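(* Let $n \in \mathbb{N}$, $n \ge 1$, and $s \in (0,1)$. There is a constant $K>0$ such that the following holds. Let $u \in \mathcal{S}'(\mathbb{R}^n)$ and assume that $$d_{s} u \in L^{1}_{od}(\mathbb{R}^{2n}) + W^{-s, \frac{n}{n-s}}_{od}(\mathbb{R}^{2n}).$$ Then $u - C_{u} \in L^{\frac{n}{n-s}}(\mathbb{R}^n)$ for some constant $C_{u} \in \mathbb{C}$ depending on $u$, together with the estimate $$\| u - C_{u} \|_{L^{\frac{n}{n-s}}(\mathbb{R}^n)} \leq K\, \| d_{s} u \|_{L^{1}_{od} + W^{-s, \frac{n}{n-s}}_{od}},$$ where $K$ is independent of $u$.
   Context: $\mathcal{S}(\mathbb{R}^m)$ is the Fréchet space of complex-valued Schwartz functions, $\mathcal{S}'(\mathbb{R}^m)$ its topological dual (tempered distributions), and $\langle\cdot,\cdot\rangle$ the bilinear pairing; functions are identified with distributions by integration. $\mathcal{S}_{od}(\mathbb{R}^{2n})$ (off-diagonal Schwartz functions) is the set of $G \in \mathcal{S}(\mathbb{R}^{2n})$, $G = G(x,y)$ with $x,y\in\mathbb{R}^n$, such that $G(x,y) = -G(y,x)$ for all $x,y$ and $\partial_x^{\alpha}\partial_y^{\beta} G(z,z) = 0$ for all $z \in \mathbb{R}^n$ and all multi-indices $\alpha,\beta \in \mathbb{N}_0^n$; it carries the subspace topology of $\mathcal{S}(\mathbb{R}^{2n})$, and $\mathcal{S}'_{od}(\mathbb{R}^{2n})$ is its topological dual. For $s\in\mathbb{R}$ and $G \in \mathcal{S}_{od}(\mathbb{R}^{2n})$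 set $\operatorname{div}_{s} G(x) := \int_{\mathbb{R}^n} \frac{2G(x,y)}{|x-y|^{s}} \frac{dy}{|x-y|^n}$; this defines a continuous linear map $\mathcal{S}_{od}(\mathbb{R}^{2n}) \to \mathcal{S}(\mathbb{R}^n)$. For $u \in \mathcal{S}'(\mathbb{R}^n)$ the distributional fractional gradient $d_{s}u \in \mathcal{S}'_{od}(\mathbb{R}^{2n})$ is defined by $\langle d_{s} u, G\rangle := \langle u, \operatorname{div}_{s} G\rangle$ for $G \in \mathcal{S}_{od}(\mathbb{R}^{2n})$. $L^1_{od}(\mathbb{R}^{2n})$ is the space of measurable functions $F$ on $\mathbb{R}^{2n}$ with $F(x,y) = -F(y,x)$ and $\|F\|_{L^1_{od}} := \int_{\mathbb{R}^n}\int_{\mathbb{R}^n} |F(x,y)| \frac{dx\,dy}{|x-y|^n} < \infty$; such an $F$ is identified with the element of $\mathcal{S}'_{od}(\mathbb{R}^{2n})$ given by $\langle F, G\rangle := \int_{\mathbb{R}^n}\int_{\mathbb{R}^n} F(x,y) G(x,y) \frac{dx\,dy}{|x-y|^n}$. For $p \in [1,\infty)$, $W^{-s,p}_{od}(\mathbb{R}^{2n}) := \{ U \in \mathcal{S}'_{od}(\mathbb{R}^{2n}) : U = d_{s} v \text{ for some } v \in L^p(\mathbb{R}^n)\}$, with norm $\|U\|_{W^{-s,p}_{od}} := \|v\|_{L^p}$ for $U = d_{s}v$, $v\in L^p(\mathbb{R}^n)$ (such $v$ is unique). The sum $L^{1}_{od} + W^{-s,p}_{od}$ is taken inside $\mathcal{S}'_{od}(\mathbb{R}^{2n})$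 and normed by $\|T\|_{L^{1}_{od} + W^{-s,p}_{od}} := \inf\{\|U\|_{L^1_{od}} + \|V\|_{W^{-s,p}_{od}} : T = U+V,\ U\in L^1_{od}(\mathbb{R}^{2n}),\ V\in W^{-s,p}_{od}(\mathbb{R}^{2n})\}$. *)

theory Defs
  imports "HOL-Analysis.Analysis"
begin

section \<open>Schwartz functions and tempered distributions\<close>

text \<open>A multi-index is represented by a list of coordinate directions, one entry for each
  differentiation.  For smooth functions the order of the entries is irrelevant.\<close>

primrec partials :: "'a::euclidean_space list \<Rightarrow> ('a \<Rightarrow> complex) \<Rightarrow> 'a \<Rightarrow> complex" where
  "partials [] f = f"
| "partials (b # bs) f = (\<lambda>x. frechet_derivative (partials bs f) (at x) b)"

text \<open>Differentiability of every iterated partial derivative amounts to \<open>f\<close> being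
  infinitely often continuously differentiable.\<close>

definition schwartz :: "('a::euclidean_space \<Rightarrow> complex) set" where
  "schwartz = {f. \<forall>bs \<in> lists Basis. partials bs f differentiable_on UNIV \<and>
      (\<forall>k::nat. bdd_above (range (\<lambda>x. (1 + norm x) ^ k * norm (partials bs f x))))}"

definition schwartz_seminorm :: "nat \<Rightarrow> 'a::euclidean_space list \<Rightarrow> ('a \<Rightarrow> complex) \<Rightarrow> real" where
  "schwartz_seminorm k bs f = (SUP x. (1 + norm x) ^ k * norm (partials bs f x))"

text \<open>The seminorm balls form a subbasis of the Frechet topology.\<close>

definition schwartz_topology :: "('a::euclidean_space \<Rightarrow> complex) topology" where
  "schwartz_topology = topology_generated_by
     {{g \<in> schwartz. schwartz_seminorm k bs (\<lambda>x. g x - f x) < e} | f k bs e.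
        f \<in> schwartz \<and> bs \<in> lists Basis \<and> 0 < e}"

lemma topspace_schwartz_topology [simp]:
  "topspace schwartz_topology = (schwartz :: ('a::euclidean_space \<Rightarrow> complex) set)"
proof -
  have "f \<in> {g \<in> schwartz. schwartz_seminorm 0 [] (\<lambda>x. g x - f x) < 1}"
    if "f \<in> schwartz" for f :: "'a \<Rightarrow> complex"
    using that by (simp add: schwartz_seminorm_def)
  moreover have "[] \<in> lists (Basis :: 'a set)" "(0::real) < 1" by simp_all
  ultimately show ?thesis
    unfolding schwartz_topology_def topology_generated_by_topspace by blast
qed

text \<open>Functionals take the value \<^const>\<open>undefined\<close> outside the space, so that equality of
  functionals is equality of functions.\<close>

definition topological_dual :: "('b \<Rightarrow> complex) topology \<Rightarrow> (('b \<Rightarrow> complex) \<Rightarrow> complex) set" where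
  "topological_dual X = {T \<in> extensional (topspace X).
     (\<forall>f \<in> topspace X. \<forall>g \<in> topspace X. T (\<lambda>x. f x + g x) = T f + T g) \<and>
     (\<forall>f \<in> topspace X. \<forall>c. T (\<lambda>x. c * f x) = c * T f) \<and>
     continuous_map X euclidean T}"

definition tempered :: "(('a::euclidean_space \<Rightarrow> complex) \<Rightarrow> complex) set" where
  "tempered = topological_dual schwartz_topology"

definition distr_of_fun :: "('a::euclidean_space \<Rightarrow> complex) \<Rightarrow> ('a \<Rightarrow> complex) \<Rightarrow> complex" where
  "distr_of_fun f = (\<lambda>\<phi> \<in> schwartz. LINT x|lebesgue. f x * \<phi> x)"

definition Lp :: "real \<Rightarrow> ('a::euclidean_space \<Rightarrow> complex) set" where
  "Lp p = {f \<in> borel_measurable lebesgue. integrable lebesgue (\<lambda>x. norm (f x) powr p)}"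

definition Lp_norm :: "real \<Rightarrow> ('a::euclidean_space \<Rightarrow> complex) \<Rightarrow> real" where
  "Lp_norm p f = (LINT x|lebesgue. norm (f x) powr p) powr (1 / p)"


section \<open>Off-diagonal functions and distributions\<close>

definition schwartz_od :: "((real^'n) \<times> (real^'n) \<Rightarrow> complex) set" where
  "schwartz_od = {G \<in> schwartz. (\<forall>x y. G (x, y) = - G (y, x)) \<and>
     (\<forall>bs \<in> lists Basis. \<forall>z. partials bs G (z, z) = 0)}"

definition schwartz_od_topology :: "((real^'n) \<times> (real^'n) \<Rightarrow> complex) topology" where
  "schwartz_od_topology = subtopology schwartz_topology schwartz_od"

lemma topspace_schwartz_od_topology [simp]: "topspace schwartz_od_topology = schwartz_od"
  by (auto simp: schwartz_od_topology_def schwartz_od_def)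

definition tempered_od :: "(((real^'n) \<times> (real^'n) \<Rightarrow> complex) \<Rightarrow> complex) set" where
  "tempered_od = topological_dual schwartz_od_topology"

text \<open>In the integrands below the value on the (null) diagonal is \<open>0\<close>, because
  division by zero yields zero.\<close>

definition frac_div :: "real \<Rightarrow> ((real^'n) \<times> (real^'n) \<Rightarrow> complex) \<Rightarrow> real^'n \<Rightarrow> complex" where
  "frac_div s G x = (LINT y|lebesgue.
     2 * G (x, y) / of_real (norm (x - y) powr s) / of_real (norm (x - y) ^ CARD('n)))"

definition frac_grad ::
  "real \<Rightarrow> ((real^'n \<Rightarrow> complex) \<Rightarrow> complex) \<Rightarrow> ((real^'n) \<times> (real^'n) \<Rightarrow> complex) \<Rightarrow> complex" where
  "frac_grad s u = (\<lambda>G \<in> schwartz_od. u (frac_div s G))"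

definition L1_od :: "((real^'n) \<times> (real^'n) \<Rightarrow> complex) set" where
  "L1_od = {F \<in> borel_measurable lebesgue. (\<forall>x y. F (x, y) = - F (y, x)) \<and>
     integrable lebesgue (\<lambda>(x, y). norm (F (x, y)) / norm (x - y) ^ CARD('n))}"

definition L1_od_norm :: "((real^'n) \<times> (real^'n) \<Rightarrow> complex) \<Rightarrow> real" where
  "L1_od_norm F = (LINT (x, y)|lebesgue. norm (F (x, y)) / norm (x - y) ^ CARD('n))"

definition distr_of_L1_od ::
  "((real^'n) \<times> (real^'n) \<Rightarrow> complex) \<Rightarrow> ((real^'n) \<times> (real^'n) \<Rightarrow> complex) \<Rightarrow> complex" where
  "distr_of_L1_od F = (\<lambda>G \<in> schwartz_od.
     LINT (x, y)|lebesgue. F (x, y) * G (x, y) / of_real (norm (x - y) ^ CARD('n)))"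

text \<open>\<open>W_od s p\<close> stands for \<open>W\<^sup>-\<^sup>s\<^sup>,\<^sup>p\<close>, the image of \<open>L\<^sup>p\<close> under the
  fractional gradient of order \<open>s\<close>.\<close>

definition W_od :: "real \<Rightarrow> real \<Rightarrow> (((real^'n) \<times> (real^'n) \<Rightarrow> complex) \<Rightarrow> complex) set" where
  "W_od s p = {U \<in> tempered_od. \<exists>v \<in> Lp p. U = frac_grad s (distr_of_fun v)}"

definition W_od_norm ::
  "real \<Rightarrow> real \<Rightarrow> (((real^'n) \<times> (real^'n) \<Rightarrow> complex) \<Rightarrow> complex) \<Rightarrow> real" where
  "W_od_norm s p U =
     (THE r. \<exists>v \<in> Lp p. U = frac_grad s (distr_of_fun v) \<and> r = Lp_norm p v)"

definition is_decomposition_od ::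
  "real \<Rightarrow> real \<Rightarrow> (((real^'n) \<times> (real^'n) \<Rightarrow> complex) \<Rightarrow> complex) \<Rightarrow>
   ((real^'n) \<times> (real^'n) \<Rightarrow> complex) \<Rightarrow> (((real^'n) \<times> (real^'n) \<Rightarrow> complex) \<Rightarrow> complex) \<Rightarrow> bool" where
  "is_decomposition_od s p T F V \<longleftrightarrow> F \<in> L1_od \<and> V \<in> W_od s p \<and>
     T = (\<lambda>G \<in> schwartz_od. distr_of_L1_od F G + V G)"

definition L1_plus_W_od ::
  "real \<Rightarrow> real \<Rightarrow> (((real^'n) \<times> (real^'n) \<Rightarrow> complex) \<Rightarrow> complex) set" where
  "L1_plus_W_od s p = {T \<in> tempered_od. \<exists>F V. is_decomposition_od s p T F V}"

definition L1_plus_W_od_norm ::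
  "real \<Rightarrow> real \<Rightarrow> (((real^'n) \<times> (real^'n) \<Rightarrow> complex) \<Rightarrow> complex) \<Rightarrow> real" where
  "L1_plus_W_od_norm s p T =
     Inf {L1_od_norm F + W_od_norm s p V | F V. is_decomposition_od s p T F V}"

end

theory Submission
  imports Defs
begin

text \<open>The identity \<open>d\<^sub>s u = F + d\<^sub>s v\<close> says that \<open>w = u - v\<close> satisfies
  \<open>w(x) - w(y) = |x - y|\<^sup>s F(x, y)\<close> away from the diagonal, so that the Gagliardo seminorm
  \<open>\<integral>\<integral> |w(x) - w(y)| / |x - y|\<^sup>n\<^sup>+\<^sup>s\<close> equals the norm of \<open>F\<close>; the theorem is then the
  fractional Sobolev inequality with exponent \<open>p = n / (n - s)\<close>, applied to \<open>w\<close>.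

  The first point is to see that \<open>w\<close> is a function.  Let \<open>\<phi>\<close> and \<open>\<psi>\<close> be Schwartz functions whose
  supports lie at positive distance.  Then
  \<open>G(x, y) = |x - y|\<^sup>n\<^sup>+\<^sup>s (\<phi>(x) \<psi>(y) - \<psi>(x) \<phi>(y))\<close> is an off-diagonal Schwartz function
  (\<open>dist_kernel_schwartz\<close>, \<open>od_test_schwartz_od\<close>), and its divergence is the combination
  \<open>2 (\<integral>\<psi>) \<phi> - 2 (\<integral>\<phi>) \<psi>\<close> (\<open>frac_div_od_test\<close>).  Testing with \<open>G\<close> gives
  \<open>(\<integral>\<psi>) w(\<phi>) - (\<integral>\<phi>) w(\<psi>) = \<integral>\<integral> K(x, y) \<phi>(x) \<psi>(y)\<close> with \<open>K(x, y) = F(x, y) |x - y|\<^sup>s\<close>.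
  Splitting an arbitrary \<open>\<phi>\<close> by a smooth step into two pieces, each separated from a fixed
  normalized bump \<open>\<psi>\<close>, turns this identity into an explicit formula for \<open>w\<close> as integration
  against a function \<open>g\<close>; testing with bumps that approximate small cubes then yields
  \<open>K(x, y) = g(x) - g(y)\<close> almost everywhere (\<open>separated_kernel_representation\<close>).

  For the Sobolev inequality (\<open>frac_sobolev\<close>), the means of \<open>g\<close> over balls of radius \<open>2\<^sup>k\<close>
  differ by at most a multiple of \<open>2\<^sup>k\<^sup>(\<^sup>s\<^sup>-\<^sup>n\<^sup>)\<close>, hence converge to a constant \<open>C\<close> that does not
  depend on the centre, and all level sets \<open>{|g - C| > t}\<close> have finite measure.  A set \<open>E\<close> of finite
  measure obeys the isoperimetric inequality \<open>Per\<^sub>s E \<ge> c |E|\<^sup>1\<^sup>/\<^sup>p\<close>, and the coarea inequality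
  bounds the integral of the perimeters of the level sets by the seminorm.

  The constant and the function in the conclusion are determined by \<open>u\<close>
  (\<open>Lp_plus_const_unique\<close>), so the bound obtained from one decomposition
  of \<open>d\<^sub>s u\<close> holds for all of them and passes to the infimum.  The same uniqueness identifies the norm
  of \<open>d\<^sub>s v\<close> with the norm of \<open>v\<close> (\<open>W_od_norm_frac_grad\<close>).\<close>

section \<open>Smooth functions with controlled derivatives\<close>

definition fast_decay :: "('a::euclidean_space \<Rightarrow> complex) \<Rightarrow> bool" where
  "fast_decay f \<longleftrightarrow> (\<forall>k::nat. \<exists>C. \<forall>x. (1 + norm x) ^ k * norm (f x) \<le> C)"

definition poly_growth :: "('a::euclidean_space \<Rightarrow> complex) \<Rightarrow> bool" where
  "poly_growth f \<longleftrightarrow> (\<exists>k::nat. \<exists>C. \<forall>x. norm (f x) \<le> C * (1 + norm x) ^ k)"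

text \<open>Differentiability is organised by order rather than by multi-index, with the first derivative
  taken innermost, because this makes Leibniz and chain rules inductions on the order.  The
  parameter \<open>Q\<close> is the growth condition imposed on all derivatives: rapid decay gives Schwartz
  functions, polynomial growth gives their multipliers.\<close>

primrec smooth_upto ::
  "(('a::euclidean_space \<Rightarrow> complex) \<Rightarrow> bool) \<Rightarrow> nat \<Rightarrow> ('a \<Rightarrow> complex) \<Rightarrow> bool" where
  "smooth_upto Q 0 f \<longleftrightarrow> Q f"
| "smooth_upto Q (Suc k) f \<longleftrightarrow> Q f \<and> f differentiable_on UNIV \<and>
     (\<forall>b\<in>Basis. smooth_upto Q k (\<lambda>x. frechet_derivative f (at x) b))"

lemma smooth_upto_imp: "smooth_upto Q k f \<Longrightarrow> Q f"
  by (cases k) auto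

lemma smooth_upto_SucI:
  assumes "Q f" and "\<And>x. (f has_derivative f' x) (at x)"
    and "\<And>b. b \<in> Basis \<Longrightarrow> smooth_upto Q k (\<lambda>x. f' x b)"
  shows "smooth_upto Q (Suc k) f"
proof -
  have "frechet_derivative f (at x) = f' x" for x
    using assms(2)[of x] frechet_derivative_at by metis
  then show ?thesis
    using assms by (auto simp: differentiable_on_def differentiable_def intro: has_derivative_at_withinI)
qed

lemma smooth_upto_has_derivative:
  "smooth_upto Q (Suc k) f \<Longrightarrow> (f has_derivative frechet_derivative f (at x)) (at x)"
  by (auto simp: differentiable_on_def frechet_derivative_works)

lemma smooth_upto_SucD: "smooth_upto Q (Suc k) f \<Longrightarrow> smooth_upto Q k f"
proof (induction k arbitrary: f)
  case (Suc k)
  show ?case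
    using Suc.prems Suc.IH by (auto simp del: smooth_upto.simps(1) dest: smooth_upto_imp)
qed (auto dest: smooth_upto_imp)

lemma smooth_upto_add:
  assumes Q: "\<And>f g. Q f \<Longrightarrow> Q g \<Longrightarrow> Q (\<lambda>x. f x + g x)"
  shows "smooth_upto Q k f \<Longrightarrow> smooth_upto Q k g \<Longrightarrow> smooth_upto Q k (\<lambda>x. f x + g x)"
proof (induction k arbitrary: f g)
  case (Suc k)
  show ?case
  proof (rule smooth_upto_SucI)
    show "Q (\<lambda>x. f x + g x)" using Suc.prems Q by auto
    show "((\<lambda>x. f x + g x) has_derivative
        (\<lambda>h. frechet_derivative f (at x) h + frechet_derivative g (at x) h)) (at x)" for x
      using Suc.prems by (intro has_derivative_add smooth_upto_has_derivative)
    show "smooth_upto Q k (\<lambda>x. frechet_derivative f (at x) b + frechet_derivative g (at x) b)"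
      if "b \<in> Basis" for b
      using Suc.prems Suc.IH that by auto
  qed
qed (use Q in auto)

text \<open>By the Leibniz rule a derivative of the product is a sum of two products of the same kind with one
  order of differentiability less.\<close>

lemma smooth_upto_mult:
  assumes Q: "\<And>f g. Q1 f \<Longrightarrow> Q2 g \<Longrightarrow> Q3 (\<lambda>x. f x * g x)"
    and Q3: "\<And>f g. Q3 f \<Longrightarrow> Q3 g \<Longrightarrow> Q3 (\<lambda>x. f x + g x)"
  shows "smooth_upto Q1 k f \<Longrightarrow> smooth_upto Q2 k g \<Longrightarrow> smooth_upto Q3 k (\<lambda>x. f x * g x)"
proof (induction k arbitrary: f g)
  case (Suc k)
  show ?case
  proof (rule smooth_upto_SucI)
    show "Q3 (\<lambda>x. f x * g x)" using Suc.prems Q by auto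
    show "((\<lambda>x. f x * g x) has_derivative
        (\<lambda>h. f x * frechet_derivative g (at x) h + frechet_derivative f (at x) h * g x)) (at x)" for x
      using Suc.prems by (intro has_derivative_mult smooth_upto_has_derivative)
    show "smooth_upto Q3 k (\<lambda>x. f x * frechet_derivative g (at x) b + frechet_derivative f (at x) b * g x)"
      if "b \<in> Basis" for b
      using Suc.prems that smooth_upto_SucD[OF Suc.prems(1)] smooth_upto_SucD[OF Suc.prems(2)]
      by (intro smooth_upto_add[of Q3, OF Q3] Suc.IH) auto
  qed
qed (use Q in auto)

lemma partials_snoc: "partials (bs @ [b]) f = partials bs (\<lambda>x. frechet_derivative f (at x) b)"
  by (induction bs) auto

text \<open>The two descriptions peel off derivatives from opposite ends: \<open>partials\<close> from the outside,
  \<open>smooth_upto\<close> from the inside.\<close>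

lemma schwartz_iff_smooth_upto: "f \<in> schwartz \<longleftrightarrow> (\<forall>k. smooth_upto fast_decay k f)"
proof -
  have bdd: "(\<forall>k::nat. bdd_above (range (\<lambda>x. (1 + norm x) ^ k * norm (g x)))) \<longleftrightarrow> fast_decay g"
    for g :: "'a \<Rightarrow> complex"
    by (auto simp: fast_decay_def bdd_above_def)
  have sch: "f \<in> schwartz \<longleftrightarrow> (\<forall>bs\<in>lists Basis. partials bs f differentiable_on UNIV \<and> fast_decay (partials bs f))"
    for f :: "'a \<Rightarrow> complex"
    by (simp add: schwartz_def bdd)
  have deriv: "(\<lambda>x. frechet_derivative f (at x) b) \<in> schwartz" if "f \<in> schwartz" "b \<in> Basis"
    for f :: "'a \<Rightarrow> complex" and b
    unfolding sch
  proof
    fix bs :: "'a list" assume "bs \<in> lists Basis"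
    then have "bs @ [b] \<in> lists Basis" using that by auto
    then show "partials bs (\<lambda>x. frechet_derivative f (at x) b) differentiable_on UNIV \<and>
        fast_decay (partials bs (\<lambda>x. frechet_derivative f (at x) b))"
      using that(1) unfolding sch partials_snoc[symmetric] by blast
  qed
  have fwd: "smooth_upto fast_decay k f" if "f \<in> schwartz" for f :: "'a \<Rightarrow> complex" and k
    using that
  proof (induction k arbitrary: f)
    case 0
    then show ?case unfolding sch by (metis partials.simps(1) lists.Nil smooth_upto.simps(1))
  next
    case (Suc k)
    from Suc.prems have "f differentiable_on UNIV" "fast_decay f"
      unfolding sch by (metis partials.simps(1) lists.Nil)+
    then show ?case using Suc.IH[OF deriv[OF Suc.prems]] by simp
  qed
  have bwd: "partials bs f differentiable_on UNIV \<and> fast_decay (partials bs f)"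
    if "bs \<in> lists Basis" "\<forall>k. smooth_upto fast_decay k f" for f :: "'a \<Rightarrow> complex" and bs
    using that
  proof (induction bs arbitrary: f rule: rev_induct)
    case Nil
    then have "smooth_upto fast_decay (Suc 0) f" by blast
    then show ?case by simp
  next
    case (snoc b bs)
    have "smooth_upto fast_decay k (\<lambda>x. frechet_derivative f (at x) b)" for k
      using snoc.prems(2)[rule_format, of "Suc k"] snoc.prems(1) by simp
    then show ?case using snoc by (simp add: partials_snoc)
  qed
  show ?thesis using fwd bwd unfolding sch by blast
qed

text \<open>The smooth multipliers of the Schwartz space, usually written \<open>\<O>\<^sub>M\<close>.\<close>

definition moderate :: "('a::euclidean_space \<Rightarrow> complex) set" where
  "moderate = {f. \<forall>k. smooth_upto poly_growth k f}"

lemma poly_growth_add: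
  assumes "poly_growth f" "poly_growth g" shows "poly_growth (\<lambda>x. f x + g x)"
proof -
  obtain k C l D where f: "\<And>x. norm (f x) \<le> C * (1 + norm x) ^ k" and g: "\<And>x. norm (g x) \<le> D * (1 + norm x) ^ l"
    using assms unfolding poly_growth_def by metis
  have CD: "C \<ge> 0" "D \<ge> 0" using order_trans[OF norm_ge_zero f[of 0]] order_trans[OF norm_ge_zero g[of 0]] by auto
  have "norm (f x + g x) \<le> (C + D) * (1 + norm x) ^ (k + l)" for x
  proof -
    have "norm (f x + g x) \<le> C * (1 + norm x) ^ k + D * (1 + norm x) ^ l"
      using f[of x] g[of x] norm_triangle_ineq[of "f x" "g x"] by linarith
    also have "\<dots> \<le> C * (1 + norm x) ^ (k + l) + D * (1 + norm x) ^ (k + l)"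
      using CD by (intro add_mono mult_left_mono power_increasing) auto
    finally show ?thesis by (simp add: algebra_simps)
  qed
  then show ?thesis unfolding poly_growth_def by blast
qed

lemma poly_growth_mult:
  assumes "poly_growth f" "poly_growth g" shows "poly_growth (\<lambda>x. f x * g x)"
proof -
  obtain k C l D where f: "\<And>x. norm (f x) \<le> C * (1 + norm x) ^ k" and g: "\<And>x. norm (g x) \<le> D * (1 + norm x) ^ l"
    using assms unfolding poly_growth_def by metis
  have "norm (f x * g x) \<le> (C * D) * (1 + norm x) ^ (k + l)" for x
    using mult_mono'[OF f[of x] g[of x]] by (simp add: norm_mult power_add mult_ac)
  then show ?thesis unfolding poly_growth_def by blast
qed

lemma fast_decay_add:
  assumes "fast_decay f" "fast_decay g" shows "fast_decay (\<lambda>x. f x + g x)"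
  unfolding fast_decay_def
proof
  fix k
  obtain C D where f: "\<And>x. (1 + norm x) ^ k * norm (f x) \<le> C" and g: "\<And>x. (1 + norm x) ^ k * norm (g x) \<le> D"
    using assms unfolding fast_decay_def by metis
  have "(1 + norm x) ^ k * norm (f x + g x) \<le> C + D" for x
  proof -
    have "(1 + norm x) ^ k * norm (f x + g x) \<le> (1 + norm x) ^ k * (norm (f x) + norm (g x))"
      by (intro mult_left_mono norm_triangle_ineq) auto
    then show ?thesis using f[of x] g[of x] by (simp add: algebra_simps)
  qed
  then show "\<exists>C. \<forall>x. (1 + norm x) ^ k * norm (f x + g x) \<le> C" by blast
qed

lemma fast_decay_mult_poly_growth:
  assumes "poly_growth f" "fast_decay g" shows "fast_decay (\<lambda>x. f x * g x)"
  unfolding fast_decay_def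
proof
  fix k
  obtain l C where f: "\<And>x. norm (f x) \<le> C * (1 + norm x) ^ l"
    using assms unfolding poly_growth_def by metis
  obtain D where g: "\<And>x. (1 + norm x) ^ (k + l) * norm (g x) \<le> D"
    using assms unfolding fast_decay_def by metis
  have C: "C \<ge> 0" using order_trans[OF norm_ge_zero f[of 0]] by auto 
  have "(1 + norm x) ^ k * norm (f x * g x) \<le> C * D" for x
  proof -
    have "(1 + norm x) ^ k * norm (f x * g x) \<le> (1 + norm x) ^ k * (C * (1 + norm x) ^ l * norm (g x))"
      unfolding norm_mult by (intro mult_left_mono mult_right_mono f) auto
    also have "\<dots> = C * ((1 + norm x) ^ (k + l) * norm (g x))" by (simp add: power_add)
    also have "\<dots> \<le> C * D" by (intro mult_left_mono g C)
    finally show ?thesis .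
  qed
  then show "\<exists>C. \<forall>x. (1 + norm x) ^ k * norm (f x * g x) \<le> C" by blast
qed

lemma fast_decay_of_bounded_support:
  assumes "poly_growth f" "bounded A" "\<And>x. x \<notin> A \<Longrightarrow> f x = 0"
  shows "fast_decay f"
  unfolding fast_decay_def
proof
  fix k
  obtain l C where f: "\<And>x. norm (f x) \<le> C * (1 + norm x) ^ l"
    using assms unfolding poly_growth_def by metis
  obtain R where R: "R > 0" "\<And>x. x \<in> A \<Longrightarrow> norm x \<le> R" using assms bounded_pos by metis
  have C: "C \<ge> 0" using order_trans[OF norm_ge_zero f[of 0]] by auto
  have "(1 + norm x) ^ k * norm (f x) \<le> (1 + R) ^ k * (C * (1 + R) ^ l)" for x
  proof (cases "x \<in> A")
    case True
    then have "(1 + norm x) ^ k * norm (f x) \<le> (1 + R) ^ k * (C * (1 + norm x) ^ l)"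
      using R(1) R(2)[OF True] C f by (intro mult_mono power_mono) auto
    also have "\<dots> \<le> (1 + R) ^ k * (C * (1 + R) ^ l)"
      using R(1) R(2)[OF True] C by (intro mult_left_mono power_mono) auto
    finally show ?thesis .
  qed (use assms C R in auto)
  then show "\<exists>C. \<forall>x. (1 + norm x) ^ k * norm (f x) \<le> C" by blast
qed

lemma moderate_add: "f \<in> moderate \<Longrightarrow> g \<in> moderate \<Longrightarrow> (\<lambda>x. f x + g x) \<in> moderate"
  unfolding moderate_def using smooth_upto_add[of poly_growth, OF poly_growth_add] by blast

lemma moderate_mult: "f \<in> moderate \<Longrightarrow> g \<in> moderate \<Longrightarrow> (\<lambda>x. f x * g x) \<in> moderate"
  unfolding moderate_def
  using smooth_upto_mult[of poly_growth poly_growth poly_growth, OF poly_growth_mult poly_growth_add]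
  by blast

lemma schwartz_add: "f \<in> schwartz \<Longrightarrow> g \<in> schwartz \<Longrightarrow> (\<lambda>x. f x + g x) \<in> schwartz"
  unfolding schwartz_iff_smooth_upto using smooth_upto_add[of fast_decay, OF fast_decay_add] by blast

lemma moderate_mult_schwartz: "f \<in> moderate \<Longrightarrow> g \<in> schwartz \<Longrightarrow> (\<lambda>x. f x * g x) \<in> schwartz"
  unfolding moderate_def schwartz_iff_smooth_upto
  using smooth_upto_mult[of poly_growth fast_decay fast_decay,
      OF fast_decay_mult_poly_growth fast_decay_add]
  by blast

lemma smooth_upto_const: "smooth_upto poly_growth k (\<lambda>_. c :: complex)"
proof (induction k arbitrary: c)
  case 0
  have "poly_growth (\<lambda>_. c)" unfolding poly_growth_def by (intro exI[of _ 0] exI[of _ "norm c"]) simp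
  then show ?case by simp
next
  case (Suc k)
  show ?case
    by (rule smooth_upto_SucI[where f' = "\<lambda>_ _. 0"]) (use Suc in \<open>auto dest: smooth_upto_imp\<close>)
qed

lemma moderate_const: "(\<lambda>_. c) \<in> moderate"
  by (simp add: moderate_def smooth_upto_const)

lemma moderate_inner: "(\<lambda>x. of_real (x \<bullet> a)) \<in> moderate"
proof -
  have "smooth_upto poly_growth k (\<lambda>x. complex_of_real (x \<bullet> a))" for k
  proof (cases k)
    case 0
    have "norm (complex_of_real (x \<bullet> a)) \<le> norm a * (1 + norm x) ^ 1" for x
      using order_trans[OF Cauchy_Schwarz_ineq2[of x a], of "norm a + norm a * norm x"]
      by (simp add: algebra_simps)
    then have "poly_growth (\<lambda>x. complex_of_real (x \<bullet> a))" unfolding poly_growth_def by blast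
    then show ?thesis using 0 by simp
  next
    case (Suc j)
    have "norm (complex_of_real (x \<bullet> a)) \<le> norm a * (1 + norm x) ^ 1" for x
      using order_trans[OF Cauchy_Schwarz_ineq2[of x a], of "norm a + norm a * norm x"]
      by (simp add: algebra_simps)
    then have "poly_growth (\<lambda>x. complex_of_real (x \<bullet> a))" unfolding poly_growth_def by blast
    then show ?thesis unfolding Suc
      by (intro smooth_upto_SucI[where f' = "\<lambda>_ h. of_real (h \<bullet> a)"] smooth_upto_const)
        (auto intro!: derivative_eq_intros)
  qed
  then show ?thesis by (simp add: moderate_def)
qed

lemma schwartz_cmult: "f \<in> schwartz \<Longrightarrow> (\<lambda>x. c * f x) \<in> schwartz"
  using moderate_mult_schwartz[OF moderate_const] .

lemma schwartz_uminus: "f \<in> schwartz \<Longrightarrow> (\<lambda>x. - f x) \<in> schwartz"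
  using schwartz_cmult[of f "-1"] by simp

lemma schwartz_diff: "f \<in> schwartz \<Longrightarrow> g \<in> schwartz \<Longrightarrow> (\<lambda>x. f x - g x) \<in> schwartz"
  using schwartz_add[of f "\<lambda>x. - g x"] schwartz_uminus[of g] by simp

text \<open>The derivative of \<open>1 / f\<close> is \<open>- f' / f\<^sup>2\<close>, a product of functions already known to be smooth of
  one order less.\<close>

lemma smooth_upto_inverse:
  assumes "f \<in> moderate" "0 < c" "\<And>x. c \<le> norm (f x)"
  shows "smooth_upto poly_growth k (\<lambda>x. inverse (f x))"
proof -
  have *: "poly_growth (\<lambda>x. inverse (f x))"
    unfolding poly_growth_def
  proof (rule exI[of _ 0], rule exI[of _ "inverse c"], rule allI)
    show "norm (inverse (f x)) \<le> inverse c * (1 + norm x) ^ 0" for x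
      using le_imp_inverse_le[OF assms(3)[of x] assms(2)] by (simp add: norm_inverse)
  qed
  have nz: "f x \<noteq> 0" for x
    using assms(2) assms(3)[of x] by auto
  show ?thesis
  proof (induction k)
    case 0
    then show ?case using * by simp
  next
    case (Suc k)
    have f: "smooth_upto poly_growth (Suc k) f" using assms(1) unfolding moderate_def by blast
    show ?case
    proof (rule smooth_upto_SucI)
      show "poly_growth (\<lambda>x. inverse (f x))" by (rule *)
      show "((\<lambda>x. inverse (f x)) has_derivative
          (\<lambda>h. - 1 * (inverse (f x) * frechet_derivative f (at x) h * inverse (f x)))) (at x)" for x
        using Deriv.has_derivative_inverse[OF _ smooth_upto_has_derivative[OF f, of x]] nz[of x] by simp
      show "smooth_upto poly_growth k
          (\<lambda>x. - 1 * (inverse (f x) * frechet_derivative f (at x) b * inverse (f x)))"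
        if "b \<in> Basis" for b
        using f that Suc.IH
        by (intro smooth_upto_mult[of poly_growth poly_growth poly_growth,
              OF poly_growth_mult poly_growth_add] smooth_upto_const) auto
    qed
  qed
qed

lemma moderate_inverse:
  assumes "f \<in> moderate" "0 < c" "\<And>x. c \<le> norm (f x)"
  shows "(\<lambda>x. inverse (f x)) \<in> moderate"
  using smooth_upto_inverse[OF assms] by (simp add: moderate_def)

lemma schwartz_has_derivative:
  "f \<in> schwartz \<Longrightarrow> (f has_derivative frechet_derivative f (at x)) (at x)"
  unfolding schwartz_iff_smooth_upto using smooth_upto_has_derivative by blast

lemma schwartz_frechet_derivative:
  "f \<in> schwartz \<Longrightarrow> b \<in> Basis \<Longrightarrow> (\<lambda>x. frechet_derivative f (at x) b) \<in> schwartz"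
  unfolding schwartz_iff_smooth_upto using smooth_upto.simps(2) by blast

lemma moderate_has_derivative:
  "f \<in> moderate \<Longrightarrow> (f has_derivative frechet_derivative f (at x)) (at x)"
  unfolding moderate_def using smooth_upto_has_derivative by blast

lemma frechet_derivative_eq_0_off_closed:
  fixes f :: "'a::euclidean_space \<Rightarrow> complex"
  assumes "closed A" "\<And>x. x \<notin> A \<Longrightarrow> f x = 0" "x \<notin> A"
  shows "frechet_derivative f (at x) = (\<lambda>_. 0)"
proof -
  have "(f has_derivative (\<lambda>_. 0)) (at x)"
    by (rule has_derivative_transform_within_open[of "\<lambda>_. 0" _ _ _ "- A"])
      (use assms in \<open>auto simp: open_Compl\<close>)
  then show ?thesis using frechet_derivative_at by metis
qed

text \<open>The complement of the closed set is open, so vanishing there is inherited by all derivatives.\<close>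

lemma partials_eq_0_off_closed:
  assumes "closed A" "\<And>x. x \<notin> A \<Longrightarrow> f x = 0" "x \<notin> A"
  shows "partials bs f x = 0"
  using assms(3)
proof (induction bs arbitrary: x)
  case (Cons b bs)
  show ?case
    using frechet_derivative_eq_0_off_closed[OF assms(1) Cons.IH Cons.prems] by simp
qed (use assms in auto)

lemma schwartz_if_bounded_support:
  assumes "f \<in> moderate" "closed A" "bounded A" "\<And>x. x \<notin> A \<Longrightarrow> f x = 0"
  shows "f \<in> schwartz"
proof -
  have "smooth_upto fast_decay k f" if "smooth_upto poly_growth k f" "\<And>x. x \<notin> A \<Longrightarrow> f x = 0" for k f
    using that
  proof (induction k arbitrary: f)
    case 0
    then show ?case using fast_decay_of_bounded_support assms(3) by auto
  next
    case (Suc k)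
    show ?case
    proof (rule smooth_upto_SucI)
      show "fast_decay f" using Suc.prems fast_decay_of_bounded_support assms(3) by auto
      show "(f has_derivative frechet_derivative f (at x)) (at x)" for x
        using smooth_upto_has_derivative[OF Suc.prems(1)] .
      show "smooth_upto fast_decay k (\<lambda>x. frechet_derivative f (at x) b)" if "b \<in> Basis" for b
        using frechet_derivative_eq_0_off_closed[OF assms(2) Suc.prems(2)] Suc.prems(1) that
        by (intro Suc.IH) auto
    qed
  qed
  then show ?thesis
    using assms unfolding moderate_def schwartz_iff_smooth_upto by blast
qed

section \<open>Flat functions, bumps and the separated test kernel\<close>

text \<open>The functions \<open>e\<^sup>-\<^sup>1\<^sup>/\<^sup>t / t\<^sup>j\<close>, extended by zero to \<open>t \<le> 0\<close>.  Including the negative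
  powers makes the family closed under differentiation.\<close>

definition flat :: "nat \<Rightarrow> real \<Rightarrow> real" where
  "flat j t = (if t \<le> 0 then 0 else exp (- 1 / t) / t ^ j)"

lemma flat_nonneg: "0 \<le> flat j t"
  by (simp add: flat_def)

text \<open>The term of order \<open>j\<close> in the power series of \<open>e\<^sup>1\<^sup>/\<^sup>t\<close> is \<open>t\<^sup>-\<^sup>j / j!\<close>.\<close>

lemma flat_le: "flat j t \<le> fact j"
proof (cases "t \<le> 0")
  case False
  then have "(1 / t) ^ j / fact j \<le> exp (1 / t)"
    using sum_le_suminf[OF summable_exp_generic[of "1 / t"], of "{j}"]
    by (simp add: exp_def divide_inverse scaleR_conv_of_real mult.commute)
  then have "1 / t ^ j \<le> fact j * exp (1 / t)"
    using pos_divide_le_eq[of "fact j" "(1 / t) ^ j" "exp (1 / t)"]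
    by (simp add: power_one_over mult.commute del: exp_le_cancel_iff)
  then have "1 / t ^ j * exp (- (1 / t)) \<le> fact j * exp (1 / t) * exp (- (1 / t))"
    by (intro mult_right_mono) auto
  also have "\<dots> = fact j" by (simp add: exp_minus)
  finally show ?thesis using False by (simp add: flat_def field_simps)
qed (simp add: flat_def)

lemma flat_eq_power_mult: "flat j t = t ^ i * flat (j + i) t"
  by (simp add: flat_def power_add)

lemma flat_has_derivative:
  "(flat j has_real_derivative (flat (j + 2) t - real j * flat (j + 1) t)) (at t)"
proof -
  consider "t < 0" | "t > 0" | "t = 0" by linarith
  then show ?thesis
  proof cases
    case 1
    have "((\<lambda>_. 0) has_real_derivative 0) (at t)" by simp
    then have "(flat j has_real_derivative 0) (at t)"
      by (rule has_field_derivative_transform_within_open[where S = "{..<0}"]) (use 1 in \<open>auto simp: flat_def\<close>)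
    then show ?thesis using 1 by (simp add: flat_def)
  next
    case 2
    have p: "((\<lambda>t. t ^ j) has_real_derivative real j * t ^ j / t) (at t)"
      using DERIV_pow[of j t UNIV] 2 by (cases j) auto
    have e: "((\<lambda>t. exp (- 1 / t)) has_real_derivative exp (- 1 / t) / t\<^sup>2) (at t)"
      using 2 by (auto intro!: derivative_eq_intros simp: power2_eq_square)
    have "((\<lambda>t. exp (- 1 / t) / t ^ j) has_real_derivative (flat (j + 2) t - real j * flat (j + 1) t)) (at t)"
      by (rule DERIV_cong[OF DERIV_divide[OF e p]])
        (use 2 in \<open>auto simp: flat_def field_simps power2_eq_square power_add\<close>)
    then show ?thesis
      by (rule has_field_derivative_transform_within_open[where S = "{0<..}"]) (use 2 in \<open>auto simp: flat_def\<close>)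
  next
    case 3
    have "((\<lambda>s. (flat j s - flat j 0) / (s - 0)) \<longlongrightarrow> 0) (at 0)"
    proof (rule Lim_null_comparison)
      show "\<forall>\<^sub>F s in at 0. norm ((flat j s - flat j 0) / (s - 0)) \<le> fact (j + 2) * \<bar>s\<bar>"
      proof (intro always_eventually allI)
        fix s :: real
        have "\<bar>flat j s\<bar> = \<bar>s\<bar> * \<bar>s\<bar> * flat (j + 2) s"
          using flat_eq_power_mult[of j s 2] flat_nonneg[of "j+2" s] by (simp add: abs_mult power2_eq_square)
        also have "\<dots> \<le> \<bar>s\<bar> * \<bar>s\<bar> * fact (j + 2)" by (intro mult_left_mono flat_le) auto
        finally show "norm ((flat j s - flat j 0) / (s - 0)) \<le> fact (j + 2) * \<bar>s\<bar>"
          by (cases "s = 0") (simp_all add: flat_def[of _ 0] pos_divide_le_eq mult_ac del: fact_Suc abs_mult_self_eq)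
      qed
      have "((\<lambda>s. fact (j + 2) * \<bar>s\<bar>) \<longlongrightarrow> fact (j + 2) * \<bar>0 :: real\<bar>) (at 0)"
        by (intro tendsto_intros)
      then show "((\<lambda>s::real. fact (j + 2) * \<bar>s\<bar>) \<longlongrightarrow> 0) (at 0)" by simp
    qed
    then show ?thesis using 3 by (simp add: has_field_derivative_iff flat_def[of _ 0])
  qed
qed

lemma smooth_upto_cmult:
  "smooth_upto fast_decay k f \<Longrightarrow> smooth_upto fast_decay k (\<lambda>x. c * f x)"
  "smooth_upto poly_growth k f \<Longrightarrow> smooth_upto poly_growth k (\<lambda>x. c * f x)"
  using smooth_upto_mult[of poly_growth fast_decay fast_decay,
      OF fast_decay_mult_poly_growth fast_decay_add smooth_upto_const]
    smooth_upto_mult[of poly_growth poly_growth poly_growth,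
      OF poly_growth_mult poly_growth_add smooth_upto_const]
  by blast+

lemma moderate_flat: "(\<lambda>x. of_real (flat j (x \<bullet> a + c))) \<in> moderate"
proof -
  have "smooth_upto poly_growth k (\<lambda>x. complex_of_real (flat j (x \<bullet> a + c)))" for k
  proof (induction k arbitrary: j)
    case 0
    have "norm (complex_of_real (flat j (x \<bullet> a + c))) \<le> fact j * (1 + norm x) ^ 0" for x
      using flat_le[of j "x \<bullet> a + c"] flat_nonneg[of j "x \<bullet> a + c"] by simp
    then have "poly_growth (\<lambda>x. complex_of_real (flat j (x \<bullet> a + c)))"
      unfolding poly_growth_def by blast
    then show ?case by simp
  next
    case (Suc k)
    let ?l = "\<lambda>x. x \<bullet> a + c"
    show ?case
    proof (rule smooth_upto_SucI)
      show "poly_growth (\<lambda>x. complex_of_real (flat j (?l x)))" using Suc.IH smooth_upto_imp by auto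
      show "((\<lambda>x. complex_of_real (flat j (?l x))) has_derivative
          (\<lambda>h. of_real (h \<bullet> a) * (of_real (flat (j + 2) (?l x)) + - of_nat j * of_real (flat (j + 1) (?l x))))) (at x)"
        for x
      proof -
        have "((\<lambda>x. flat j (?l x)) has_derivative
            (\<lambda>h. (flat (j + 2) (?l x) - real j * flat (j + 1) (?l x)) * (h \<bullet> a))) (at x)"
          by (rule has_derivative_compose[of ?l "\<lambda>h. h \<bullet> a" x UNIV "flat j"])
            (use flat_has_derivative[of j "?l x"] in
              \<open>auto simp: has_field_derivative_def intro!: derivative_eq_intros\<close>)
        from has_derivative_of_real[OF this] show ?thesis by (simp add: algebra_simps)
      qed
      show "smooth_upto poly_growth k
          (\<lambda>x. of_real (b \<bullet> a) * (of_real (flat (j + 2) (?l x)) + - of_nat j * of_real (flat (j + 1) (?l x))))" for b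
        by (intro smooth_upto_cmult(2) smooth_upto_add[of poly_growth, OF poly_growth_add] Suc.IH)
    qed
  qed
  then show ?thesis by (simp add: moderate_def)
qed

lemma moderate_prod:
  "finite I \<Longrightarrow> (\<And>i. i \<in> I \<Longrightarrow> f i \<in> moderate) \<Longrightarrow> (\<lambda>x. \<Prod>i\<in>I. f i x) \<in> moderate"
proof (induction I rule: finite_induct)
  case (insert i I)
  have "(\<lambda>x. f i x * (\<Prod>i\<in>I. f i x)) \<in> moderate" by (intro moderate_mult insert) auto
  then show ?case using insert by simp
qed (simp add: moderate_const)

text \<open>A smooth function supported in the box; as \<open>m\<close> grows it tends to the indicator of the open box,
  because \<open>e\<^sup>-\<^sup>1\<^sup>/\<^sup>m\<^sup>t\<close> tends to \<open>1\<close> for \<open>t > 0\<close>.\<close>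

definition box_bump :: "nat \<Rightarrow> 'a::euclidean_space \<Rightarrow> 'a \<Rightarrow> 'a \<Rightarrow> real" where
  "box_bump m a b x = (\<Prod>i\<in>Basis. flat 0 (m * (x \<bullet> i - a \<bullet> i)) * flat 0 (m * (b \<bullet> i - x \<bullet> i)))"

lemma box_bump_bounds: "0 \<le> box_bump m a b x" "box_bump m a b x \<le> 1"
proof -
  have "flat 0 s * flat 0 t \<le> 1" for s t
    using mult_mono[OF flat_le[of 0 s] flat_le[of 0 t]] flat_nonneg by simp
  then show "0 \<le> box_bump m a b x" "box_bump m a b x \<le> 1"
    unfolding box_bump_def by (auto intro!: prod_nonneg prod_le_1 simp: flat_nonneg)
qed

lemma box_bump_eq_0: assumes "x \<notin> cbox a b" shows "box_bump m a b x = 0"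
proof -
  obtain i where "i \<in> Basis" and i: "x \<bullet> i - a \<bullet> i < 0 \<or> b \<bullet> i - x \<bullet> i < 0" using assms by (auto simp: mem_box)
  have "real m * (x \<bullet> i - a \<bullet> i) \<le> 0 \<or> real m * (b \<bullet> i - x \<bullet> i) \<le> 0"
    using i by (auto simp: mult_le_0_iff)
  then have "flat 0 (m * (x \<bullet> i - a \<bullet> i)) * flat 0 (m * (b \<bullet> i - x \<bullet> i)) = 0"
    by (auto simp: flat_def)
  then show ?thesis using \<open>i \<in> Basis\<close> unfolding box_bump_def by (intro prod_zero) auto
qed

lemma box_bump_schwartz: "(\<lambda>x. of_real (box_bump m a b x)) \<in> schwartz"
proof (rule schwartz_if_bounded_support)
  have "(\<lambda>x. of_real (flat 0 (m * (x \<bullet> i - a \<bullet> i)))) \<in> moderate" for i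
    using moderate_flat[of 0 "real m *\<^sub>R i" "- real m * (a \<bullet> i)"] by (simp add: algebra_simps)
  moreover have "(\<lambda>x. of_real (flat 0 (m * (b \<bullet> i - x \<bullet> i)))) \<in> moderate" for i
    using moderate_flat[of 0 "- real m *\<^sub>R i" "real m * (b \<bullet> i)"] by (simp add: algebra_simps)
  ultimately show "(\<lambda>x. of_real (box_bump m a b x)) \<in> moderate"
    unfolding box_bump_def of_real_prod of_real_mult by (intro moderate_prod moderate_mult) auto
  show "closed (cbox a b)" "bounded (cbox a b)" by (auto simp: closed_cbox bounded_cbox)
qed (simp add: box_bump_eq_0)

lemma flat_0_tendsto: "(\<lambda>m::nat. flat 0 (m * t)) \<longlonglongrightarrow> (if t \<le> 0 then 0 else 1)"
proof (cases "t \<le> 0")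
  case True
  then have "real m * t \<le> 0" for m by (simp add: mult_le_0_iff)
  then show ?thesis using True by (simp add: flat_def)
next
  case False
  have "(\<lambda>m::nat. inverse (real m) * (- 1 / t)) \<longlonglongrightarrow> 0 * (- 1 / t)"
    by (intro tendsto_intros lim_inverse_n)
  then have "(\<lambda>m::nat. exp (inverse (real m) * (- 1 / t))) \<longlonglongrightarrow> exp 0"
    by (intro tendsto_exp) simp
  then show ?thesis
  proof (rule Lim_transform_eventually[THEN tendsto_cong_limit])
    show "\<forall>\<^sub>F m in sequentially. exp (inverse (real m) * (- 1 / t)) = flat 0 (m * t)"
      using eventually_gt_at_top[of 0]
      by eventually_elim (use False in \<open>auto simp: flat_def field_simps mult_le_0_iff\<close>)
  qed (use False in auto)
qed

lemma box_bump_tendsto: "(\<lambda>m. box_bump m a b x) \<longlonglongrightarrow> indicator (box a b) x"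
proof -
  have "(\<lambda>m. box_bump m a b x) \<longlonglongrightarrow>
      (\<Prod>i\<in>Basis. (if x \<bullet> i - a \<bullet> i \<le> 0 then 0 else 1) * (if b \<bullet> i - x \<bullet> i \<le> 0 then 0 else 1 :: real))"
    unfolding box_bump_def by (intro tendsto_prod tendsto_mult flat_0_tendsto)
  also have "(\<Prod>i\<in>Basis. (if x \<bullet> i - a \<bullet> i \<le> 0 then 0 else 1) * (if b \<bullet> i - x \<bullet> i \<le> 0 then 0 else 1 :: real))
      = indicator (box a b) x"
  proof (cases "x \<in> box a b")
    case True
    then show ?thesis by (auto simp: mem_box intro!: prod.neutral)
  next
    case False
    then obtain i where "i \<in> Basis" "x \<bullet> i - a \<bullet> i \<le> 0 \<or> b \<bullet> i - x \<bullet> i \<le> 0"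
      by (auto simp: mem_box not_less)
    then show ?thesis using False by (auto intro!: prod_zero)
  qed
  finally show ?thesis .
qed

text \<open>A smooth transition from \<open>0\<close> on \<open>{x \<bullet> e \<le> 0}\<close> to \<open>1\<close> on \<open>{x \<bullet> e \<ge> 1}\<close>.\<close>

definition smooth_step :: "'a::euclidean_space \<Rightarrow> 'a \<Rightarrow> complex" where
  "smooth_step e x = of_real (flat 0 (x \<bullet> e)) *
     inverse (of_real (flat 0 (x \<bullet> e)) + of_real (flat 0 (1 - x \<bullet> e)))"

lemma flat_0_mono: "s \<le> t \<Longrightarrow> flat 0 s \<le> flat 0 t"
  by (auto simp: flat_def field_simps)

text \<open>One of \<open>t\<close> and \<open>1 - t\<close> is at least \<open>1 / 2\<close>.\<close>

lemma flat_step_denominator: "exp (- 2) \<le> flat 0 t + flat 0 (1 - t)"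
proof -
  have "exp (- 2) = flat 0 (1 / 2)" by (simp add: flat_def)
  also have "\<dots> \<le> flat 0 t + flat 0 (1 - t)"
  proof (cases "t \<ge> 1 / 2")
    case True
    then show ?thesis using flat_0_mono[of "1/2" t] flat_nonneg[of 0 "1 - t"] by linarith
  next
    case False
    then show ?thesis using flat_0_mono[of "1/2" "1 - t"] flat_nonneg[of 0 t] by linarith
  qed
  finally show ?thesis .
qed

lemma moderate_smooth_step: "smooth_step e \<in> moderate"
proof -
  have 1: "(\<lambda>x. of_real (flat 0 (x \<bullet> e))) \<in> moderate" using moderate_flat[of 0 e 0] by simp
  have 2: "(\<lambda>x. of_real (flat 0 (1 - x \<bullet> e))) \<in> moderate" using moderate_flat[of 0 "- e" 1] by simp
  have 3: "exp (- 2) \<le> norm (complex_of_real (flat 0 (x \<bullet> e)) + of_real (flat 0 (1 - x \<bullet> e)))" for x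
    using flat_step_denominator[of "x \<bullet> e"] by (simp del: of_real_add add: of_real_add[symmetric])
  show ?thesis
    using moderate_mult[OF 1 moderate_inverse[OF moderate_add[OF 1 2] _ 3]]
    by (simp add: smooth_step_def[abs_def])
qed

lemma smooth_step_eq_0: "x \<bullet> e \<le> 0 \<Longrightarrow> smooth_step e x = 0"
  by (simp add: smooth_step_def flat_def)

lemma smooth_step_eq_1: "1 \<le> x \<bullet> e \<Longrightarrow> smooth_step e x = 1"
  by (simp add: smooth_step_def flat_def)

definition separated :: "'a::euclidean_space set \<Rightarrow> 'a set \<Rightarrow> bool" where
  "separated A B \<longleftrightarrow> closed A \<and> closed B \<and> (\<exists>\<delta>>0. \<forall>x\<in>A. \<forall>y\<in>B. \<delta> \<le> norm (x - y))"

definition supported_in :: "('a::euclidean_space \<Rightarrow> complex) \<Rightarrow> 'a set \<Rightarrow> bool" where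
  "supported_in f A \<longleftrightarrow> (\<forall>x. x \<notin> A \<longrightarrow> f x = 0)"

text \<open>The building block \<open>|x - y|\<^sup>r f(x) g(y)\<close> of the off-diagonal test functions.\<close>

definition dist_kernel ::
  "real \<Rightarrow> ('a::euclidean_space \<Rightarrow> complex) \<Rightarrow> ('a \<Rightarrow> complex) \<Rightarrow> 'a \<times> 'a \<Rightarrow> complex" where
  "dist_kernel r f g z = of_real (norm (fst z - snd z) powr r) * (f (fst z) * g (snd z))"

text \<open>On the support \<open>|x - y|\<close> is bounded below by the separation, which controls negative powers, and
  above by \<open>(1 + |x|) (1 + |y|)\<close>, which controls positive ones.\<close>

lemma fast_decay_dist_kernel:
  assumes AB: "separated A B" and f: "fast_decay f" "supported_in f A" and g: "fast_decay g" "supported_in g B"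
  shows "fast_decay (dist_kernel r f g)"
  unfolding fast_decay_def
proof
  fix k :: nat
  obtain \<delta> where \<delta>: "\<delta> > 0" "\<And>x y. x \<in> A \<Longrightarrow> y \<in> B \<Longrightarrow> \<delta> \<le> norm (x - y)"
    using AB unfolding separated_def by blast
  \<comment> \<open>Decay of order \<open>k\<close> of the kernel costs decay of order \<open>k + N\<close> of the factors.\<close>
  define N where "N = nat \<lceil>\<bar>r\<bar>\<rceil>"
  obtain C where C: "\<And>x. (1 + norm x) ^ (k + N) * norm (f x) \<le> C" using f unfolding fast_decay_def by metis
  obtain D where D: "\<And>x. (1 + norm x) ^ (k + N) * norm (g x) \<le> D" using g unfolding fast_decay_def by metis
  have C0: "C \<ge> 0" using order_trans[OF _ C[of 0]] by auto
  have "(1 + norm z) ^ k * norm (dist_kernel r f g z) \<le> (\<delta> powr r + 1) * (C * D)" for z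
  proof (cases "fst z \<in> A \<and> snd z \<in> B")
    case True
    obtain x y where z: "z = (x, y)" by (cases z)
    define P where "P = (1 + norm x) * (1 + norm y)"
    have P: "1 \<le> P" "1 + norm x + norm y \<le> P" by (auto simp: P_def algebra_simps)
    have d: "\<delta> \<le> norm (x - y)" using \<delta> True z by auto
    have "norm (x - y) powr r \<le> (\<delta> powr r + 1) * P ^ N"
    proof (cases "r \<ge> 0")
      case True
      have "norm (x - y) powr r \<le> P powr r"
        using True P norm_triangle_ineq4[of x y] by (intro powr_mono2) auto
      also have "\<dots> \<le> P powr (real N)" using True P by (intro powr_mono) (auto simp: N_def)
      also have "\<dots> = P ^ N" using P by (simp add: powr_realpow)
      also have "\<dots> \<le> (\<delta> powr r + 1) * P ^ N" using P by (simp add: algebra_simps)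
      finally show ?thesis .
    next
      case False
      have "norm (x - y) powr r \<le> \<delta> powr r" using False d \<delta> by (intro powr_mono2') auto
      also have "\<dots> \<le> (\<delta> powr r + 1) * P ^ N"
        using P mult_mono[of "\<delta> powr r" "\<delta> powr r + 1" 1 "P ^ N"] by simp
      finally show ?thesis .
    qed
    moreover have "(1 + norm z) ^ k \<le> P ^ k"
      using norm_Pair_le[of x y] P z by (intro power_mono) auto
    ultimately have "(1 + norm z) ^ k * (norm (x - y) powr r * (norm (f x) * norm (g y)))
        \<le> P ^ k * ((\<delta> powr r + 1) * P ^ N * (norm (f x) * norm (g y)))"
      using P by (intro mult_mono mult_right_mono) auto
    also have "\<dots> = (\<delta> powr r + 1) * (((1 + norm x) ^ (k + N) * norm (f x)) * ((1 + norm y) ^ (k + N) * norm (g y)))"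
      by (simp add: P_def power_add power_mult_distrib mult_ac)
    also have "\<dots> \<le> (\<delta> powr r + 1) * (C * D)"
      using C0 by (intro mult_left_mono mult_mono C D) auto
    finally show ?thesis by (simp add: dist_kernel_def z norm_mult)
  next
    case False
    then have "dist_kernel r f g z = 0" using f g by (auto simp: dist_kernel_def supported_in_def)
    moreover have "D \<ge> 0" using order_trans[OF _ D[of 0]] by auto
    ultimately show ?thesis using C0 by simp
  qed
  then show "\<exists>C. \<forall>z. (1 + norm z) ^ k * norm (dist_kernel r f g z) \<le> C" by blast
qed

lemma has_derivative_norm_powr:
  fixes w :: "'a::euclidean_space"
  assumes "w \<noteq> 0"
  shows "((\<lambda>w. norm w powr r) has_derivative (\<lambda>h. r * norm w powr (r - 2) * (w \<bullet> h))) (at w)"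
proof -
  have "((\<lambda>w. norm w powr r) has_derivative
      (\<lambda>h. norm w powr r * (0 * ln (norm w) + (h \<bullet> sgn w) * r / norm w))) (at w)"
    by (rule has_derivative_powr) (use assms in \<open>auto intro: has_derivative_norm\<close>)
  moreover have "norm w powr r * (0 * ln (norm w) + (h \<bullet> sgn w) * r / norm w)
      = r * norm w powr (r - 2) * (w \<bullet> h)" for h
    using assms by (simp add: powr_diff sgn_div_norm inner_commute field_simps power2_eq_square)
  ultimately show ?thesis by simp
qed

text \<open>On the diagonal the power of the distance may fail to be differentiable, but there the kernel
  vanishes in a neighbourhood, and so does the formula for the derivative.\<close>

lemma dist_kernel_has_derivative:
  assumes AB: "separated A B" and f: "f \<in> schwartz" "supported_in f A" and g: "g \<in> schwartz" "supported_in g B"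
  shows "(dist_kernel r f g has_derivative (\<lambda>h.
     of_real (r * norm (x - y) powr (r - 2) * ((x - y) \<bullet> (fst h - snd h))) * (f x * g y)
     + of_real (norm (x - y) powr r) * (f x * frechet_derivative g (at y) (snd h)
        + frechet_derivative f (at x) (fst h) * g y))) (at (x, y))"
    (is "(_ has_derivative ?D) _")
proof (cases "x = y")
  case False
  have 1: "((\<lambda>z::'a\<times>'a. norm (fst z - snd z) powr r) has_derivative
      (\<lambda>h. r * norm (x - y) powr (r - 2) * ((x - y) \<bullet> (fst h - snd h)))) (at (x, y))"
    by (rule has_derivative_compose[where f = "\<lambda>z. fst z - snd z" and g = "\<lambda>w. norm w powr r" and s = UNIV and x = "(x, y)", simplified])
      (use False in \<open>auto intro!: derivative_eq_intros has_derivative_norm_powr\<close>)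
  have 2: "((\<lambda>z. f (fst z)) has_derivative (\<lambda>h. frechet_derivative f (at x) (fst h))) (at (x, y))"
    by (rule has_derivative_compose[where f = fst and s = UNIV and x = "(x, y)", simplified])
      (auto intro!: derivative_eq_intros schwartz_has_derivative f)
  have 3: "((\<lambda>z. g (snd z)) has_derivative (\<lambda>h. frechet_derivative g (at y) (snd h))) (at (x, y))"
    by (rule has_derivative_compose[where f = snd and s = UNIV and x = "(x, y)", simplified])
      (auto intro!: derivative_eq_intros schwartz_has_derivative g)
  from has_derivative_mult[OF has_derivative_of_real[OF 1] has_derivative_mult[OF 2 3]]
  show ?thesis by (simp add: dist_kernel_def[abs_def] algebra_simps)
next
  case True
  have cl: "closed A" "closed B" "x \<notin> A \<or> x \<notin> B"
    using AB unfolding separated_def by force+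
  then have z: "?D = (\<lambda>_. 0)" using True by auto
  show ?thesis
    unfolding z
  proof (rule has_derivative_transform_within_open[of "\<lambda>_. 0" _ _ _ "- (A \<times> B)"])
    show "open (- (A \<times> B))" using cl by (auto intro!: open_Compl closed_Times)
    show "0 = dist_kernel r f g z" if "z \<in> - (A \<times> B)" for z
      using that f g by (cases z) (auto simp: dist_kernel_def supported_in_def)
  qed (use cl True in auto)
qed

lemma supported_in_frechet_derivative:
  "closed A \<Longrightarrow> supported_in f A \<Longrightarrow> supported_in (\<lambda>x. frechet_derivative f (at x) b) A"
  unfolding supported_in_def using frechet_derivative_eq_0_off_closed[of A f] by simp

text \<open>A derivative of a kernel is again a combination of kernels with separated supports: the derivative
  of \<open>|x - y|\<^sup>r\<close> in direction \<open>i\<close> is \<open>r |x - y|\<^sup>r\<^sup>-\<^sup>2 (x\<^sub>i - y\<^sub>i)\<close>, and the factors \<open>x\<^sub>i\<close> and \<open>y\<^sub>i\<close>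
  are absorbed into \<open>f\<close> and \<open>g\<close>.  Hence the induction has to run over all \<open>r\<close>, \<open>f\<close>, \<open>g\<close> at once.\<close>

lemma dist_kernel_schwartz:
  assumes AB: "separated A B" and "f \<in> schwartz" "supported_in f A" and "g \<in> schwartz" "supported_in g B"
  shows "dist_kernel r f g \<in> schwartz"
proof -
  have cl: "closed A" "closed B" using AB by (auto simp: separated_def)
  have "smooth_upto fast_decay k (dist_kernel r f g)" for k
    using assms(2-)
  proof (induction k arbitrary: f g r)
    case 0
    then show ?case
      using fast_decay_dist_kernel[OF AB] unfolding schwartz_iff_smooth_upto
      by (metis smooth_upto.simps(1))
  next
    case (Suc k)
    note fg = Suc.prems
    have x: "(\<lambda>x. of_real (x \<bullet> i) * h x) \<in> schwartz" if "h \<in> schwartz" for h :: "'a \<Rightarrow> complex" and i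
      using moderate_mult_schwartz[OF moderate_inner that] .
    have xs: "supported_in (\<lambda>x. of_real (x \<bullet> i) * h x) A'" if "supported_in h A'"
      for h :: "'a \<Rightarrow> complex" and i A' using that by (simp add: supported_in_def)
    show ?case
    proof (rule smooth_upto_SucI)
      show "fast_decay (dist_kernel r f g)" using Suc.IH[OF fg] smooth_upto_imp by blast
      show "(dist_kernel r f g has_derivative (\<lambda>h.
         of_real (r * norm (fst z - snd z) powr (r - 2) * ((fst z - snd z) \<bullet> (fst h - snd h))) * (f (fst z) * g (snd z))
         + of_real (norm (fst z - snd z) powr r) * (f (fst z) * frechet_derivative g (at (snd z)) (snd h)
            + frechet_derivative f (at (fst z)) (fst h) * g (snd z)))) (at z)" for z
        using dist_kernel_has_derivative[OF AB fg, of r "fst z" "snd z"] by simp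
      show "smooth_upto fast_decay k (\<lambda>z.
         of_real (r * norm (fst z - snd z) powr (r - 2) * ((fst z - snd z) \<bullet> (fst b - snd b))) * (f (fst z) * g (snd z))
         + of_real (norm (fst z - snd z) powr r) * (f (fst z) * frechet_derivative g (at (snd z)) (snd b)
            + frechet_derivative f (at (fst z)) (fst b) * g (snd z)))" if b: "b \<in> Basis" for b
      proof -
        have S: "smooth_upto fast_decay k (\<lambda>z. of_real r * (dist_kernel (r - 2) (\<lambda>x. of_real (x \<bullet> i) * f x) g z
             + (- 1) * dist_kernel (r - 2) f (\<lambda>x. of_real (x \<bullet> i) * g x) z))" for i
          by (intro smooth_upto_cmult smooth_upto_add[of fast_decay, OF fast_decay_add] Suc.IH x xs fg)
        consider i where "i \<in> Basis" "b = (i, 0)" | i where "i \<in> Basis" "b = (0, i)"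
          using b unfolding Basis_prod_def by auto
        then show ?thesis
        proof cases
          case 1
          have L: "bounded_linear (frechet_derivative g (at y))" for y
            using schwartz_has_derivative[OF fg(3)] has_derivative_bounded_linear by blast
          have "smooth_upto fast_decay k (\<lambda>z. of_real r * (dist_kernel (r - 2) (\<lambda>x. of_real (x \<bullet> i) * f x) g z
             + (- 1) * dist_kernel (r - 2) f (\<lambda>x. of_real (x \<bullet> i) * g x) z)
             + dist_kernel r (\<lambda>x. frechet_derivative f (at x) i) g z)"
            by (intro smooth_upto_add[of fast_decay, OF fast_decay_add] S Suc.IH fg schwartz_frechet_derivative
                supported_in_frechet_derivative cl 1)
          then show ?thesis
            by (rule back_subst) (auto simp: fun_eq_iff dist_kernel_def 1 algebra_simps inner_diff_left
                linear_0[OF bounded_linear.linear[OF L]])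
        next
          case 2
          have L: "bounded_linear (frechet_derivative f (at y))" for y
            using schwartz_has_derivative[OF fg(1)] has_derivative_bounded_linear by blast
          have "smooth_upto fast_decay k (\<lambda>z. (- 1) * (of_real r * (dist_kernel (r - 2) (\<lambda>x. of_real (x \<bullet> i) * f x) g z
             + (- 1) * dist_kernel (r - 2) f (\<lambda>x. of_real (x \<bullet> i) * g x) z))
             + dist_kernel r f (\<lambda>x. frechet_derivative g (at x) i) z)"
            by (intro smooth_upto_cmult smooth_upto_add[of fast_decay, OF fast_decay_add] S Suc.IH fg schwartz_frechet_derivative
                supported_in_frechet_derivative cl 2)
          then show ?thesis
            by (rule back_subst) (auto simp: fun_eq_iff dist_kernel_def 2 algebra_simps inner_diff_left
                linear_0[OF bounded_linear.linear[OF L]])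
        qed
      qed
    qed
  qed
  then show ?thesis by (simp add: schwartz_iff_smooth_upto)
qed

section \<open>Integration against Schwartz functions\<close>

lemma schwartz_continuous: "f \<in> schwartz \<Longrightarrow> continuous_on S f"
  by (meson schwartz_has_derivative has_derivative_continuous continuous_at_imp_continuous_on)

lemma schwartz_borel: "f \<in> schwartz \<Longrightarrow> f \<in> borel_measurable borel"
  by (intro borel_measurable_continuous_onI schwartz_continuous)

lemma schwartz_fast_decay: "f \<in> schwartz \<Longrightarrow> fast_decay f"
  unfolding schwartz_iff_smooth_upto using smooth_upto.simps(1) by blast

lemma schwartz_bounded:
  assumes "f \<in> schwartz" obtains C where "C \<ge> 0" "\<And>x. norm (f x) \<le> C"
proof -
  obtain C where C: "\<And>x. (1 + norm x) ^ 0 * norm (f x) \<le> C"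
    using schwartz_fast_decay[OF assms] unfolding fast_decay_def by metis
  then have "norm (f x) \<le> C" for x by (metis mult_1 power_0)
  then show ?thesis using that order_trans[OF norm_ge_zero] by blast
qed

text \<open>Compare with the sum over \<open>j\<close> of \<open>C (1 + j)\<^sup>-\<^sup>n\<^sup>-\<^sup>2\<close> on the ball of radius \<open>1 + j\<close>, whose integral is
  a multiple of the sum of \<open>(1 + j)\<^sup>-\<^sup>2\<close>.\<close>

lemma integrable_fast_decay:
  fixes f :: "'a::euclidean_space \<Rightarrow> complex"
  assumes [measurable]: "f \<in> borel_measurable borel" and f: "fast_decay f"
  shows "integrable lborel f"
proof -
  let ?n = "DIM('a)"
  obtain C where C: "\<And>x. (1 + norm x) ^ (?n + 2) * norm (f x) \<le> C"
    using f unfolding fast_decay_def by metis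
  have C0: "C \<ge> 0" using order_trans[OF _ C[of 0]] by auto
  let ?\<omega> = "unit_ball_vol (real ?n)"
  let ?a = "\<lambda>j::nat. C / (1 + real j) ^ (?n + 2)"
  have pw: "ennreal (norm (f x)) \<le> (\<Sum>j. ennreal (?a j) * indicator (ball 0 (1 + real j)) x)" for x
  proof -
    define j where "j = nat \<lfloor>norm x\<rfloor>"
    have j: "real j \<le> norm x" "norm x < 1 + real j" using norm_ge_zero[of x] unfolding j_def by linarith+
    have "(1 + real j) ^ (?n + 2) * norm (f x) \<le> (1 + norm x) ^ (?n + 2) * norm (f x)"
      using j by (intro mult_right_mono power_mono) auto
    then have "norm (f x) \<le> ?a j"
      using C[of x] by (subst pos_le_divide_eq) (auto simp: mult.commute)
    then have "ennreal (norm (f x)) \<le> ennreal (?a j) * indicator (ball 0 (1 + real j)) x"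
      using j by (simp add: ennreal_leI)
    also have "\<dots> = sum (\<lambda>j. ennreal (?a j) * indicator (ball 0 (1 + real j)) x) {j}"
      by (simp only: sum.insert finite.emptyI empty_iff not_False_eq_True sum.empty add_0_right)
    also have "\<dots> \<le> (\<Sum>j. ennreal (?a j) * indicator (ball 0 (1 + real j)) x)"
      by (intro sum_le_suminf) auto
    finally show ?thesis .
  qed
  have "(\<integral>\<^sup>+x. ennreal (norm (f x)) \<partial>lborel)
      \<le> (\<integral>\<^sup>+x. (\<Sum>j. ennreal (?a j) * indicator (ball 0 (1 + real j)) x) \<partial>(lborel :: 'a measure))"
    by (intro nn_integral_mono pw)
  also have "\<dots> = (\<Sum>j. ennreal (?a j) * emeasure lborel (ball (0::'a) (1 + real j)))"
    by (subst nn_integral_suminf) (auto simp: nn_integral_cmult_indicator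
          intro!: borel_measurable_times_ennreal borel_measurable_indicator)
  also have "\<dots> = (\<Sum>j. ennreal (C * ?\<omega> * inverse ((real (Suc j)) ^ 2)))"
  proof (intro suminf_cong)
    fix j
    define X where "X = 1 + real j"
    have "X > 0" by (simp add: X_def)
    then have "C / X ^ (?n + 2) * (?\<omega> * X ^ ?n) = C * ?\<omega> * inverse (X ^ 2)"
      by (simp add: power_add field_simps power2_eq_square)
    then have "?a j * (?\<omega> * (1 + real j) ^ ?n) = C * ?\<omega> * inverse ((real (Suc j)) ^ 2)"
      by (simp add: X_def)
    then show "ennreal (?a j) * emeasure lborel (ball (0::'a) (1 + real j)) = ennreal (C * ?\<omega> * inverse ((real (Suc j)) ^ 2))"
      using C0 by (simp add: emeasure_ball flip: ennreal_mult)
  qed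
  also have "\<dots> < \<infinity>"
  proof -
    have "summable (\<lambda>j. inverse ((real (Suc j)) ^ 2))"
      using inverse_power_summable[of 2, where ?'a = real] by (subst summable_Suc_iff) simp
    then have "summable (\<lambda>j. C * ?\<omega> * inverse ((real (Suc j)) ^ 2))"
      by (rule summable_mult)
    then show ?thesis
      using C0 by (subst suminf_ennreal2) auto
  qed
  finally show ?thesis by (simp add: integrable_iff_bounded)
qed

lemma schwartz_integrable: "f \<in> schwartz \<Longrightarrow> integrable lborel f"
  by (intro integrable_fast_decay schwartz_borel schwartz_fast_decay)

lemma schwartz_integrable_lebesgue: "f \<in> schwartz \<Longrightarrow> integrable lebesgue f"
  using schwartz_integrable[of f] schwartz_borel[of f] by (subst integrable_completion) auto

lemma schwartz_integral_lebesgue: "f \<in> schwartz \<Longrightarrow> integral\<^sup>L lebesgue f = integral\<^sup>L lborel f"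
  using schwartz_borel[of f] by (intro integral_completion) auto

lemma AE_cbox_iff_box: "AE x in lebesgue. (x \<in> box a b) = (x \<in> cbox a (b::'a::euclidean_space))"
proof -
  have "cbox a b - box a b \<in> null_sets lebesgue"
    using negligible_frontier_interval[of a b] by (simp add: negligible_iff_null_sets)
  then show ?thesis
    by (rule AE_I'[where N = "cbox a b - box a b"]) (use box_subset_cbox[of a b] in auto)
qed

lemma box_bump_integral_tendsto:
  fixes H :: "'a::euclidean_space \<Rightarrow> complex"
  assumes H: "set_integrable lebesgue (cbox a b) H"
  shows "(\<lambda>m. LINT x|lebesgue. H x * of_real (box_bump m a b x)) \<longlonglongrightarrow> (LINT x:cbox a b|lebesgue. H x)"
  unfolding set_lebesgue_integral_def
proof (rule integral_dominated_convergence)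
  let ?H = "\<lambda>x. indicator (cbox a b) x *\<^sub>R H x"
  have int: "integrable lebesgue ?H" using H by (simp add: set_integrable_def)
  then show "?H \<in> borel_measurable lebesgue" by simp
  show "integrable lebesgue (\<lambda>x. norm (?H x))" using int by (rule integrable_norm)
  have eq: "H x * of_real (box_bump m a b x) = ?H x * of_real (box_bump m a b x)" for m x
    by (cases "x \<in> cbox a b") (auto simp: box_bump_eq_0)
  have "(\<lambda>x. complex_of_real (box_bump m a b x)) \<in> borel_measurable lebesgue" for m
    using schwartz_borel[OF box_bump_schwartz] by (intro measurable_completion) simp
  then show "(\<lambda>x. H x * of_real (box_bump m a b x)) \<in> borel_measurable lebesgue" for m
    unfolding eq using int by (intro borel_measurable_times) auto
  show "AE x in lebesgue. norm (H x * of_real (box_bump m a b x)) \<le> norm (?H x)" for m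
  proof (intro AE_I2)
    fix x
    have "norm (?H x) * norm (complex_of_real (box_bump m a b x)) \<le> norm (?H x) * 1"
      by (intro mult_left_mono) (use box_bump_bounds[of m a b x] in auto)
    then show "norm (H x * of_real (box_bump m a b x)) \<le> norm (?H x)"
      unfolding eq norm_mult by simp
  qed
  show "AE x in lebesgue. (\<lambda>m. H x * of_real (box_bump m a b x)) \<longlonglongrightarrow> ?H x"
    using AE_cbox_iff_box[of a b]
  proof eventually_elim
    case (elim x)
    have "(\<lambda>m. H x * of_real (box_bump m a b x)) \<longlonglongrightarrow> H x * of_real (indicator (box a b) x)"
      by (intro tendsto_intros box_bump_tendsto)
    then show ?case using elim by (auto simp: indicator_def)
  qed
qed

lemma box_bump_Pair:
  "box_bump m (a, c) (b, d) (x, y) = box_bump m a b x * box_bump m c d y"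
  unfolding box_bump_def Basis_prod_def
  by (subst prod.union_disjoint) (auto simp: prod.reindex inj_on_def)

text \<open>Lebesgue differentiation along shrinking cubes.\<close>

lemma AE_eq_0_if_small_cubes:
  fixes H :: "'a::euclidean_space \<Rightarrow> complex"
  assumes loc: "\<And>a b. set_integrable lebesgue (cbox a b) H"
    and cubes: "\<And>x. x \<in> S \<Longrightarrow> \<exists>d>0. \<forall>h. 0 < h \<and> h < d \<longrightarrow> (LINT y:cbox x (x + h *\<^sub>R One)|lebesgue. H y) = 0"
  shows "AE x in lebesgue. x \<in> S \<longrightarrow> H x = 0"
proof -
  have "H integrable_on cbox a b" for a b
    using set_lebesgue_integral_eq_integral(1)[OF loc] .
  then obtain N where N: "negligible N"
     "\<And>x e. \<lbrakk>x \<notin> N; 0 < e\<rbrakk> \<Longrightarrow> \<exists>d>0. \<forall>h. 0 < h \<and> h < d \<longrightarrow>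
         norm (integral (cbox x (x + h *\<^sub>R One)) H /\<^sub>R h ^ DIM('a) - H x) < e"
    using integrable_ccontinuous_explicit[of H] by metis
  have "H x = 0" if x: "x \<in> S" "x \<notin> N" for x
  proof (rule ccontr)
    assume "H x \<noteq> 0"
    then obtain d where d: "d > 0" "\<And>h. 0 < h \<and> h < d \<Longrightarrow>
         norm (integral (cbox x (x + h *\<^sub>R One)) H /\<^sub>R h ^ DIM('a) - H x) < norm (H x)"
      using N(2)[OF x(2), of "norm (H x)"] by auto
    obtain d' where d': "d' > 0" "\<And>h. 0 < h \<and> h < d' \<Longrightarrow> (LINT y:cbox x (x + h *\<^sub>R One)|lebesgue. H y) = 0"
      using cubes[OF x(1)] by blast
    define h where "h = min d d' / 2"
    have h: "0 < h \<and> h < d" "0 < h \<and> h < d'" using d(1) d'(1) by (auto simp: h_def)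
    have "integral (cbox x (x + h *\<^sub>R One)) H = 0"
      using d'(2)[OF h(2)] set_lebesgue_integral_eq_integral(2)[OF loc] by metis
    then show False using d(2)[OF h(1)] by simp
  qed
  moreover have "AE x in lebesgue. x \<notin> N"
    using N(1) by (intro AE_not_in) (simp add: negligible_iff_null_sets)
  ultimately show ?thesis by (auto elim: eventually_mono)
qed

lemma AE_eq_0_if_schwartz_integrals_eq_0:
  fixes H :: "'a::euclidean_space \<Rightarrow> complex"
  assumes loc: "\<And>a b. set_integrable lebesgue (cbox a b) H"
    and int: "\<And>\<phi>. \<phi> \<in> schwartz \<Longrightarrow> (LINT x|lebesgue. H x * \<phi> x) = 0"
  shows "AE x in lebesgue. H x = 0"
proof -
  have "(LINT x:cbox a b|lebesgue. H x) = 0" for a b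
    using box_bump_integral_tendsto[OF loc, of a b] by (simp add: int[OF box_bump_schwartz] LIMSEQ_const_iff)
  then have "AE x in lebesgue. x \<in> UNIV \<longrightarrow> H x = 0"
    by (intro AE_eq_0_if_small_cubes loc) (auto intro!: exI[of _ 1])
  then show ?thesis by simp
qed

lemma normalized_bump:
  fixes a b :: "'a::euclidean_space"
  assumes "box a b \<noteq> {}"
  obtains \<psi> where "\<psi> \<in> schwartz" "supported_in \<psi> (cbox a b)" "integral\<^sup>L lborel \<psi> = 1"
proof -
  have "(\<lambda>m. LINT x|lebesgue. 1 * complex_of_real (box_bump m a b x)) \<longlonglongrightarrow> (LINT x:cbox a b|lebesgue. 1)"
    by (rule box_bump_integral_tendsto) (rule absolutely_integrable_on_const[OF lmeasurable_cbox])
  moreover have "(LINT x:cbox a b|lebesgue. 1 :: complex) \<noteq> 0"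
  proof -
    have "0 < measure lborel (cbox a b)"
      using assms by (subst content_pos_lt_eq) (simp add: box_ne_empty)
    moreover have "(LINT x|lborel. indicator (cbox a b) x *\<^sub>R c) = measure lborel (cbox a b) *\<^sub>R c"
      for c :: complex
    proof -
      have "integrable lborel (indicator (cbox a b) :: 'a \<Rightarrow> real)"
        by (rule integrable_real_indicator) (simp, rule emeasure_bounded_finite[OF bounded_cbox])
      then show ?thesis by simp
    qed
    from this[of 1] have "(LINT x:cbox a b|lebesgue. 1 :: complex) = measure lborel (cbox a b) *\<^sub>R 1"
      unfolding set_lebesgue_integral_def by (subst integral_completion) auto
    ultimately show ?thesis by simp
  qed
  ultimately have "\<not> (\<lambda>m. LINT x|lebesgue. 1 * complex_of_real (box_bump m a b x)) \<longlonglongrightarrow> 0"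
    by (metis LIMSEQ_unique)
  then have "\<exists>m. (LINT x|lebesgue. complex_of_real (box_bump m a b x)) \<noteq> 0"
    by (rule contrapos_np) simp
  then obtain m where m: "(LINT x|lebesgue. complex_of_real (box_bump m a b x)) \<noteq> 0" by blast
  define I where "I = (LINT x|lborel. complex_of_real (box_bump m a b x))"
  have I: "I \<noteq> 0" using m schwartz_integral_lebesgue[OF box_bump_schwartz, of m a b] unfolding I_def by metis
  show ?thesis
  proof (rule that[of "\<lambda>x. inverse I * of_real (box_bump m a b x)"])
    show "(\<lambda>x. inverse I * of_real (box_bump m a b x)) \<in> schwartz"
      by (intro schwartz_cmult box_bump_schwartz)
    show "supported_in (\<lambda>x. inverse I * of_real (box_bump m a b x)) (cbox a b)"
      by (simp add: supported_in_def box_bump_eq_0)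
    show "(LINT x|lborel. inverse I * of_real (box_bump m a b x)) = 1"
      using I by (simp add: I_def)
  qed
qed

lemma box_bump_pos: "x \<in> box a b \<Longrightarrow> 0 < box_bump 1 a b x"
  unfolding box_bump_def by (intro prod_pos) (auto simp: mem_box flat_def)

lemma set_integrable_cbox_if_integrable_mult_schwartz:
  fixes g :: "'a::euclidean_space \<Rightarrow> complex"
  assumes [measurable]: "g \<in> borel_measurable borel"
    and int: "\<And>\<phi>. \<phi> \<in> schwartz \<Longrightarrow> integrable lborel (\<lambda>x. g x * \<phi> x)"
  shows "set_integrable lborel (cbox a b) g"
proof (cases "cbox a b = {}")
  case False
  \<comment> \<open>A bump over an enlarged box is bounded below on the box itself.\<close>
  define \<phi> where "\<phi> = (\<lambda>x. complex_of_real (box_bump 1 (a - One) (b + One) x))"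
  have \<phi>: "\<phi> \<in> schwartz" unfolding \<phi>_def by (rule box_bump_schwartz)
  have sub: "x \<in> box (a - One) (b + One)" if "x \<in> cbox a b" for x
  proof -
    have "a \<bullet> i - 1 < x \<bullet> i" "x \<bullet> i < b \<bullet> i + 1" if "i \<in> Basis" for i
      using \<open>x \<in> cbox a b\<close> that by (force simp: mem_box)+
    then show ?thesis by (simp add: mem_box inner_diff_left inner_add_left)
  qed
  have "continuous_on (cbox a b) (\<lambda>x. norm (\<phi> x))"
    by (intro continuous_on_norm schwartz_continuous \<phi>)
  then obtain x0 where x0: "x0 \<in> cbox a b" "\<And>x. x \<in> cbox a b \<Longrightarrow> norm (\<phi> x0) \<le> norm (\<phi> x)"
    using continuous_attains_inf[OF compact_cbox False] by blast
  define c where "c = norm (\<phi> x0)"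
  have c: "c > 0" using box_bump_pos[OF sub[OF x0(1)]] by (simp add: c_def \<phi>_def)
  show ?thesis unfolding set_integrable_def
  proof (rule Bochner_Integration.integrable_bound)
    show "integrable lborel (\<lambda>x. (g x * \<phi> x) / of_real c)" using int[OF \<phi>] by auto
    show "AE x in lborel. norm (indicator (cbox a b) x *\<^sub>R g x) \<le> norm ((g x * \<phi> x) / of_real c)"
    proof (intro AE_I2)
      fix x
      show "norm (indicator (cbox a b) x *\<^sub>R g x) \<le> norm ((g x * \<phi> x) / of_real c)"
      proof (cases "x \<in> cbox a b")
        case True
        have "norm (g x) * c \<le> norm (g x) * norm (\<phi> x)"
          using x0(2)[OF True] by (intro mult_left_mono) (auto simp: c_def)
        then show ?thesis using True c by (simp add: norm_mult norm_divide pos_le_divide_eq)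
      qed simp
    qed
  qed simp
qed simp

lemma integrable_product:
  fixes f :: "'a::euclidean_space \<Rightarrow> complex" and g :: "'b::euclidean_space \<Rightarrow> complex"
  assumes f: "integrable lborel f" and g: "integrable lborel g"
  shows "integrable lborel (\<lambda>(x, y). f x * g y)"
    and "(LINT (x, y)|lborel. f x * g y) = integral\<^sup>L lborel f * integral\<^sup>L lborel g"
proof -
  have [measurable]: "f \<in> borel_measurable borel" "g \<in> borel_measurable borel"
    using f g by (auto dest: borel_measurable_integrable)
  have "integrable (lborel \<Otimes>\<^sub>M lborel) (\<lambda>(x, y). f x * g y)"
  proof (rule lborel_pair.Fubini_integrable)
    show "integrable lborel (\<lambda>x. LINT y|lborel. norm (case (x, y) of (x, y) \<Rightarrow> f x * g y))"
      using f by (simp add: norm_mult)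
    show "AE x in lborel. integrable lborel (\<lambda>y. case (x, y) of (x, y) \<Rightarrow> f x * g y)"
      using g by auto
  qed measurable
  then show int: "integrable lborel (\<lambda>(x, y). f x * g y)" by (simp add: lborel_prod)
  show "(LINT (x, y)|lborel. f x * g y) = integral\<^sup>L lborel f * integral\<^sup>L lborel g"
    using lborel_pair.integral_fst'[of "\<lambda>(x, y). f x * g y"] int by (simp add: lborel_prod)
qed

section \<open>The fractional Sobolev inequality of order one\<close>

text \<open>The seminorm of the homogeneous Sobolev-Slobodeckij space of order \<open>s\<close> and exponent one.\<close>

definition gagliardo :: "real \<Rightarrow> ('a::euclidean_space \<Rightarrow> 'b::real_normed_vector) \<Rightarrow> ennreal" where
  "gagliardo s f = (\<integral>\<^sup>+x. \<integral>\<^sup>+y.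
     ennreal (norm (f x - f y) / norm (x - y) powr (real DIM('a) + s)) \<partial>lborel \<partial>lborel)"

text \<open>The Gagliardo seminorm of the indicator of \<open>E\<close>, counting each pair of points once.\<close>

definition frac_perimeter :: "real \<Rightarrow> 'a::euclidean_space set \<Rightarrow> ennreal" where
  "frac_perimeter s E = (\<integral>\<^sup>+x. \<integral>\<^sup>+y.
     ennreal (indicator E x * indicator (- E) y / norm (x - y) powr (real DIM('a) + s)) \<partial>lborel \<partial>lborel)"

definition iso_const :: "real \<Rightarrow> nat \<Rightarrow> real" where
  "iso_const s n = (unit_ball_vol n / 2) powr (1 + s / real n)"

lemma iso_const_pos: "0 < iso_const s n"
  using unit_ball_vol_pos[of n] by (simp add: iso_const_def less_imp_neq[symmetric])

text \<open>Around a point \<open>x\<close> of \<open>E\<close> take the ball of measure \<open>2 |E|\<close>.  At least half of it lies outside \<open>E\<close>, at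
  distance at most its radius \<open>R\<close>, so the inner integral is at least \<open>|E| / R\<^sup>n\<^sup>+\<^sup>s\<close>, a multiple
  of \<open>|E|\<^sup>-\<^sup>s\<^sup>/\<^sup>n\<close>.\<close>

lemma frac_isoperimetric:
  fixes E :: "'a::euclidean_space set"
  assumes E[measurable]: "E \<in> sets borel" and fin: "emeasure lborel E < \<infinity>" and "0 < s"
  shows "ennreal (iso_const s DIM('a) * measure lborel E powr (1 - s / real DIM('a))) \<le> frac_perimeter s E"
proof (cases "measure lborel E = 0")
  case False
  define n where "n = real DIM('a)"
  define \<omega> where "\<omega> = unit_ball_vol n"
  define m where "m = measure lborel E"
  \<comment> \<open>The radius of a ball of measure \<open>2 m\<close>.\<close>
  define R where "R = (2 * m / \<omega>) powr (1 / n)"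
  have n: "n > 0" by (simp add: n_def)
  have \<omega>: "\<omega> > 0" by (simp add: \<omega>_def n_def unit_ball_vol_pos)
  have m: "m > 0" using False by (simp add: m_def zero_less_measure_iff)
  have em: "emeasure lborel E = ennreal m" using fin by (simp add: m_def emeasure_eq_ennreal_measure)
  have R: "R > 0" using m \<omega> by (simp add: R_def)
  have Rn: "\<omega> * R ^ DIM('a) = 2 * m"
    using m \<omega> n by (simp add: R_def powr_realpow[symmetric] powr_powr n_def)
  have ball: "ennreal m \<le> emeasure lborel (ball x R - E)" for x :: 'a
  proof -
    have "ennreal m + ennreal m = emeasure lborel (ball x R)"
      using R Rn m by (simp add: emeasure_ball \<omega>_def n_def flip: ennreal_plus)
    also have "\<dots> \<le> emeasure lborel ((ball x R - E) \<union> E)" by (intro emeasure_mono) auto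
    also have "\<dots> \<le> emeasure lborel (ball x R - E) + ennreal m"
      using emeasure_subadditive[of "ball x R - E" lborel E] by (simp add: em)
    finally show ?thesis by (simp add: ennreal_add_left_cancel_le add.commute)
  qed
  have "ennreal (iso_const s DIM('a) * m powr (1 - s / n)) = ennreal (m / R powr (n + s)) * ennreal m"
  proof -
    have "R powr (n + s) = (2 * m / \<omega>) powr (1 + s / n)"
      using n by (simp add: R_def powr_powr add_divide_distrib)
    then have "(\<omega> / 2 / m) powr (1 + s / n) * R powr (n + s) = 1"
      using m \<omega> by (simp flip: powr_mult)
    then have "(\<omega> / 2 / m) powr (1 + s / n) = 1 / R powr (n + s)"
      using R by (simp add: eq_divide_eq)
    then have "m / R powr (n + s) * m = m * m * (\<omega> / 2 / m) powr (1 + s / n)" by simp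
    also have "\<dots> = (\<omega> / 2) powr (1 + s / n) * (m powr 2 / m powr (1 + s / n))"
      using m \<omega> by (simp add: powr_divide powr_mult power2_eq_square)
    also have "m powr 2 / m powr (1 + s / n) = m powr (1 - s / n)"
      by (simp add: powr_diff[symmetric])
    finally show ?thesis using m by (simp add: iso_const_def \<omega>_def n_def flip: ennreal_mult)
  qed
  also have "\<dots> = (\<integral>\<^sup>+x. ennreal (m / R powr (n + s)) * indicator E x \<partial>lborel)"
    by (simp add: em nn_integral_cmult_indicator)
  also have "\<dots> \<le> frac_perimeter s E"
    unfolding frac_perimeter_def
  proof (intro nn_integral_mono)
    fix x :: 'a
    show "ennreal (m / R powr (n + s)) * indicator E x
      \<le> (\<integral>\<^sup>+y. ennreal (indicator E x * indicator (- E) y / norm (x - y) powr (real DIM('a) + s)) \<partial>lborel)"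
    proof (cases "x \<in> E")
      case True
      have "ennreal (m / R powr (n + s)) = ennreal (1 / R powr (n + s)) * ennreal m"
        using m by (simp flip: ennreal_mult)
      also have "\<dots> \<le> ennreal (1 / R powr (n + s)) * emeasure lborel (ball x R - E)"
        by (intro mult_left_mono ball) auto
      also have "\<dots> = (\<integral>\<^sup>+y. ennreal (1 / R powr (n + s)) * indicator (ball x R - E) y \<partial>lborel)"
        by (simp add: nn_integral_cmult_indicator)
      also have "\<dots> \<le> (\<integral>\<^sup>+y. ennreal (indicator E x * indicator (- E) y / norm (x - y) powr (real DIM('a) + s)) \<partial>lborel)"
      proof (intro nn_integral_mono)
        fix y
        show "ennreal (1 / R powr (n + s)) * indicator (ball x R - E) y
          \<le> ennreal (indicator E x * indicator (- E) y / norm (x - y) powr (real DIM('a) + s))"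
        proof (cases "y \<in> ball x R - E")
          case y: True
          then have "0 < norm (x - y)" "norm (x - y) \<le> R" using True by (auto simp: dist_norm)
          then have "1 / R powr (n + s) \<le> 1 / norm (x - y) powr (n + s)"
            using n \<open>0 < s\<close> R by (intro divide_left_mono powr_mono2 mult_pos_pos) auto
          then show ?thesis using y True by (simp add: n_def)
        qed simp
      qed
      finally show ?thesis using True by simp
    qed simp
  qed
  finally show ?thesis by (simp add: m_def n_def)
qed simp

text \<open>The pair \<open>(x, y)\<close> contributes to the perimeter of the level set at height \<open>t\<close> exactly when
  \<open>f(y) \<le> t < f(x)\<close>, and these \<open>t\<close> form an interval of length at most \<open>|f(x) - f(y)|\<close>.\<close>

lemma coarea_le:
  fixes f :: "'a::euclidean_space \<Rightarrow> real"
  assumes [measurable]: "f \<in> borel_measurable borel"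
  shows "(\<integral>\<^sup>+t. indicator {0<..} t * frac_perimeter s {x. t < f x} \<partial>lborel) \<le> gagliardo s f"
proof -
  define k where "k = (\<lambda>x y :: 'a. norm (x - y) powr (real DIM('a) + s))"
  define H where "H = (\<lambda>t x y. ennreal (of_bool (0 < t \<and> t < f x \<and> f y \<le> t) / k x y))"
  have k[measurable]: "case_prod k \<in> borel_measurable (borel \<Otimes>\<^sub>M borel)"
    unfolding k_def by measurable
  have [measurable]: "k x \<in> borel_measurable borel" for x
    unfolding k_def by measurable
  have k0: "k x y \<ge> 0" for x y by (simp add: k_def)
  have H: "(\<lambda>(t, x, y). H t x y) \<in> borel_measurable (borel \<Otimes>\<^sub>M borel \<Otimes>\<^sub>M borel)"
    unfolding H_def k_def by measurable
  have [measurable]: "(\<lambda>(t, y). H t x y) \<in> borel_measurable (borel \<Otimes>\<^sub>M borel)" for x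
    unfolding H_def k_def by measurable
  have [measurable]: "(\<lambda>(t, x). \<integral>\<^sup>+y. H t x y \<partial>lborel) \<in> borel_measurable (borel \<Otimes>\<^sub>M borel)"
    unfolding H_def k_def by measurable
  have "indicator {0<..} t * frac_perimeter s {x. t < f x} = (\<integral>\<^sup>+x. \<integral>\<^sup>+y. H t x y \<partial>lborel \<partial>lborel)" for t
  proof (cases "t > 0")
    case True
    then show ?thesis
      unfolding frac_perimeter_def H_def k_def
      by (auto intro!: nn_integral_cong simp: indicator_def)
  qed (simp add: H_def)
  then have "(\<integral>\<^sup>+t. indicator {0<..} t * frac_perimeter s {x. t < f x} \<partial>lborel)
      = (\<integral>\<^sup>+t. \<integral>\<^sup>+x. \<integral>\<^sup>+y. H t x y \<partial>lborel \<partial>lborel \<partial>lborel)" by simp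
  also have "\<dots> = (\<integral>\<^sup>+x. \<integral>\<^sup>+t. \<integral>\<^sup>+y. H t x y \<partial>lborel \<partial>lborel \<partial>lborel)"
    by (rule lborel_pair.Fubini'[symmetric]) measurable
  also have "\<dots> = (\<integral>\<^sup>+x. \<integral>\<^sup>+y. \<integral>\<^sup>+t. H t x y \<partial>lborel \<partial>lborel \<partial>lborel)"
    by (intro nn_integral_cong lborel_pair.Fubini'[symmetric]) measurable
  also have "\<dots> \<le> gagliardo s f"
    unfolding gagliardo_def
  proof (intro nn_integral_mono)
    fix x y
    have "(\<integral>\<^sup>+t. H t x y \<partial>lborel) \<le> (\<integral>\<^sup>+t. ennreal (1 / k x y) * indicator {f y..f x} t \<partial>lborel)"
      by (intro nn_integral_mono) (auto simp: H_def indicator_def)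
    also have "\<dots> = ennreal (1 / k x y) * emeasure lborel {f y..f x}"
      by (simp add: nn_integral_cmult_indicator)
    also have "\<dots> \<le> ennreal (1 / k x y) * ennreal (norm (f x - f y))"
      by (intro mult_left_mono) (auto simp: emeasure_lborel_Icc_eq intro!: ennreal_leI)
    also have "\<dots> = ennreal (norm (f x - f y) / k x y)"
      using k0 by (simp flip: ennreal_mult)
    finally show "(\<integral>\<^sup>+t. H t x y \<partial>lborel)
      \<le> ennreal (norm (f x - f y) / norm (x - y) powr (real DIM('a) + s))" by (simp add: k_def)
  qed
  finally show ?thesis .
qed

text \<open>Write \<open>h(t) = |{f > t}|\<^sup>1\<^sup>/\<^sup>p\<close>.  The isoperimetric and coarea inequalities bound \<open>J = \<integral> h\<close>.  Since
  \<open>h\<close> is decreasing, \<open>t h(t) \<le> J\<close>, and therefore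
  \<open>\<integral> f\<^sup>p = \<integral> p t\<^sup>p\<^sup>-\<^sup>1 h(t)\<^sup>p dt = \<integral> p (t h(t))\<^sup>p\<^sup>-\<^sup>1 h(t) dt \<le> p J\<^sup>p\<close>.\<close>

lemma frac_sobolev_of_finite_levels:
  fixes f :: "'a::euclidean_space \<Rightarrow> real"
  assumes [measurable]: "f \<in> borel_measurable borel" and f0: "\<And>x. 0 \<le> f x"
    and fin: "\<And>t. 0 < t \<Longrightarrow> emeasure lborel {x. t < f x} < \<infinity>"
    and s: "0 < s" "s < real DIM('a)" and p: "p = real DIM('a) / (real DIM('a) - s)"
    and D: "gagliardo s f \<le> ennreal D" "0 \<le> D"
  shows "(\<integral>\<^sup>+x. ennreal (f x powr p) \<partial>lborel) \<le> ennreal (p * (D / iso_const s DIM('a)) powr p)"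
proof -
  define c where "c = iso_const s DIM('a)"
  define J where "J = D / c"
  define m where "m = (\<lambda>t. measure lborel {x. t < f x})"
  define h where "h = (\<lambda>t. m t powr (1 / p))"
  have c: "c > 0" by (simp add: c_def iso_const_pos)
  have J0: "J \<ge> 0" using c D by (simp add: J_def)
  have p1: "p > 1" using s by (simp add: p)
  have ip: "1 / p = 1 - s / real DIM('a)" using s by (simp add: p field_simps)
  have [measurable]: "m \<in> borel_measurable borel"
  proof -
    have "Measurable.pred (borel \<Otimes>\<^sub>M lborel) (\<lambda>z::real\<times>'a. fst z < f (snd z))" by measurable
    then have "(\<lambda>t. emeasure lborel (Pair t -` {z::real\<times>'a. fst z < f (snd z)})) \<in> borel_measurable borel"
      by (intro lborel.measurable_emeasure_Pair) (simp add: pred_def space_pair_measure)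
    then show ?thesis unfolding m_def measure_def by simp
  qed
  have [measurable]: "h \<in> borel_measurable borel" unfolding h_def by measurable
  have em: "emeasure lborel {x. t < f x} = ennreal (m t)" if "t > 0" for t
    using fin[OF that] by (simp add: m_def emeasure_eq_ennreal_measure)
  have mono: "h t \<le> h r" if "0 < r" "r \<le> t" for r t
  proof -
    have "emeasure lborel {x. t < f x} \<le> emeasure lborel {x. r < f x}"
      using that by (intro emeasure_mono) auto
    then have "m t \<le> m r" using that by (simp add: em m_def)
    then show ?thesis unfolding h_def using p1 by (intro powr_mono2) (auto simp: m_def)
  qed
  have hJ: "(\<integral>\<^sup>+t. indicator {0<..} t * ennreal (h t) \<partial>lborel) \<le> ennreal J"
  proof -
    have "ennreal c * (\<integral>\<^sup>+t. indicator {0<..} t * ennreal (h t) \<partial>lborel)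
        = (\<integral>\<^sup>+t. ennreal c * (indicator {0<..} t * ennreal (h t)) \<partial>lborel)"
      by (intro nn_integral_cmult[symmetric]) measurable
    also have "\<dots> \<le> (\<integral>\<^sup>+t. indicator {0<..} t * frac_perimeter s {x. t < f x} \<partial>lborel)"
    proof (intro nn_integral_mono)
      fix t :: real
      show "ennreal c * (indicator {0<..} t * ennreal (h t)) \<le> indicator {0<..} t * frac_perimeter s {x. t < f x}"
      proof (cases "t > 0")
        case True
        have "ennreal c * ennreal (h t) = ennreal (c * m t powr (1 - s / real DIM('a)))"
          using c by (simp add: h_def ip flip: ennreal_mult)
        also have "\<dots> \<le> frac_perimeter s {x. t < f x}"
          unfolding c_def m_def by (rule frac_isoperimetric) (use fin True s in auto)
        finally show ?thesis using True by simp
      qed simp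
    qed
    also have "\<dots> \<le> gagliardo s f" by (rule coarea_le) measurable
    also have "\<dots> \<le> ennreal D" by (rule D)
    also have "\<dots> = ennreal c * ennreal J" using c J0 by (simp add: J_def flip: ennreal_mult)
    finally show ?thesis using c by (simp add: ennreal_mult_le_mult_iff)
  qed
  have th: "t * h t \<le> J" if t: "t > 0" for t
  proof -
    have "ennreal (t * h t) = (\<integral>\<^sup>+r. ennreal (h t) * indicator {0<..t} r \<partial>lborel)"
      using t by (simp add: nn_integral_cmult_indicator h_def mult.commute[of t] ennreal_mult)
    also have "\<dots> \<le> (\<integral>\<^sup>+r. indicator {0<..} r * ennreal (h r) \<partial>lborel)"
      by (intro nn_integral_mono) (auto simp: indicator_def intro!: ennreal_leI mono)
    finally have "ennreal (t * h t) \<le> ennreal J" using hJ by order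
    then show ?thesis using J0 by simp
  qed
  have pt: "p * t powr (p - 1) * m t \<le> p * J powr (p - 1) * h t" if t: "t > 0" for t
  proof -
    have "m t = h t powr p" using p1 by (simp add: h_def powr_powr m_def)
    also have "\<dots> = h t powr (p - 1) * h t"
      using powr_add[of "h t" "p - 1" 1] by (simp add: h_def)
    finally have "t powr (p - 1) * m t = (t * h t) powr (p - 1) * h t"
      using t by (simp add: powr_mult h_def)
    also have "\<dots> \<le> J powr (p - 1) * h t"
      using th[OF t] t p1 by (intro mult_right_mono powr_mono2) (auto simp: h_def)
    finally show ?thesis using p1 by (simp add: mult.assoc)
  qed
  have layer: "ennreal (f x powr p) = (\<integral>\<^sup>+t. ennreal (of_bool (0 < t \<and> t < f x) * (p * t powr (p - 1))) \<partial>lborel)" for x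
  proof -
    have "((\<lambda>t. p * t powr (p - 1)) has_integral p * (f x powr (p - 1 + 1) / (p - 1 + 1))) {0..f x}"
      using p1 f0 by (intro has_integral_mult_right has_integral_powr_from_0) auto
    then have "ennreal (f x powr p) = (\<integral>\<^sup>+t. ennreal (p * t powr (p - 1)) * indicator {0..f x} t \<partial>lborel)"
      using p1 by (subst nn_integral_has_integral_lebesgue') auto
    also have "\<dots> = (\<integral>\<^sup>+t. ennreal (of_bool (0 < t \<and> t < f x) * (p * t powr (p - 1))) \<partial>lborel)"
    proof (intro nn_integral_cong_AE)
      have "AE t in lborel. t \<notin> {0, f x}" 
        by (intro AE_not_in) (auto intro: countable_imp_null_set_lborel)
      then show "AE t in lborel. ennreal (p * t powr (p - 1)) * indicator {0..f x} t
          = ennreal (of_bool (0 < t \<and> t < f x) * (p * t powr (p - 1)))"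
        by eventually_elim (auto simp: indicator_def)
    qed
    finally show ?thesis .
  qed
  have "(\<integral>\<^sup>+x. ennreal (f x powr p) \<partial>lborel)
      = (\<integral>\<^sup>+x. \<integral>\<^sup>+t. ennreal (of_bool (0 < t \<and> t < f x) * (p * t powr (p - 1))) \<partial>lborel \<partial>lborel)"
    by (simp add: layer)
  also have "\<dots> = (\<integral>\<^sup>+t. \<integral>\<^sup>+x. ennreal (of_bool (0 < t \<and> t < f x) * (p * t powr (p - 1))) \<partial>lborel \<partial>lborel)"
    by (rule lborel_pair.Fubini'[symmetric]) measurable
  also have "\<dots> \<le> (\<integral>\<^sup>+t. ennreal (p * J powr (p - 1)) * (indicator {0<..} t * ennreal (h t)) \<partial>lborel)"
  proof (intro nn_integral_mono)
    fix t :: real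
    show "(\<integral>\<^sup>+x. ennreal (of_bool (0 < t \<and> t < f x) * (p * t powr (p - 1))) \<partial>lborel)
        \<le> ennreal (p * J powr (p - 1)) * (indicator {0<..} t * ennreal (h t))"
    proof (cases "t > 0")
      case True
      have "(\<integral>\<^sup>+x. ennreal (of_bool (0 < t \<and> t < f x) * (p * t powr (p - 1))) \<partial>lborel)
          = (\<integral>\<^sup>+x. ennreal (p * t powr (p - 1)) * indicator {x. t < f x} x \<partial>lborel)"
        using True by (intro nn_integral_cong) (auto simp: indicator_def)
      also have "\<dots> = ennreal (p * t powr (p - 1)) * ennreal (m t)"
        using True by (simp add: nn_integral_cmult_indicator em)
      also have "\<dots> = ennreal (p * t powr (p - 1) * m t)" using p1 by (simp add: m_def flip: ennreal_mult)
      also have "\<dots> \<le> ennreal (p * J powr (p - 1) * h t)" by (intro ennreal_leI pt True)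
      also have "\<dots> = ennreal (p * J powr (p - 1)) * ennreal (h t)"
        using p1 by (simp add: h_def flip: ennreal_mult)
      finally show ?thesis using True by simp
    qed simp
  qed
  also have "\<dots> = ennreal (p * J powr (p - 1)) * (\<integral>\<^sup>+t. indicator {0<..} t * ennreal (h t) \<partial>lborel)"
    by (intro nn_integral_cmult) measurable
  also have "\<dots> \<le> ennreal (p * J powr (p - 1)) * ennreal J"
    by (intro mult_left_mono hJ) auto
  also have "\<dots> = ennreal (p * J powr p)"
    using p1 J0 powr_add[of J "p - 1" 1] by (simp add: mult.assoc flip: ennreal_mult)
  finally show ?thesis by (simp add: J_def c_def)
qed

lemma geometric_steps_converge:
  fixes b :: "nat \<Rightarrow> 'b::banach"
  assumes b: "\<And>k. norm (b (Suc k) - b k) \<le> M * q ^ k" and q: "0 \<le> q" "q < 1" and M: "0 \<le> M"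
  obtains L where "b \<longlonglongrightarrow> L" "\<And>k. norm (b k - L) \<le> M * q ^ k / (1 - q)"
proof -
  have *: "norm (b (k + j) - b k) \<le> M * q ^ k / (1 - q) * (1 - q ^ j)" for k j
  proof (induction j)
    case (Suc j)
    have "norm (b (k + Suc j) - b k) \<le> norm (b (Suc (k + j)) - b (k + j)) + norm (b (k + j) - b k)"
      using norm_triangle_ineq[of "b (Suc (k + j)) - b (k + j)" "b (k + j) - b k"] by simp
    also have "\<dots> \<le> M * q ^ (k + j) + M * q ^ k / (1 - q) * (1 - q ^ j)"
      by (intro add_mono b Suc.IH)
    also have "\<dots> = M * q ^ k / (1 - q) * (1 - q ^ Suc j)"
      using q by (simp add: field_simps power_add)
    finally show ?case .
  qed simp
  have le: "norm (b (k + j) - b k) \<le> M * q ^ k / (1 - q)" for k j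
  proof -
    have "M * q ^ k / (1 - q) * (1 - q ^ j) \<le> M * q ^ k / (1 - q) * 1"
      using q M by (intro mult_left_mono) auto
    then show ?thesis using *[of k j] by simp
  qed
  have lim: "(\<lambda>k. M * q ^ k / (1 - q)) \<longlonglongrightarrow> 0"
    using q tendsto_mult_left[OF LIMSEQ_realpow_zero[OF q], of "M / (1 - q)"] by simp
  have "Cauchy b"
  proof (rule metric_CauchyI)
    fix e :: real assume "e > 0"
    then obtain N where N: "M * q ^ N / (1 - q) < e / 2"
      using order_tendstoD(2)[OF lim, of "e / 2"] by (auto simp: eventually_sequentially)
    have "dist (b i) (b j) < e" if "i \<ge> N" "j \<ge> N" for i j
    proof -
      have "dist (b i) (b N) < e / 2" "dist (b j) (b N) < e / 2"
        using order.strict_trans1[OF le[of N "i - N"] N] order.strict_trans1[OF le[of N "j - N"] N] that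
        by (simp_all add: dist_norm)
      then show ?thesis using dist_triangle_half_l by blast
    qed
    then show "\<exists>N. \<forall>i\<ge>N. \<forall>j\<ge>N. dist (b i) (b j) < e" by blast
  qed
  then obtain L where L: "b \<longlonglongrightarrow> L" using Cauchy_convergent convergent_def by blast
  have "norm (b k - L) \<le> M * q ^ k / (1 - q)" for k
  proof -
    have "(\<lambda>j. norm (b (k + j) - b k)) \<longlonglongrightarrow> norm (L - b k)"
      using LIMSEQ_ignore_initial_segment[OF L, of k] by (intro tendsto_intros) (simp add: add.commute)
    then have "norm (L - b k) \<le> M * q ^ k / (1 - q)"
      by (rule LIMSEQ_le_const2) (use le in auto)
    then show ?thesis by (simp add: norm_minus_commute)
  qed
  then show ?thesis using that L by blast
qed

definition mean_on :: "('a::euclidean_space \<Rightarrow> complex) \<Rightarrow> 'a set \<Rightarrow> complex" where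
  "mean_on g A = (LINT w:A|lborel. g w) /\<^sub>R measure lborel A"

lemma mean_on_minus_const_le:
  assumes A: "A \<in> sets borel" "emeasure lborel A < \<infinity>" and g: "set_integrable lborel A g"
  shows "ennreal (measure lborel A * norm (mean_on g A - c))
    \<le> (\<integral>\<^sup>+w. ennreal (norm (g w - c)) * indicator A w \<partial>lborel)"
proof (cases "measure lborel A = 0")
  case False
  have c: "set_integrable lborel A (\<lambda>_. c)"
    using A unfolding set_integrable_def by (intro integrable_scaleR_left integrable_real_indicator) auto
  have const: "(LINT w:A|lborel. c) = measure lborel A *\<^sub>R c"
    using A by (simp add: set_lebesgue_integral_def)
  have "measure lborel A *\<^sub>R (mean_on g A - c) = (LINT w:A|lborel. g w - c)"
    using set_integral_diff(2)[OF g c] False const by (simp add: mean_on_def scaleR_diff_right)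
  then have "measure lborel A * norm (mean_on g A - c) = norm (LINT w|lborel. indicator A w *\<^sub>R (g w - c))"
    unfolding set_lebesgue_integral_def by (metis norm_scaleR abs_of_nonneg measure_nonneg)
  also have "ennreal \<dots> \<le> (\<integral>\<^sup>+w. norm (indicator A w *\<^sub>R (g w - c)) \<partial>lborel)"
    using set_integral_diff(1)[OF g c] unfolding set_integrable_def by (rule integral_norm_bound_ennreal)
  also have "\<dots> = (\<integral>\<^sup>+w. ennreal (norm (g w - c)) * indicator A w \<partial>lborel)"
    by (intro nn_integral_cong) (auto simp: indicator_def)
  finally show ?thesis .
qed simp

lemma oscillation_le_gagliardo_density:
  fixes g :: "'a::euclidean_space \<Rightarrow> complex"
  assumes [measurable]: "g \<in> borel_measurable borel" and B: "B \<in> sets borel"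
    and d: "\<And>w. w \<in> B \<Longrightarrow> norm (x - w) \<le> d" and s: "0 < s"
  shows "(\<integral>\<^sup>+w. ennreal (norm (g w - g x)) * indicator B w \<partial>lborel)
    \<le> ennreal (d powr (real DIM('a) + s)) *
       (\<integral>\<^sup>+w. ennreal (norm (g x - g w) / norm (x - w) powr (real DIM('a) + s)) \<partial>lborel)"
proof -
  let ?a = "real DIM('a) + s"
  have "(\<integral>\<^sup>+w. ennreal (norm (g w - g x)) * indicator B w \<partial>lborel)
    \<le> (\<integral>\<^sup>+w. ennreal (d powr ?a) * ennreal (norm (g x - g w) / norm (x - w) powr ?a) \<partial>lborel)"
  proof (intro nn_integral_mono)
    fix w
    show "ennreal (norm (g w - g x)) * indicator B w
        \<le> ennreal (d powr ?a) * ennreal (norm (g x - g w) / norm (x - w) powr ?a)"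
    proof (cases "w \<in> B \<and> w \<noteq> x")
      case True
      then have "norm (x - w) powr ?a \<le> d powr ?a" using d s by (intro powr_mono2) auto
      moreover have "0 < norm (x - w) powr ?a" using True by auto
      ultimately have "norm (g w - g x) \<le> d powr ?a * (norm (g x - g w) / norm (x - w) powr ?a)"
        using mult_right_mono[of "norm (x - w) powr ?a" "d powr ?a" "norm (g x - g w)"]
        by (simp add: pos_le_divide_eq norm_minus_commute mult.commute)
      then show ?thesis using True by (simp flip: ennreal_mult)
    qed (auto simp: indicator_def)
  qed
  also have "\<dots> = ennreal (d powr ?a) *
       (\<integral>\<^sup>+w. ennreal (norm (g x - g w) / norm (x - w) powr ?a) \<partial>lborel)"
    by (intro nn_integral_cmult) measurable
  finally show ?thesis .
qed

text \<open>Points of the two sets are at distance at most \<open>d\<close>, so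
  \<open>|g(z) - g(w)| \<le> d\<^sup>n\<^sup>+\<^sup>s |g(z) - g(w)| / |z - w|\<^sup>n\<^sup>+\<^sup>s\<close>; average in \<open>w\<close>, then in \<open>z\<close>.\<close>

lemma mean_on_diff_le:
  fixes g :: "'a::euclidean_space \<Rightarrow> complex"
  assumes [measurable]: "g \<in> borel_measurable borel"
    and A: "A \<in> sets borel" "emeasure lborel A < \<infinity>" "set_integrable lborel A g"
    and B: "B \<in> sets borel" "emeasure lborel B < \<infinity>" "set_integrable lborel B g"
    and d: "\<And>z w. z \<in> A \<Longrightarrow> w \<in> B \<Longrightarrow> norm (z - w) \<le> d" and s: "0 < s"
    and D: "gagliardo s g \<le> ennreal D" "0 \<le> D"
  shows "measure lborel A * measure lborel B * norm (mean_on g A - mean_on g B)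
    \<le> d powr (real DIM('a) + s) * D"
proof -
  let ?a = "real DIM('a) + s"
  let ?\<delta> = "\<lambda>z. \<integral>\<^sup>+w. ennreal (norm (g z - g w) / norm (z - w) powr ?a) \<partial>lborel"
  have "ennreal (measure lborel A * measure lborel B * norm (mean_on g A - mean_on g B))
      = ennreal (measure lborel B) * ennreal (measure lborel A * norm (mean_on g A - mean_on g B))"
    by (simp add: mult_ac flip: ennreal_mult)
  also have "\<dots> \<le> ennreal (measure lborel B) * (\<integral>\<^sup>+z. ennreal (norm (g z - mean_on g B)) * indicator A z \<partial>lborel)"
    by (intro mult_left_mono mean_on_minus_const_le A) auto
  also have "\<dots> = (\<integral>\<^sup>+z. ennreal (measure lborel B) * (ennreal (norm (g z - mean_on g B)) * indicator A z) \<partial>lborel)"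
    using A(1) by (intro nn_integral_cmult[symmetric]) (auto intro!: borel_measurable_times_ennreal)
  also have "\<dots> \<le> (\<integral>\<^sup>+z. ennreal (d powr ?a) * ?\<delta> z \<partial>lborel)"
  proof (intro nn_integral_mono)
    fix z
    show "ennreal (measure lborel B) * (ennreal (norm (g z - mean_on g B)) * indicator A z) \<le> ennreal (d powr ?a) * ?\<delta> z"
    proof (cases "z \<in> A")
      case True
      have "ennreal (measure lborel B) * ennreal (norm (g z - mean_on g B))
          = ennreal (measure lborel B * norm (mean_on g B - g z))"
        by (simp add: norm_minus_commute flip: ennreal_mult)
      also have "\<dots> \<le> (\<integral>\<^sup>+w. ennreal (norm (g w - g z)) * indicator B w \<partial>lborel)"
        by (intro mean_on_minus_const_le B)
      also have "\<dots> \<le> ennreal (d powr ?a) * ?\<delta> z"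
        by (intro oscillation_le_gagliardo_density B d True s) measurable
      finally show ?thesis using True by simp
    qed simp
  qed
  also have "\<dots> = ennreal (d powr ?a) * gagliardo s g"
    unfolding gagliardo_def by (intro nn_integral_cmult) measurable
  also have "\<dots> \<le> ennreal (d powr ?a) * ennreal D"
    by (intro mult_left_mono D) auto
  finally show ?thesis using D by (simp flip: ennreal_mult)
qed

text \<open>The constant is the common limit of the means over large balls.  Fix a radius \<open>r = 2\<^sup>k\<close> so large that
  all means over balls of radius \<open>r\<close> are within \<open>t / 2\<close> of \<open>C\<close>.  Where \<open>|g(x) - C| > t\<close>, the value
  \<open>g(x)\<close> is at distance at least \<open>t / 2\<close> from the mean over its own ball, which forces
  \<open>\<integral> |g(x) - g(w)| / |x - w|\<^sup>n\<^sup>+\<^sup>s dw\<close> to be bounded below; Markov's inequality concludes.\<close>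

lemma frac_finite_levels:
  fixes g :: "'a::euclidean_space \<Rightarrow> complex"
  assumes [measurable]: "g \<in> borel_measurable borel"
    and loc: "\<And>x r. set_integrable lborel (ball x r) g"
    and s: "0 < s" "s < real DIM('a)" and fin: "gagliardo s g < \<infinity>"
  obtains C where "\<And>t. 0 < t \<Longrightarrow> emeasure lborel {x. t < norm (g x - C)} < \<infinity>"
proof -
  define n where "n = real DIM('a)"
  define \<omega> where "\<omega> = unit_ball_vol n"
  define D where "D = enn2real (gagliardo s g)"
  have D: "gagliardo s g = ennreal D" "0 \<le> D" using fin by (auto simp: D_def)
  have n: "n > 0" by (simp add: n_def)
  have \<omega>: "\<omega> > 0" by (simp add: \<omega>_def n_def unit_ball_vol_pos)
  define q where "q = 2 powr (s - n)"
  have q: "0 < q" "q < 1" using s by (auto simp: q_def n_def powr_less_one)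
  define M where "M = 4 powr (n + s) * D / \<omega>\<^sup>2"
  have M: "0 \<le> M" using D by (simp add: M_def)
  define b where "b = (\<lambda>x k. mean_on g (ball x (2 ^ k)))"
  have vol: "measure lborel (ball x r) = \<omega> * r powr n" if "r > 0" for x :: 'a and r
    using that by (simp add: content_ball \<omega>_def n_def powr_realpow)
  \<comment> \<open>Two balls of radius about \<open>2\<^sup>k\<close> with centres at distance at most \<open>2\<^sup>k\<close>: any two of their points
    are at distance at most \<open>4 * 2\<^sup>k\<close>.\<close>
  have close: "norm (b x k - b y j) \<le> M * q ^ k" if "norm (x - y) \<le> 2 ^ k" "j = k \<or> j = Suc k" for x y k j
  proof -
    let ?r = "2 ^ k :: real" and ?r' = "2 ^ j :: real"
    have r: "0 < ?r" "?r \<le> ?r'" "?r' \<le> 2 * ?r" using that(2) by auto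
    have "measure lborel (ball x ?r) * measure lborel (ball y ?r') * norm (b x k - b y j)
        \<le> (4 * ?r) powr (real DIM('a) + s) * D"
      unfolding b_def
    proof (rule mean_on_diff_le)
      fix z w assume "z \<in> ball x (2 ^ k)" "w \<in> ball y (2 ^ j)"
      then have "dist x z < ?r" "dist y w < ?r'" by auto
      moreover have "dist z w \<le> dist x z + dist x y + dist y w"
        using dist_triangle[of z w x] dist_triangle[of x w y] by (simp add: dist_commute)
      ultimately show "norm (z - w) \<le> 4 * ?r" using that(1) r by (simp add: dist_norm)
    qed (use loc s D in \<open>auto simp: emeasure_ball\<close>)
    moreover have "\<omega> * ?r powr n * (\<omega> * ?r powr n) \<le> measure lborel (ball x ?r) * measure lborel (ball y ?r')"
      using r n \<omega> by (auto simp: vol intro!: mult_left_mono mult_mono powr_mono2)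
    ultimately have "\<omega> * ?r powr n * (\<omega> * ?r powr n) * norm (b x k - b y j) \<le> (4 * ?r) powr (n + s) * D"
      unfolding n_def by (meson mult_right_mono norm_ge_zero order_trans)
    then have "norm (b x k - b y j) \<le> (4 * ?r) powr (n + s) * D / (\<omega> * ?r powr n * (\<omega> * ?r powr n))"
      using \<omega> by (subst pos_le_divide_eq) (auto simp: mult_ac)
    also have "\<dots> = M * (?r powr (n + s) / (?r powr n * ?r powr n))"
      by (simp add: M_def powr_mult power2_eq_square mult_ac)
    also have "?r powr (n + s) / (?r powr n * ?r powr n) = ?r powr (s - n)"
      by (simp add: powr_add powr_diff)
    also have "?r powr (s - n) = q ^ k"
      by (simp add: q_def powr_realpow[symmetric] powr_powr mult.commute)
    finally show ?thesis .
  qed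
  have step: "norm (b x (Suc k) - b x k) \<le> M * q ^ k" for x k
    using close[of x x k "Suc k"] by (simp add: norm_minus_commute)
  obtain C where C: "b 0 \<longlonglongrightarrow> C"
    by (rule geometric_steps_converge[of "b 0" M q]) (use step q M in auto)
  have lim0: "(\<lambda>k. M * q ^ k) \<longlonglongrightarrow> 0"
    using q by (auto intro!: tendsto_mult_right_zero LIMSEQ_realpow_zero)
  have mean_C: "norm (b x k - C) \<le> M * q ^ k / (1 - q)" for x k
  proof -
    obtain L where L: "b x \<longlonglongrightarrow> L" "\<And>k. norm (b x k - L) \<le> M * q ^ k / (1 - q)"
      by (rule geometric_steps_converge[of "b x" M q]) (use step q M in auto)
    have "\<forall>\<^sub>F k in sequentially. norm x \<le> 2 ^ k"
    proof -
      obtain k0 :: nat where k0: "norm x < 2 ^ k0" using real_arch_pow[of 2 "norm x"] by auto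
      show ?thesis using eventually_ge_at_top[of k0]
      proof eventually_elim
        case (elim k)
        then have "(2::real) ^ k0 \<le> 2 ^ k" by (intro power_increasing) auto
        then show ?case using k0 by linarith
      qed
    qed
    then have "\<forall>\<^sub>F k in sequentially. norm (b x k - b 0 k) \<le> M * q ^ k"
      by eventually_elim (use close[of x 0] in auto)
    then have "(\<lambda>k. b x k - b 0 k) \<longlonglongrightarrow> 0"
      using lim0 by (rule Lim_null_comparison)
    from tendsto_add[OF this C] have "b x \<longlonglongrightarrow> C" by simp
    then show ?thesis using L LIMSEQ_unique by blast
  qed
  have "emeasure lborel {x. t < norm (g x - C)} < \<infinity>" if t: "t > 0" for t
  proof -
    have "(\<lambda>k. M * q ^ k / (1 - q)) \<longlonglongrightarrow> 0 / (1 - q)"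
      using q by (intro tendsto_divide lim0 tendsto_const) auto
    then have "\<forall>\<^sub>F k in sequentially. M * q ^ k / (1 - q) < t / 2"
      using t by (intro order_tendstoD(2)[of _ "0 / (1 - q)"]) auto
    then obtain k where k: "M * q ^ k / (1 - q) < t / 2" by (auto simp: eventually_sequentially)
    let ?r = "2 ^ k :: real"
    let ?\<delta> = "\<lambda>x. \<integral>\<^sup>+w. ennreal (norm (g x - g w) / norm (x - w) powr (real DIM('a) + s)) \<partial>lborel"
    define v where "v = \<omega> * ?r powr n"
    define e where "e = v * (t / 2)"
    have e: "e > 0" using t \<omega> by (simp add: e_def v_def)
    have sub: "ennreal e \<le> ennreal (?r powr (real DIM('a) + s)) * ?\<delta> x" if "t < norm (g x - C)" for x
    proof -
      have "norm (g x - C) \<le> norm (b x k - g x) + norm (b x k - C)"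
        using norm_triangle_ineq4[of "b x k - C" "b x k - g x"] by (simp add: add.commute)
      then have "t / 2 \<le> norm (b x k - g x)" using that mean_C[of x k] k by linarith
      then have "ennreal e \<le> ennreal (measure lborel (ball x ?r) * norm (b x k - g x))"
        using \<omega> by (auto simp: e_def v_def vol intro!: ennreal_leI mult_left_mono)
      also have "\<dots> \<le> (\<integral>\<^sup>+w. ennreal (norm (g w - g x)) * indicator (ball x ?r) w \<partial>lborel)"
        unfolding b_def by (intro mean_on_minus_const_le loc) (auto simp: emeasure_ball)
      also have "\<dots> \<le> ennreal (?r powr (real DIM('a) + s)) * ?\<delta> x"
        by (rule oscillation_le_gagliardo_density) (use s in \<open>auto simp: dist_norm\<close>)
      finally show ?thesis .
    qed
    have "ennreal e * emeasure lborel {x. t < norm (g x - C)}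
        = (\<integral>\<^sup>+x. ennreal e * indicator {x. t < norm (g x - C)} x \<partial>lborel)"
      by (intro nn_integral_cmult_indicator[symmetric]) measurable
    also have "\<dots> \<le> (\<integral>\<^sup>+x. ennreal (?r powr (real DIM('a) + s)) * ?\<delta> x \<partial>lborel)"
      using sub by (intro nn_integral_mono) (auto simp: indicator_def)
    also have "\<dots> = ennreal (?r powr (real DIM('a) + s)) * gagliardo s g"
      unfolding gagliardo_def by (intro nn_integral_cmult) measurable
    also have "\<dots> < \<infinity>" using fin by (simp add: ennreal_mult_less_top)
    finally show ?thesis using e by (auto simp: ennreal_mult_less_top ennreal_mult_eq_top_iff less_top)
  qed
  then show ?thesis by (rule that)
qed

lemma frac_sobolev:
  fixes g :: "'a::euclidean_space \<Rightarrow> complex"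
  assumes [measurable]: "g \<in> borel_measurable borel"
    and loc: "\<And>x r. set_integrable lborel (ball x r) g"
    and s: "0 < s" "s < real DIM('a)" and p: "p = real DIM('a) / (real DIM('a) - s)"
    and D: "gagliardo s g \<le> ennreal D" "0 \<le> D"
  obtains C where "(\<integral>\<^sup>+x. ennreal (norm (g x - C) powr p) \<partial>lborel)
    \<le> ennreal (p * (D / iso_const s DIM('a)) powr p)"
proof -
  have "gagliardo s g < \<infinity>" using D(1) by (simp add: le_less_trans)
  then obtain C where C: "\<And>t. 0 < t \<Longrightarrow> emeasure lborel {x. t < norm (g x - C)} < \<infinity>"
    using frac_finite_levels[of g s] loc s by auto
  have "gagliardo s (\<lambda>x. norm (g x - C)) \<le> gagliardo s g"
    unfolding gagliardo_def
  proof (intro nn_integral_mono ennreal_leI divide_right_mono)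
    show "norm (norm (g x - C) - norm (g y - C)) \<le> norm (g x - g y)" for x y
      using norm_triangle_ineq3[of "g x - C" "g y - C"] by simp
  qed auto
  then have "gagliardo s (\<lambda>x. norm (g x - C)) \<le> ennreal D" using D by order
  then have "(\<integral>\<^sup>+x. ennreal (norm (g x - C) powr p) \<partial>lborel)
    \<le> ennreal (p * (D / iso_const s DIM('a)) powr p)"
    using C s p D by (intro frac_sobolev_of_finite_levels) auto
  then show ?thesis by (rule that)
qed

section \<open>From separated tests to a function\<close>

lemma separated_sym: "separated A B \<Longrightarrow> separated B A"
  unfolding separated_def by (metis norm_minus_commute)

lemma separated_halfspaces_inner:
  fixes e :: "'a::euclidean_space"
  assumes e: "e \<in> Basis" and "closed A" "closed B"
    and gap: "\<And>x y. x \<in> A \<Longrightarrow> y \<in> B \<Longrightarrow> x \<bullet> e + 1 \<le> y \<bullet> e"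
  shows "separated A B"
  unfolding separated_def
proof (intro conjI exI[of _ 1] ballI)
  fix x y assume "x \<in> A" "y \<in> B"
  then have "1 \<le> \<bar>(x - y) \<bullet> e\<bar>" using gap[of x y] by (simp add: inner_diff_left)
  also have "\<dots> \<le> norm (x - y)" using e by (rule Basis_le_norm)
  finally show "1 \<le> norm (x - y)" .
qed (use assms in auto)

lemma separated_small_cubes:
  fixes x y :: "'a::euclidean_space"
  assumes "x \<noteq> y"
  obtains d where "0 < d"
    "\<And>h. 0 < h \<Longrightarrow> h < d \<Longrightarrow> separated (cbox x (x + h *\<^sub>R One)) (cbox y (y + h *\<^sub>R One))"
proof -
  let ?S = "real DIM('a)"
  define d where "d = norm (x - y) / (4 * ?S)"
  have d: "0 < d" using assms by (simp add: d_def)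
  have near: "norm (v' - v) \<le> norm (x - y) / 4" if "v' \<in> cbox v (v + h *\<^sub>R One)" "0 < h" "h < d" for v v' :: 'a and h
  proof -
    have "norm (v' - v) \<le> (\<Sum>i\<in>Basis. \<bar>(v' - v) \<bullet> i\<bar>)" by (rule norm_le_l1)
    also have "\<dots> \<le> (\<Sum>i\<in>(Basis::'a set). h)"
      using that by (intro sum_mono) (auto simp: mem_box inner_diff_left inner_add_left)
    also have "\<dots> \<le> ?S * d" using that by simp
    finally show ?thesis by (simp add: d_def)
  qed
  show ?thesis
  proof (rule that[OF d])
    fix h assume h: "0 < h" "h < d"
    show "separated (cbox x (x + h *\<^sub>R One)) (cbox y (y + h *\<^sub>R One))"
      unfolding separated_def
    proof (intro conjI exI[of _ "norm (x - y) / 2"] ballI)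
      fix x' y' assume "x' \<in> cbox x (x + h *\<^sub>R One)" "y' \<in> cbox y (y + h *\<^sub>R One)"
      then have "norm (x' - x) \<le> norm (x - y) / 4" "norm (y' - y) \<le> norm (x - y) / 4"
        using near h by auto
      moreover have "norm (x - y) \<le> norm (x' - x) + norm (x' - y') + norm (y' - y)"
        using norm_triangle_ineq4[of "x' - y'" "x' - x"] norm_triangle_ineq[of "x - y'" "y' - y"]
        by (simp add: norm_minus_commute)
      ultimately show "norm (x - y) / 2 \<le> norm (x' - y')" by linarith
    qed (use assms in auto)
  qed
qed

text \<open>The hypothesis is the identity \<open>(\<integral>\<psi>) w(\<phi>) - (\<integral>\<phi>) w(\<psi>) = \<integral>\<integral> K \<phi> \<psi>\<close> for separated supports.
  Fixing a \<open>\<psi>\<close> of integral one shows that \<open>w\<close> is integration against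
  \<open>w(\<psi>) + \<integral> K(x, y) \<psi>(y) dy\<close> on test functions supported away from \<open>\<psi>\<close>; two such \<open>\<psi>\<close>, on either
  side of a slab, suffice for all test functions.  Once \<open>w\<close> is given by \<open>g\<close>, the hypothesis says that
  \<open>K(x, y) - g(x) + g(y)\<close> integrates to zero against products of separated bumps, hence over small
  cubes away from the diagonal.\<close>

lemma separated_kernel_representation:
  fixes w :: "('a::euclidean_space \<Rightarrow> complex) \<Rightarrow> complex" and K :: "'a \<times> 'a \<Rightarrow> complex"
  assumes K[measurable]: "K \<in> borel_measurable borel"
    and Kloc: "\<And>a b. set_integrable lborel (cbox a b) K"
    and add: "\<And>f g. f \<in> schwartz \<Longrightarrow> g \<in> schwartz \<Longrightarrow> w (\<lambda>x. f x + g x) = w f + w g"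
    and Kint: "\<And>A B \<phi> \<psi>. separated A B \<Longrightarrow> \<phi> \<in> schwartz \<Longrightarrow> supported_in \<phi> A \<Longrightarrow>
      \<psi> \<in> schwartz \<Longrightarrow> supported_in \<psi> B \<Longrightarrow> integrable lborel (\<lambda>(x, y). K (x, y) * (\<phi> x * \<psi> y))"
    and Kid: "\<And>A B \<phi> \<psi>. separated A B \<Longrightarrow> \<phi> \<in> schwartz \<Longrightarrow> supported_in \<phi> A \<Longrightarrow>
      \<psi> \<in> schwartz \<Longrightarrow> supported_in \<psi> B \<Longrightarrow>
      integral\<^sup>L lborel \<psi> * w \<phi> - integral\<^sup>L lborel \<phi> * w \<psi> = (LINT (x, y)|lborel. K (x, y) * (\<phi> x * \<psi> y))"
  shows "\<exists>g \<in> borel_measurable borel.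
    (\<forall>\<phi>\<in>schwartz. integrable lborel (\<lambda>x. g x * \<phi> x) \<and> w \<phi> = (LINT x|lborel. g x * \<phi> x)) \<and>
    (AE z in lborel. fst z \<noteq> snd z \<longrightarrow> K z = g (fst z) - g (snd z))"
proof -
  define k where "k = (\<lambda>\<psi> x. LINT y|lborel. K (x, y) * \<psi> y)"
  have k_meas: "k \<psi> \<in> borel_measurable borel" if "\<psi> \<in> schwartz" for \<psi>
  proof -
    note [measurable] = schwartz_borel[OF that]
    show ?thesis unfolding k_def by measurable
  qed
  have local_rep: "integrable lborel (\<lambda>x. (w \<psi> + k \<psi> x) * \<phi> x) \<and> w \<phi> = (LINT x|lborel. (w \<psi> + k \<psi> x) * \<phi> x)"
    if AB: "separated A B" and \<phi>: "\<phi> \<in> schwartz" "supported_in \<phi> A"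
      and \<psi>: "\<psi> \<in> schwartz" "supported_in \<psi> B" "integral\<^sup>L lborel \<psi> = 1" for A B \<phi> \<psi>
  proof -
    note [measurable] = schwartz_borel[OF \<phi>(1)] schwartz_borel[OF \<psi>(1)]
    have int: "integrable (lborel \<Otimes>\<^sub>M lborel) (\<lambda>(x, y). K (x, y) * (\<phi> x * \<psi> y))"
      using Kint[OF AB \<phi> \<psi>(1,2)] by (simp add: lborel_prod)
    have inner: "(LINT y|lborel. K (x, y) * (\<phi> x * \<psi> y)) = k \<psi> x * \<phi> x" for x
    proof -
      have "(LINT y|lborel. K (x, y) * (\<phi> x * \<psi> y)) = (LINT y|lborel. \<phi> x * (K (x, y) * \<psi> y))"
        by (simp add: mult_ac)
      then show ?thesis by (simp add: k_def)
    qed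
    have i1: "integrable lborel (\<lambda>x. k \<psi> x * \<phi> x)"
      using lborel_pair.integrable_fst'[OF int] by (simp add: inner)
    have e1: "(LINT x|lborel. k \<psi> x * \<phi> x) = (LINT (x, y)|lborel. K (x, y) * (\<phi> x * \<psi> y))"
      using lborel_pair.integral_fst'[OF int] by (simp add: inner lborel_prod)
    have i2: "integrable lborel (\<lambda>x. w \<psi> * \<phi> x)"
      using schwartz_integrable[OF \<phi>(1)] by simp
    have "w \<phi> = integral\<^sup>L lborel \<phi> * w \<psi> + (LINT x|lborel. k \<psi> x * \<phi> x)"
      using Kid[OF AB \<phi> \<psi>(1,2)] \<psi>(3) e1 by (simp add: diff_eq_eq add.commute)
    also have "\<dots> = (LINT x|lborel. (w \<psi> + k \<psi> x) * \<phi> x)"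
      using Bochner_Integration.integral_add[OF i2 i1] by (simp add: ring_distribs mult.commute)
    finally show ?thesis
      using Bochner_Integration.integrable_add[OF i2 i1] by (simp add: ring_distribs)
  qed
  obtain e :: 'a where e: "e \<in> Basis" using nonempty_Basis by blast
  \<comment> \<open>On \<open>B1\<close> the coordinate along \<open>e\<close> is at least \<open>2\<close>, on \<open>B0\<close> at most \<open>-1\<close>; the step \<open>\<eta>\<close> below lives
    between \<open>0\<close> and \<open>1\<close>, so each piece of a test function has distance at least one from its bump.\<close>
  define B1 where "B1 = cbox (3 *\<^sub>R e - One) (3 *\<^sub>R e + One)"
  define B0 where "B0 = cbox (- 2 *\<^sub>R e - One) (- 2 *\<^sub>R e + One)"
  have ne: "box (v - One) (v + One) \<noteq> {}" for v :: 'a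
    by (simp add: box_ne_empty inner_diff_left inner_add_left)
  obtain \<psi>1 where \<psi>1: "\<psi>1 \<in> schwartz" "supported_in \<psi>1 B1" "integral\<^sup>L lborel \<psi>1 = 1"
    using normalized_bump[OF ne[of "3 *\<^sub>R e"]] unfolding B1_def by blast
  obtain \<psi>0 where \<psi>0: "\<psi>0 \<in> schwartz" "supported_in \<psi>0 B0" "integral\<^sup>L lborel \<psi>0 = 1"
    using normalized_bump[OF ne[of "- 2 *\<^sub>R e"]] unfolding B0_def by blast
  have B1: "2 \<le> y \<bullet> e" if "y \<in> B1" for y
    using that e by (auto simp: B1_def mem_box inner_diff_left inner_add_left dest!: bspec[of _ _ e])
  have B0: "y \<bullet> e \<le> -1" if "y \<in> B0" for y
    using that e by (auto simp: B0_def mem_box inner_diff_left inner_add_left dest!: bspec[of _ _ e])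
  have sep1: "separated {x. x \<bullet> e \<le> 1} B1"
    by (rule separated_halfspaces_inner[OF e])
      (use B1 in \<open>force simp: B1_def inner_commute[of _ e] closed_halfspace_le\<close>)+
  have sep0: "separated {x. 0 \<le> x \<bullet> e} B0"
    by (rule separated_sym, rule separated_halfspaces_inner[OF e])
      (use B0 in \<open>force simp: B0_def inner_commute[of _ e] closed_halfspace_ge\<close>)+
  define \<eta> where "\<eta> = smooth_step e"
  have \<eta>: "\<eta> \<in> moderate" "(\<lambda>x. 1 + (- 1) * \<eta> x) \<in> moderate"
    unfolding \<eta>_def by (intro moderate_add moderate_const moderate_mult moderate_smooth_step)+
  define g where "g = (\<lambda>x. (1 + (- 1) * \<eta> x) * (w \<psi>1 + k \<psi>1 x) + \<eta> x * (w \<psi>0 + k \<psi>0 x))"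
  have [measurable]: "\<eta> \<in> borel_measurable borel"
    using moderate_has_derivative[OF \<eta>(1)] has_derivative_continuous
    by (intro borel_measurable_continuous_onI continuous_at_imp_continuous_on) blast
  note [measurable] = k_meas[OF \<psi>1(1)] k_meas[OF \<psi>0(1)]
  have g_meas[measurable]: "g \<in> borel_measurable borel" unfolding g_def by measurable
  have g_rep: "integrable lborel (\<lambda>x. g x * \<phi> x) \<and> w \<phi> = (LINT x|lborel. g x * \<phi> x)" if \<phi>: "\<phi> \<in> schwartz" for \<phi>
  proof -
    define \<phi>1 \<phi>0 where "\<phi>1 = (\<lambda>x. (1 + (- 1) * \<eta> x) * \<phi> x)" and "\<phi>0 = (\<lambda>x. \<eta> x * \<phi> x)"
    have S: "\<phi>1 \<in> schwartz" "\<phi>0 \<in> schwartz"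
      unfolding \<phi>1_def \<phi>0_def by (intro moderate_mult_schwartz \<eta> \<phi>)+
    have sup: "supported_in \<phi>1 {x. x \<bullet> e \<le> 1}" "supported_in \<phi>0 {x. 0 \<le> x \<bullet> e}"
      by (auto simp: supported_in_def \<phi>1_def \<phi>0_def \<eta>_def smooth_step_eq_0 smooth_step_eq_1)
    note 1 = local_rep[OF sep1 S(1) sup(1) \<psi>1]
    note 0 = local_rep[OF sep0 S(2) sup(2) \<psi>0]
    have g: "g x * \<phi> x = (w \<psi>1 + k \<psi>1 x) * \<phi>1 x + (w \<psi>0 + k \<psi>0 x) * \<phi>0 x" for x
      by (simp add: g_def \<phi>1_def \<phi>0_def algebra_simps)
    have "w \<phi> = w \<phi>1 + w \<phi>0"
      using add[OF S] by (simp add: \<phi>1_def \<phi>0_def algebra_simps)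
    then show ?thesis
      unfolding g using 1 0 by (simp add: Bochner_Integration.integral_add)
  qed
  have g_loc: "set_integrable lborel (cbox a b) g" for a b
    by (rule set_integrable_cbox_if_integrable_mult_schwartz) (use g_rep in auto)
  define H where "H = (\<lambda>z. K z - (g (fst z) - g (snd z)))"
  have [measurable]: "(\<lambda>z :: 'a \<times> 'a. g (fst z)) \<in> borel_measurable borel" "(\<lambda>z :: 'a \<times> 'a. g (snd z)) \<in> borel_measurable borel"
    by (intro measurable_compose[OF _ g_meas] borel_measurable_continuous_onI continuous_intros)+
  have H_meas[measurable]: "H \<in> borel_measurable borel" unfolding H_def by measurable
  have H_loc: "set_integrable lborel (cbox a b) H" for a b :: "'a \<times> 'a"
  proof -
    obtain a1 a2 b1 b2 where ab: "a = (a1, a2)" "b = (b1, b2)" by (metis surj_pair)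
    have one: "integrable lborel (\<lambda>y. indicator (cbox c d) y *\<^sub>R (1::complex))" for c d :: 'a
      by (intro integrable_scaleR_left integrable_real_indicator) (simp, rule emeasure_bounded_finite[OF bounded_cbox])
    have g1: "set_integrable lborel (cbox a b) (\<lambda>z. g (fst z))"
      using integrable_product(1)[OF g_loc[of a1 b1, unfolded set_integrable_def] one[of a2 b2]]
      unfolding set_integrable_def ab
      by (rule Bochner_Integration.integrable_cong[OF refl, THEN iffD1, rotated]) (auto simp: indicator_def)
    have g2: "set_integrable lborel (cbox a b) (\<lambda>z. g (snd z))"
      using integrable_product(1)[OF one[of a1 b1] g_loc[of a2 b2, unfolded set_integrable_def]]
      unfolding set_integrable_def ab
      by (rule Bochner_Integration.integrable_cong[OF refl, THEN iffD1, rotated]) (auto simp: indicator_def)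
    show ?thesis unfolding H_def by (intro set_integral_diff Kloc g1 g2)
  qed
  have H_loc': "set_integrable lebesgue (cbox a b) H" for a b
    using H_loc[of a b] unfolding set_integrable_def by (subst integrable_completion) auto
  have H_cube: "(LINT z:cbox (a1, a2) (b1, b2)|lebesgue. H z) = 0"
    if sep: "separated (cbox a1 b1) (cbox a2 b2)" for a1 a2 b1 b2
  proof -
    have "(LINT z|lebesgue. H z * of_real (box_bump m (a1, a2) (b1, b2) z)) = 0" for m
    proof -
      define \<phi> \<psi> where "\<phi> = (\<lambda>x. complex_of_real (box_bump m a1 b1 x))" and "\<psi> = (\<lambda>x. complex_of_real (box_bump m a2 b2 x))"
      have S: "\<phi> \<in> schwartz" "\<psi> \<in> schwartz" unfolding \<phi>_def \<psi>_def by (rule box_bump_schwartz)+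
      have sup: "supported_in \<phi> (cbox a1 b1)" "supported_in \<psi> (cbox a2 b2)"
        by (auto simp: supported_in_def \<phi>_def \<psi>_def box_bump_eq_0)
      note [measurable] = S[THEN schwartz_borel]
      note iK = Kint[OF sep S(1) sup(1) S(2) sup(2)]
      note i1 = integrable_product[OF conjunct1[OF g_rep[OF S(1)]] schwartz_integrable[OF S(2)]]
      note i2 = integrable_product[OF schwartz_integrable[OF S(1)] conjunct1[OF g_rep[OF S(2)]]]
      have pw: "H z * of_real (box_bump m (a1, a2) (b1, b2) z)
        = (case z of (x, y) \<Rightarrow> K (x, y) * (\<phi> x * \<psi> y)) - (case z of (x, y) \<Rightarrow> g x * \<phi> x * \<psi> y)
          + (case z of (x, y) \<Rightarrow> \<phi> x * (g y * \<psi> y))" for z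
        by (cases z) (simp add: H_def \<phi>_def \<psi>_def box_bump_Pair algebra_simps)
      have "(LINT z|lebesgue. H z * of_real (box_bump m (a1, a2) (b1, b2) z))
          = (LINT z|lborel. H z * of_real (box_bump m (a1, a2) (b1, b2) z))"
        unfolding pw
        by (intro integral_completion borel_measurable_add borel_measurable_diff
            borel_measurable_integrable iK i1(1) i2(1))
      also have "\<dots> = (LINT (x, y)|lborel. K (x, y) * (\<phi> x * \<psi> y)) - (LINT (x, y)|lborel. g x * \<phi> x * \<psi> y)
          + (LINT (x, y)|lborel. \<phi> x * (g y * \<psi> y))"
        unfolding pw
        using Bochner_Integration.integral_add[OF Bochner_Integration.integrable_diff[OF iK i1(1)] i2(1)]
          Bochner_Integration.integral_diff[OF iK i1(1)] by (simp only:)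
      also have "\<dots> = 0"
        using Kid[OF sep S(1) sup(1) S(2) sup(2)] g_rep[OF S(1)] g_rep[OF S(2)] i1(2) i2(2)
        by (simp add: algebra_simps)
      finally show ?thesis .
    qed
    then show ?thesis
      using box_bump_integral_tendsto[OF H_loc', of "(a1, a2)" "(b1, b2)"] by (simp add: LIMSEQ_const_iff)
  qed
  have "AE z in lebesgue. z \<in> {z. fst z \<noteq> snd z} \<longrightarrow> H z = 0"
  proof (rule AE_eq_0_if_small_cubes[OF H_loc'])
    fix z :: "'a \<times> 'a" assume z: "z \<in> {z. fst z \<noteq> snd z}"
    then obtain d where d: "0 < d" "\<And>h. 0 < h \<Longrightarrow> h < d \<Longrightarrow>
        separated (cbox (fst z) (fst z + h *\<^sub>R One)) (cbox (snd z) (snd z + h *\<^sub>R One))"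
      using separated_small_cubes[of "fst z" "snd z"] by auto
    have One: "(One :: 'a \<times> 'a) = (One, One)"
      unfolding Basis_prod_def by (subst sum.union_disjoint) (auto simp: sum.reindex inj_on_def sum_prod)
    show "\<exists>d>0. \<forall>h. 0 < h \<and> h < d \<longrightarrow> (LINT y:cbox z (z + h *\<^sub>R One)|lebesgue. H y) = 0"
    proof (intro exI[of _ d] conjI allI impI d)
      fix h assume "0 < h \<and> h < d"
      then show "(LINT y:cbox z (z + h *\<^sub>R One)|lebesgue. H y) = 0"
        using H_cube[OF d(2)[of h]] unfolding One by (cases z) auto
    qed
  qed
  then have "AE z in lborel. fst z \<noteq> snd z \<longrightarrow> K z = g (fst z) - g (snd z)"
    by (simp add: AE_completion_iff H_def)
  then show ?thesis using g_meas g_rep by blast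
qed

section \<open>Lebesgue spaces and Borel versions\<close>

lemma lebesgue_borel_version:
  fixes f :: "'a::euclidean_space \<Rightarrow> complex"
  assumes "f \<in> borel_measurable lebesgue"
  obtains f' where "f' \<in> borel_measurable borel" "AE x in lborel. f x = f' x"
proof -
  have "(\<lambda>x. Re (f x)) \<in> borel_measurable lebesgue" "(\<lambda>x. Im (f x)) \<in> borel_measurable lebesgue"
    using assms by measurable
  from this[THEN completion_ex_borel_measurable_real]
  obtain r i where r: "r \<in> borel_measurable lborel" "AE x in lborel. Re (f x) = r x"
    and i: "i \<in> borel_measurable lborel" "AE x in lborel. Im (f x) = i x"
    by blast
  show ?thesis
  proof (rule that[of "\<lambda>x. Complex (r x) (i x)"])
    show "(\<lambda>x. Complex (r x) (i x)) \<in> borel_measurable borel"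
      using r(1) i(1) by (subst borel_measurable_complex_iff) simp
    show "AE x in lborel. f x = Complex (r x) (i x)"
      using r(2) i(2) by eventually_elim (simp add: complex_eq_iff)
  qed
qed

lemma Lp_norm_nonneg: "0 \<le> Lp_norm p f"
  by (simp add: Lp_norm_def)

lemma Lp_norm_powr: "0 < p \<Longrightarrow> Lp_norm p f powr p = (LINT x|lebesgue. norm (f x) powr p)"
  by (simp add: Lp_norm_def powr_powr)

lemma norm_add_powr_le:
  assumes "0 < p"
  shows "norm (a + b) powr p \<le> 2 powr p * (norm a powr p + norm b powr p)"
proof -
  have "norm (a + b) powr p \<le> (2 * max (norm a) (norm b)) powr p"
    using norm_triangle_ineq[of a b] assms by (intro powr_mono2) auto
  also have "\<dots> = 2 powr p * max (norm a) (norm b) powr p"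
    by (simp add: powr_mult max_def)
  also have "\<dots> \<le> 2 powr p * (norm a powr p + norm b powr p)"
    by (intro mult_left_mono) (auto simp: max_def)
  finally show ?thesis .
qed

lemma Lp_add:
  assumes f: "f \<in> Lp p" and g: "g \<in> Lp p" and p: "1 \<le> p"
  shows "(\<lambda>x. f x + g x) \<in> Lp p" and "Lp_norm p (\<lambda>x. f x + g x) \<le> 4 * (Lp_norm p f + Lp_norm p g)"
proof -
  have [measurable]: "f \<in> borel_measurable lebesgue" "g \<in> borel_measurable lebesgue"
    using f g by (auto simp: Lp_def)
  have int: "integrable lebesgue (\<lambda>x. 2 powr p * (norm (f x) powr p + norm (g x) powr p))"
    using f g by (auto simp: Lp_def)
  have fg: "integrable lebesgue (\<lambda>x. norm (f x + g x) powr p)"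
    by (rule Bochner_Integration.integrable_bound[OF int])
      (use norm_add_powr_le[of p "f _" "g _"] p in \<open>auto intro!: AE_I2\<close>)
  then show "(\<lambda>x. f x + g x) \<in> Lp p" by (simp add: Lp_def)
  let ?A = "Lp_norm p f" and ?B = "Lp_norm p g"
  have AB: "0 \<le> ?A" "0 \<le> ?B" by (rule Lp_norm_nonneg)+
  have "(LINT x|lebesgue. norm (f x + g x) powr p)
      \<le> (LINT x|lebesgue. 2 powr p * (norm (f x) powr p + norm (g x) powr p))"
    using p by (intro integral_mono fg int norm_add_powr_le) auto
  also have "\<dots> = 2 powr p * (?A powr p + ?B powr p)"
    using f g p by (simp add: Lp_norm_powr Lp_def)
  also have "\<dots> \<le> 2 powr p * ((?A + ?B) powr p + (?A + ?B) powr p)"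
    using AB p by (intro mult_left_mono add_mono powr_mono2) auto
  also have "\<dots> = 2 powr p * 2 powr 1 * (?A + ?B) powr p" by simp
  also have "\<dots> \<le> 2 powr p * 2 powr p * (?A + ?B) powr p"
    using p by (intro mult_right_mono mult_left_mono powr_mono) auto
  also have "\<dots> = (4 * (?A + ?B)) powr p"
    using AB by (simp add: powr_mult[symmetric])
  finally have "Lp_norm p (\<lambda>x. f x + g x) \<le> ((4 * (?A + ?B)) powr p) powr (1 / p)"
    unfolding Lp_norm_def[of p "\<lambda>x. f x + g x"] using p by (intro powr_mono2) auto
  also have "\<dots> = 4 * (?A + ?B)" using AB p by (simp add: powr_powr)
  finally show "Lp_norm p (\<lambda>x. f x + g x) \<le> 4 * (?A + ?B)" .
qed

lemma Lp_cong_AE: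
  assumes "f \<in> Lp p" "g \<in> borel_measurable lebesgue" "AE x in lebesgue. f x = g x"
  shows "g \<in> Lp p" and "Lp_norm p f = Lp_norm p g"
proof -
  have [measurable]: "f \<in> borel_measurable lebesgue" "g \<in> borel_measurable lebesgue"
    using assms by (auto simp: Lp_def)
  have ae: "AE x in lebesgue. norm (f x) powr p = norm (g x) powr p"
    using assms(3) by eventually_elim simp
  have "integrable lebesgue (\<lambda>x. norm (f x) powr p) = integrable lebesgue (\<lambda>x. norm (g x) powr p)"
    by (rule integrable_cong_AE) (use ae in auto)
  then show "g \<in> Lp p" using assms by (auto simp: Lp_def)
  show "Lp_norm p f = Lp_norm p g"
    unfolding Lp_norm_def by (subst integral_cong_AE[OF _ _ ae]) auto
qed

lemma const_in_Lp_imp_0: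
  assumes "(\<lambda>_::'a::euclidean_space. c) \<in> Lp p"
  shows "c = 0"
proof (rule ccontr)
  assume "c \<noteq> 0"
  have "integrable lebesgue (\<lambda>_::'a. norm c powr p)" using assms by (simp add: Lp_def)
  then have "integrable lborel (\<lambda>_::'a. norm c powr p)" by (subst (asm) integrable_completion) auto
  then show False using \<open>c \<noteq> 0\<close> by (simp add: integrable_iff_bounded ennreal_mult_top)
qed

lemma norm_le_1_plus_powr:
  assumes "1 \<le> p" shows "norm z \<le> 1 + norm z powr p"
proof (cases "norm z \<le> 1")
  case True
  then show ?thesis by (simp add: add_increasing2)
next
  case False
  then have "norm z powr 1 \<le> norm z powr p" using assms by (intro powr_mono) auto
  then show ?thesis using False by simp
qed

lemma Lp_mult_schwartz_integrable:
  assumes f: "f \<in> Lp p" and p: "1 \<le> p" and \<phi>: "\<phi> \<in> schwartz"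
  shows "integrable lebesgue (\<lambda>x. f x * \<phi> x)"
proof -
  obtain C where C: "C \<ge> 0" "\<And>x. norm (\<phi> x) \<le> C" using schwartz_bounded[OF \<phi>] by blast
  have [measurable]: "f \<in> borel_measurable lebesgue" "\<phi> \<in> borel_measurable lebesgue"
    using f schwartz_integrable_lebesgue[OF \<phi>] by (auto simp: Lp_def)
  have int: "integrable lebesgue (\<lambda>x. norm (\<phi> x) + C * norm (f x) powr p)"
    using f schwartz_integrable_lebesgue[OF \<phi>] by (auto simp: Lp_def)
  show ?thesis
  proof (rule Bochner_Integration.integrable_bound[OF int])
    show "AE x in lebesgue. norm (f x * \<phi> x) \<le> norm (norm (\<phi> x) + C * norm (f x) powr p)"
    proof (intro AE_I2)
      fix x
      have "norm (f x * \<phi> x) \<le> (1 + norm (f x) powr p) * norm (\<phi> x)"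
        unfolding norm_mult using p by (intro mult_right_mono norm_le_1_plus_powr) auto
      also have "\<dots> \<le> norm (\<phi> x) + C * norm (f x) powr p"
        using mult_left_mono[OF C(2)[of x], of "norm (f x) powr p"] by (simp add: algebra_simps)
      finally show "norm (f x * \<phi> x) \<le> norm (norm (\<phi> x) + C * norm (f x) powr p)"
        using C(1) by simp
    qed
  qed simp
qed

lemma Lp_set_integrable_cbox:
  assumes f: "f \<in> Lp p" and p: "1 \<le> p"
  shows "set_integrable lebesgue (cbox a b) f"
proof -
  have [measurable]: "f \<in> borel_measurable lebesgue" using f by (auto simp: Lp_def)
  have i: "integrable lebesgue (indicator (cbox a b) :: 'a \<Rightarrow> real)"
    using lmeasurable_cbox[of a b] by (simp add: fmeasurable_def)
  have int: "integrable lebesgue (\<lambda>x. indicator (cbox a b) x + norm (f x) powr p)"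
    using f i by (auto simp: Lp_def)
  show ?thesis unfolding set_integrable_def
  proof (rule Bochner_Integration.integrable_bound[OF int])
    show "AE x in lebesgue. norm (indicator (cbox a b) x *\<^sub>R f x) \<le> norm (indicator (cbox a b) x + norm (f x) powr p)"
      using norm_le_1_plus_powr[OF p, of "f _"] by (intro AE_I2) (simp add: indicator_def)
  qed (intro borel_measurable_scaleR borel_measurable_indicator; simp)
qed

text \<open>The difference \<open>f1 - f2\<close> equals a constant almost everywhere, and only the zero constant is
  \<open>p\<close>-integrable over the whole space.\<close>

lemma Lp_plus_const_unique:
  fixes f1 f2 :: "'a::euclidean_space \<Rightarrow> complex"
  assumes f: "f1 \<in> Lp p" "f2 \<in> Lp p" and p: "1 \<le> p"
    and eq: "\<And>\<phi>. \<phi> \<in> schwartz \<Longrightarrow> (LINT x|lebesgue. f1 x * \<phi> x) + C1 * integral\<^sup>L lebesgue \<phi>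
      = (LINT x|lebesgue. f2 x * \<phi> x) + C2 * integral\<^sup>L lebesgue \<phi>"
  shows "C1 = C2" and "AE x in lebesgue. f1 x = f2 x"
proof -
  define H where "H = (\<lambda>x. f1 x - f2 x + (C1 - C2))"
  have loc: "set_integrable lebesgue (cbox a b) H" for a b
    unfolding H_def
    by (rule set_integral_add(1)[OF set_integral_diff(1)[OF Lp_set_integrable_cbox[OF f(1) p]
            Lp_set_integrable_cbox[OF f(2) p]] absolutely_integrable_on_const[OF lmeasurable_cbox]])
  have ae: "AE x in lebesgue. H x = 0"
  proof (rule AE_eq_0_if_schwartz_integrals_eq_0[OF loc])
    fix \<phi> :: "'a \<Rightarrow> complex" assume \<phi>: "\<phi> \<in> schwartz"
    note i = Lp_mult_schwartz_integrable[OF f(1) p \<phi>] Lp_mult_schwartz_integrable[OF f(2) p \<phi>]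
      schwartz_integrable_lebesgue[OF \<phi>]
    have "H x * \<phi> x = f1 x * \<phi> x - f2 x * \<phi> x + (C1 - C2) * \<phi> x" for x
      by (simp add: H_def algebra_simps)
    then have "(LINT x|lebesgue. H x * \<phi> x) = (LINT x|lebesgue. f1 x * \<phi> x - f2 x * \<phi> x + (C1 - C2) * \<phi> x)"
      by (simp only:)
    also have "\<dots> = (LINT x|lebesgue. f1 x * \<phi> x) - (LINT x|lebesgue. f2 x * \<phi> x) + (C1 - C2) * integral\<^sup>L lebesgue \<phi>"
      using i by simp
    also have "\<dots> = 0" using eq[OF \<phi>] by (simp add: algebra_simps)
    finally show "(LINT x|lebesgue. H x * \<phi> x) = 0" .
  qed
  have "(\<lambda>x. - 1 * f1 x) \<in> Lp p" using f(1) by (simp add: Lp_def)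
  from Lp_add(1)[OF f(2) this p] have "(\<lambda>x. f2 x - f1 x) \<in> Lp p" by simp
  moreover have "AE x in lebesgue. f2 x - f1 x = C1 - C2"
    using ae
  proof eventually_elim
    case (elim x)
    then have "C1 - C2 = f2 x - f1 x" by (simp only: H_def add_eq_0_iff minus_diff_eq)
    then show ?case by (rule sym)
  qed
  ultimately have "(\<lambda>_::'a. C1 - C2) \<in> Lp p"
    by (rule Lp_cong_AE(1)[OF _ borel_measurable_const])
  then have "C1 - C2 = 0" by (rule const_in_Lp_imp_0)
  then show "C1 = C2" by simp
  show "AE x in lebesgue. f1 x = f2 x"
    using ae by eventually_elim (use \<open>C1 = C2\<close> in \<open>simp add: H_def\<close>)
qed

text \<open>Antisymmetrizing a Borel version changes it only on a null set, since exchanging the variables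
  preserves Lebesgue measure.\<close>

lemma antisymmetric_borel_version:
  fixes F :: "'a::euclidean_space \<times> 'a \<Rightarrow> complex"
  assumes F: "F \<in> borel_measurable lebesgue" and anti: "\<And>x y. F (x, y) = - F (y, x)"
  obtains F' where "F' \<in> borel_measurable borel" "AE z in lborel. F z = F' z" "\<And>x y. F' (x, y) = - F' (y, x)"
proof -
  obtain F0 where F0[measurable]: "F0 \<in> borel_measurable borel" and ae: "AE z in lborel. F z = F0 z"
    using lebesgue_borel_version[OF F] by blast
  have swap[measurable]: "prod.swap \<in> measurable (borel :: ('a \<times> 'a) measure) borel"
    by (intro borel_measurable_continuous_onI continuous_on_swap)
  have distr: "distr lborel lborel prod.swap = (lborel :: ('a \<times> 'a) measure)"
    using lborel_pair.distr_pair_swap[where ?'a = 'a and ?'b = 'a, symmetric]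
    by (simp add: lborel_prod prod.swap_def[abs_def] case_prod_beta')
  have "AE z in lborel. F (prod.swap z) = F0 (prod.swap z)"
  proof -
    obtain N where N: "N \<in> null_sets lborel" "{z \<in> space lborel. F z \<noteq> F0 z} \<subseteq> N"
      using ae by (auto simp: eventually_ae_filter)
    have "emeasure lborel (prod.swap -` N) = emeasure (distr lborel lborel prod.swap) N"
      using N swap by (subst emeasure_distr) auto
    also have "\<dots> = 0" unfolding distr using N by auto
    finally have "prod.swap -` N \<in> null_sets lborel"
      using measurable_sets[OF swap, of N] N by (auto simp: null_sets_def)
    then show ?thesis by (rule AE_I') (use N in auto)
  qed
  with ae have "AE z in lborel. F z = (F0 z - F0 (prod.swap z)) / 2"
  proof eventually_elim
    case (elim z)
    then show ?case using anti[of "fst z" "snd z"] by (cases z) simp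
  qed
  moreover have "(\<lambda>z. (F0 z - F0 (prod.swap z)) / 2) \<in> borel_measurable borel" by measurable
  moreover have "(F0 (x, y) - F0 (prod.swap (x, y))) / 2 = - ((F0 (y, x) - F0 (prod.swap (y, x))) / 2)" for x y
    by (simp add: minus_divide_left)
  ultimately show ?thesis by (intro that[of "\<lambda>z. (F0 z - F0 (prod.swap z)) / 2"])
qed

section \<open>Off-diagonal test functions and the estimate\<close>

definition od_test ::
  "real \<Rightarrow> (real^'n \<Rightarrow> complex) \<Rightarrow> (real^'n \<Rightarrow> complex) \<Rightarrow> (real^'n) \<times> (real^'n) \<Rightarrow> complex" where
  "od_test s \<phi> \<psi> z = dist_kernel (real CARD('n) + s) \<phi> \<psi> z - dist_kernel (real CARD('n) + s) \<psi> \<phi> z"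

lemma separated_disjoint: "separated A B \<Longrightarrow> x \<in> A \<Longrightarrow> x \<notin> B"
  unfolding separated_def by force

lemma od_test_schwartz_od:
  fixes \<phi> \<psi> :: "real^'n \<Rightarrow> complex"
  assumes AB: "separated A B" and \<phi>: "\<phi> \<in> schwartz" "supported_in \<phi> A" and \<psi>: "\<psi> \<in> schwartz" "supported_in \<psi> B"
  shows "od_test s \<phi> \<psi> \<in> schwartz_od"
proof -
  have S: "od_test s \<phi> \<psi> \<in> schwartz"
    using schwartz_diff[OF dist_kernel_schwartz[OF AB \<phi> \<psi>] dist_kernel_schwartz[OF separated_sym[OF AB] \<psi> \<phi>]]
    unfolding od_test_def[abs_def] .
  have anti: "od_test s \<phi> \<psi> (x, y) = - od_test s \<phi> \<psi> (y, x)" for x y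
    unfolding od_test_def dist_kernel_def fst_conv snd_conv norm_minus_commute[of y x] mult.commute[of "\<phi> y"]
      mult.commute[of "\<phi> x"] minus_diff_eq ..
  have cl: "closed (A \<times> B \<union> B \<times> A)" using AB by (auto simp: separated_def intro: closed_Times)
  have "partials bs (od_test s \<phi> \<psi>) (z, z) = 0" for bs z
  proof (rule partials_eq_0_off_closed[OF cl])
    show "od_test s \<phi> \<psi> p = 0" if "p \<notin> A \<times> B \<union> B \<times> A" for p
      using that \<phi>(2) \<psi>(2) by (cases p) (auto simp: od_test_def dist_kernel_def supported_in_def)
    show "(z, z) \<notin> A \<times> B \<union> B \<times> A" using separated_disjoint[OF AB] by auto
  qed
  with S anti show ?thesis unfolding schwartz_od_def by blast
qed

text \<open>The weight \<open>|x - y|\<^sup>-\<^sup>n\<^sup>-\<^sup>s\<close> of the divergence cancels the power of the distance in the test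
  function.  On the diagonal both sides vanish because the supports are disjoint.\<close>

lemma frac_div_od_test:
  fixes \<phi> \<psi> :: "real^'n \<Rightarrow> complex"
  assumes AB: "separated A B" and \<phi>: "\<phi> \<in> schwartz" "supported_in \<phi> A" and \<psi>: "\<psi> \<in> schwartz" "supported_in \<psi> B"
  shows "frac_div s (od_test s \<phi> \<psi>) =
    (\<lambda>x. 2 * integral\<^sup>L lborel \<psi> * \<phi> x + - (2 * integral\<^sup>L lborel \<phi>) * \<psi> x)"
proof
  fix x
  have pw: "2 * od_test s \<phi> \<psi> (x, y) / of_real (norm (x - y) powr s) / of_real (norm (x - y) ^ CARD('n))
      = 2 * \<phi> x * \<psi> y - 2 * \<psi> x * \<phi> y" for y
  proof (cases "x = y")
    case True
    then show ?thesis using separated_disjoint[OF AB, of y] \<phi>(2) \<psi>(2)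
      by (auto simp: supported_in_def od_test_def dist_kernel_def)
  next
    case False
    define d where "d = complex_of_real (norm (x - y) powr s) * of_real (norm (x - y) ^ CARD('n))"
    have d: "d \<noteq> 0" using False by (simp add: d_def)
    have "norm (x - y) powr (real CARD('n) + s) = norm (x - y) powr s * norm (x - y) ^ CARD('n)"
      using False by (simp add: powr_add powr_realpow)
    then have E: "complex_of_real (norm (x - y) powr (real CARD('n) + s)) = d"
      by (simp only: d_def of_real_mult)
    have "2 * od_test s \<phi> \<psi> (x, y) = d * (2 * \<phi> x * \<psi> y - 2 * \<psi> x * \<phi> y)"
      unfolding od_test_def dist_kernel_def fst_conv snd_conv E by (simp only: algebra_simps)
    then show ?thesis using d unfolding divide_divide_eq_left d_def[symmetric] by simp
  qed
  have "frac_div s (od_test s \<phi> \<psi>) x = (LINT y|lebesgue. 2 * \<phi> x * \<psi> y - 2 * \<psi> x * \<phi> y)"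
    unfolding frac_div_def pw ..
  also have "\<dots> = 2 * \<phi> x * integral\<^sup>L lebesgue \<psi> - 2 * \<psi> x * integral\<^sup>L lebesgue \<phi>"
    using schwartz_integrable_lebesgue[OF \<phi>(1)] schwartz_integrable_lebesgue[OF \<psi>(1)] by simp
  finally show "frac_div s (od_test s \<phi> \<psi>) x =
      2 * integral\<^sup>L lborel \<psi> * \<phi> x + - (2 * integral\<^sup>L lborel \<phi>) * \<psi> x"
    by (simp add: schwartz_integral_lebesgue \<phi>(1) \<psi>(1) mult_ac)
qed

lemma integrable_L1_od_mult:
  fixes F :: "(real^'n) \<times> (real^'n) \<Rightarrow> complex"
  assumes [measurable]: "F \<in> borel_measurable borel" "h \<in> borel_measurable borel"
    and F: "integrable lborel (\<lambda>z. norm (F z) / norm (fst z - snd z) ^ CARD('n))"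
    and C: "\<And>z. norm (fst z - snd z) powr (real CARD('n) + s) * norm (h z) \<le> C"
  shows "integrable lborel (\<lambda>z. F z * of_real (norm (fst z - snd z) powr s) * h z)"
proof (rule Bochner_Integration.integrable_bound)
  show "integrable lborel (\<lambda>z. C * (norm (F z) / norm (fst z - snd z) ^ CARD('n)))"
    using F by (intro integrable_mult_right)
  have [measurable]: "(\<lambda>z::(real^'n) \<times> (real^'n). norm (fst z - snd z)) \<in> borel_measurable borel"
    by (intro borel_measurable_continuous_onI continuous_intros)
  show "(\<lambda>z. F z * of_real (norm (fst z - snd z) powr s) * h z) \<in> borel_measurable lborel"
    by measurable
  show "AE z in lborel. norm (F z * of_real (norm (fst z - snd z) powr s) * h z)
      \<le> norm (C * (norm (F z) / norm (fst z - snd z) ^ CARD('n)))"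
  proof (intro AE_I2)
    fix z :: "(real^'n) \<times> (real^'n)"
    define d where "d = norm (fst z - snd z)"
    have C0: "0 \<le> C" using order_trans[OF _ C[of z]] by simp
    show "norm (F z * of_real (norm (fst z - snd z) powr s) * h z)
      \<le> norm (C * (norm (F z) / norm (fst z - snd z) ^ CARD('n)))"
    proof (cases "d = 0")
      case False
      then have "d > 0" by (simp add: d_def)
      then have "norm (F z * of_real (d powr s) * h z) = norm (F z) / d ^ CARD('n) * (d powr (real CARD('n) + s) * norm (h z))"
        by (simp add: norm_mult powr_add powr_realpow)
      also have "\<dots> \<le> norm (F z) / d ^ CARD('n) * C"
        using C[of z] \<open>d > 0\<close> by (intro mult_left_mono) (auto simp: d_def)
      finally show ?thesis using C0 \<open>d > 0\<close> by (simp add: d_def[symmetric] mult.commute abs_mult)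
    qed (simp add: d_def)
  qed
qed

text \<open>With \<open>w = u - v\<close> and \<open>K = F |x - y|\<^sup>s\<close>, testing the decomposition with the functions \<open>od_test\<close>
  gives the hypothesis of \<open>separated_kernel_representation\<close>: by the antisymmetry of \<open>F\<close> both halves of the
  test function contribute the same integral.  The resulting function \<open>g\<close> has Gagliardo seminorm
  equal to the norm of \<open>F\<close>.\<close>

lemma frac_grad_in_L1_plus_W_representation:
  fixes u :: "(real^'n \<Rightarrow> complex) \<Rightarrow> complex" and s p :: real
  assumes s: "0 < s" "s < 1" and p: "p = real CARD('n) / (real CARD('n) - s)"
    and uadd: "\<And>f g. f \<in> schwartz \<Longrightarrow> g \<in> schwartz \<Longrightarrow> u (\<lambda>x. f x + g x) = u f + u g"
    and umult: "\<And>f c. f \<in> schwartz \<Longrightarrow> u (\<lambda>x. c * f x) = c * u f"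
    and F: "F \<in> L1_od" and v: "v \<in> Lp p"
    and dec: "\<And>G. G \<in> schwartz_od \<Longrightarrow>
      frac_grad s u G = distr_of_L1_od F G + frac_grad s (distr_of_fun v) G"
  shows "\<exists>C. \<exists>f\<in>Lp p. Lp_norm p f \<le> p powr (1 / p) / iso_const s CARD('n) * L1_od_norm F \<and>
    (\<forall>\<phi>\<in>schwartz. u \<phi> = C * integral\<^sup>L lebesgue \<phi>
       + (LINT x|lebesgue. f x * \<phi> x) + (LINT x|lebesgue. v x * \<phi> x))"
proof -
  let ?n = "real CARD('n)"
  have n1: "1 \<le> ?n" by (simp add: Suc_leI)
  have ns: "s < ?n" using s n1 by linarith
  have p1: "1 \<le> p" using s ns unfolding p by (subst pos_le_divide_eq) auto
  have Fm: "F \<in> borel_measurable lebesgue" and Fanti: "\<And>x y. F (x, y) = - F (y, x)"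
    and Fint: "integrable lebesgue (\<lambda>(x, y). norm (F (x, y)) / norm (x - y) ^ CARD('n))"
    using F unfolding L1_od_def by blast+
  obtain F' where F'[measurable]: "F' \<in> borel_measurable borel" and ae: "AE z in lborel. F z = F' z"
    and anti: "\<And>x y. F' (x, y) = - F' (y, x)"
    using antisymmetric_borel_version[OF Fm Fanti] by blast
  have ael: "AE z in lebesgue. F z = F' z" using ae by (simp add: AE_completion_iff)
  have d[measurable]: "(\<lambda>z::(real^'n) \<times> (real^'n). norm (fst z - snd z)) \<in> borel_measurable borel"
    by (intro borel_measurable_continuous_onI continuous_intros)
  define N where "N = (\<lambda>z. norm (F' z) / norm (fst z - snd z) ^ CARD('n))"
  have N[measurable]: "N \<in> borel_measurable borel" unfolding N_def by measurable
  have N0: "0 \<le> N z" for z by (simp add: N_def)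
  have N_ae: "AE z in lebesgue. (case z of (x, y) \<Rightarrow> norm (F (x, y)) / norm (x - y) ^ CARD('n)) = N z"
    using ael by eventually_elim (simp add: N_def case_prod_beta)
  have NL: "integrable lebesgue N"
    by (rule integrable_cong_AE_imp[OF Fint _ N_ae]) (rule measurable_completion, simp)
  then have Nint: "integrable lborel N" by (subst (asm) integrable_completion) auto
  have Nnorm: "L1_od_norm F = integral\<^sup>L lborel N"
  proof -
    have "L1_od_norm F = integral\<^sup>L lebesgue N"
      unfolding L1_od_norm_def using Fint NL N_ae by (intro integral_cong_AE) auto
    then show ?thesis by (simp add: integral_completion)
  qed
  define K where "K = (\<lambda>z. F' z * of_real (norm (fst z - snd z) powr s))"
  have K[measurable]: "K \<in> borel_measurable borel" unfolding K_def by measurable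
  have Kanti: "K (y, x) = - K (x, y)" for x y
    using anti[of y x] by (simp add: K_def norm_minus_commute)
  define w where "w = (\<lambda>\<phi>. u \<phi> - (LINT x|lebesgue. v x * \<phi> x))"
  note vint = Lp_mult_schwartz_integrable[OF v p1]
  have Kloc: "set_integrable lborel (cbox a b) K" for a b
  proof -
    obtain R where R: "R > 0" "\<And>z. z \<in> cbox a b \<Longrightarrow> norm z \<le> R"
      using bounded_cbox[of a b] bounded_pos by metis
    have "integrable lborel (\<lambda>z. F' z * of_real (norm (fst z - snd z) powr s) * indicator (cbox a b) z)"
    proof (rule integrable_L1_od_mult[where C = "(2 * R) powr (?n + s)"])
      show "norm (fst z - snd z) powr (?n + s) * norm (indicator (cbox a b) z :: complex) \<le> (2 * R) powr (?n + s)" for z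
      proof (cases "z \<in> cbox a b")
        case True
        have "norm (fst z - snd z) \<le> norm (fst z) + norm (snd z)" by (rule norm_triangle_ineq4)
        also have "\<dots> \<le> 2 * R" using R(2)[OF True] norm_fst_le[of "fst z" "snd z"] norm_snd_le[of "snd z" "fst z"] by simp
        finally show ?thesis using True n1 s by (auto intro!: powr_mono2)
      qed simp
    qed (use Nint in \<open>auto simp: N_def\<close>)
    then show ?thesis unfolding set_integrable_def K_def
      by (rule Bochner_Integration.integrable_cong[OF refl, THEN iffD1, rotated]) (auto simp: indicator_def)
  qed
  have Kint: "integrable lborel (\<lambda>(x, y). K (x, y) * (\<phi> x * \<psi> y))"
    if AB: "separated A B" and \<phi>: "\<phi> \<in> schwartz" "supported_in \<phi> A" and \<psi>: "\<psi> \<in> schwartz" "supported_in \<psi> B"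
    for A B \<phi> \<psi>
  proof -
    obtain C where C: "\<And>z. norm (dist_kernel (?n + s) \<phi> \<psi> z) \<le> C"
      using schwartz_bounded[OF dist_kernel_schwartz[OF AB \<phi> \<psi>]] by blast
    have [measurable]: "(\<lambda>z. \<phi> (fst z) * \<psi> (snd z)) \<in> borel_measurable borel"
      by (intro borel_measurable_times measurable_compose[OF _ schwartz_borel[OF \<phi>(1)]] 
          measurable_compose[OF _ schwartz_borel[OF \<psi>(1)]] borel_measurable_continuous_onI continuous_intros)
    have "integrable lborel (\<lambda>z. F' z * of_real (norm (fst z - snd z) powr s) * (\<phi> (fst z) * \<psi> (snd z)))"
    proof (rule integrable_L1_od_mult)
      show "norm (fst z - snd z) powr (?n + s) * norm (\<phi> (fst z) * \<psi> (snd z)) \<le> C" for z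
        using C[of z] by (simp add: dist_kernel_def norm_mult)
    qed (use Nint in \<open>auto simp: N_def\<close>)
    then show ?thesis by (simp add: K_def case_prod_beta')
  qed
  have Kid: "integral\<^sup>L lborel \<psi> * w \<phi> - integral\<^sup>L lborel \<phi> * w \<psi> = (LINT (x, y)|lborel. K (x, y) * (\<phi> x * \<psi> y))"
    if AB: "separated A B" and \<phi>: "\<phi> \<in> schwartz" "supported_in \<phi> A" and \<psi>: "\<psi> \<in> schwartz" "supported_in \<psi> B"
    for A B \<phi> \<psi>
  proof -
    let ?G = "od_test s \<phi> \<psi>"
    let ?I = "LINT (x, y)|lborel. K (x, y) * (\<phi> x * \<psi> y)"
    note G = od_test_schwartz_od[OF AB \<phi> \<psi>, of s]
    have GS: "?G \<in> schwartz" using G unfolding schwartz_od_def by blast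
    note i1 = Kint[OF AB \<phi> \<psi>] and i2 = Kint[OF separated_sym[OF AB] \<psi> \<phi>]
    note div = frac_div_od_test[OF AB \<phi> \<psi>, of s]
    have divS: "(\<lambda>x. 2 * integral\<^sup>L lborel \<psi> * \<phi> x + - (2 * integral\<^sup>L lborel \<phi>) * \<psi> x) \<in> schwartz"
      by (intro schwartz_add schwartz_cmult \<phi> \<psi>)
    have U: "frac_grad s u ?G = 2 * integral\<^sup>L lborel \<psi> * u \<phi> - 2 * integral\<^sup>L lborel \<phi> * u \<psi>"
    proof -
      have "frac_grad s u ?G = u (\<lambda>x. 2 * integral\<^sup>L lborel \<psi> * \<phi> x + - (2 * integral\<^sup>L lborel \<phi>) * \<psi> x)"
        using G by (simp only: frac_grad_def restrict_apply' div)
      also have "\<dots> = 2 * integral\<^sup>L lborel \<psi> * u \<phi> + - (2 * integral\<^sup>L lborel \<phi>) * u \<psi>"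
        by (simp only: uadd[OF schwartz_cmult[OF \<phi>(1)] schwartz_cmult[OF \<psi>(1)]] umult[OF \<phi>(1)] umult[OF \<psi>(1)])
      finally show ?thesis by simp
    qed
    have V: "frac_grad s (distr_of_fun v) ?G
        = 2 * integral\<^sup>L lborel \<psi> * (LINT x|lebesgue. v x * \<phi> x) - 2 * integral\<^sup>L lborel \<phi> * (LINT x|lebesgue. v x * \<psi> x)"
    proof -
      have "frac_grad s (distr_of_fun v) ?G
        = (LINT x|lebesgue. v x * (2 * integral\<^sup>L lborel \<psi> * \<phi> x + - (2 * integral\<^sup>L lborel \<phi>) * \<psi> x))"
        using G divS by (simp add: frac_grad_def div distr_of_fun_def)
      also have "\<dots> = (LINT x|lebesgue. 2 * integral\<^sup>L lborel \<psi> * (v x * \<phi> x) - 2 * integral\<^sup>L lborel \<phi> * (v x * \<psi> x))"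
        by (intro Bochner_Integration.integral_cong) (auto simp: algebra_simps)
      also have "\<dots> = 2 * integral\<^sup>L lborel \<psi> * (LINT x|lebesgue. v x * \<phi> x) - 2 * integral\<^sup>L lborel \<phi> * (LINT x|lebesgue. v x * \<psi> x)"
        using vint[OF \<phi>(1)] vint[OF \<psi>(1)] by simp
      finally show ?thesis .
    qed
    have Kswap: "K (y, x) * (\<psi> y * \<phi> x) = - (K (x, y) * (\<phi> x * \<psi> y))" for x y
      using Kanti[of y x] by (simp add: mult_ac)
    \<comment> \<open>Exchanging the variables, with the antisymmetry of \<open>K\<close>.\<close>
    have swap: "(LINT (x, y)|lborel. K (x, y) * (\<psi> x * \<phi> y)) = - ?I"
    proof -
      have "(LINT (x, y)|lborel. K (x, y) * (\<psi> x * \<phi> y)) = (LINT (x, y)|lborel. K (y, x) * (\<psi> y * \<phi> x))"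
        using lborel_pair.integral_product_swap[of "\<lambda>(x, y). K (x, y) * (\<psi> x * \<phi> y)"] borel_measurable_integrable[OF i2]
        by (simp add: lborel_prod)
      also have "\<dots> = (LINT z|lborel. - (case z of (x, y) \<Rightarrow> K (x, y) * (\<phi> x * \<psi> y)))"
        by (intro Bochner_Integration.integral_cong) (auto simp: Kswap)
      finally show ?thesis by simp
    qed
    have pw: "F' (x, y) * ?G (x, y) / of_real (norm (x - y) ^ CARD('n)) = K (x, y) * (\<phi> x * \<psi> y) - K (x, y) * (\<psi> x * \<phi> y)" for x y
    proof (cases "x = y")
      case False
      then have "complex_of_real (norm (x - y) powr (?n + s)) = of_real (norm (x - y) ^ CARD('n)) * of_real (norm (x - y) powr s)"
        by (simp add: powr_add powr_realpow)
      then show ?thesis using False by (simp add: od_test_def dist_kernel_def K_def field_simps)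
    qed (simp add: K_def)
    have meas: "(\<lambda>z. (case z of (x, y) \<Rightarrow> K (x, y) * (\<phi> x * \<psi> y)) - (case z of (x, y) \<Rightarrow> K (x, y) * (\<psi> x * \<phi> y))) \<in> borel_measurable lborel"
      by (intro borel_measurable_diff borel_measurable_integrable i1 i2)
    have "distr_of_L1_od F ?G
        = (LINT z|lebesgue. (case z of (x, y) \<Rightarrow> K (x, y) * (\<phi> x * \<psi> y)) - (case z of (x, y) \<Rightarrow> K (x, y) * (\<psi> x * \<phi> y)))"
      unfolding distr_of_L1_od_def restrict_apply'[OF G]
    proof (rule integral_cong_AE)
      show "(\<lambda>z. (case z of (x, y) \<Rightarrow> K (x, y) * (\<phi> x * \<psi> y)) - (case z of (x, y) \<Rightarrow> K (x, y) * (\<psi> x * \<phi> y))) \<in> borel_measurable lebesgue"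
        by (rule measurable_completion[OF meas])
      have G': "?G \<in> borel_measurable lebesgue"
        using schwartz_borel[OF GS] by (intro measurable_completion) simp
      have "(\<lambda>z::(real^'n) \<times> (real^'n). complex_of_real (norm (fst z - snd z) ^ CARD('n))) \<in> borel_measurable lborel"
        by measurable
      then have D: "(\<lambda>z::(real^'n) \<times> (real^'n). complex_of_real (norm (fst z - snd z) ^ CARD('n))) \<in> borel_measurable lebesgue"
        by (rule measurable_completion)
      have "(\<lambda>z. F z * ?G z / of_real (norm (fst z - snd z) ^ CARD('n))) \<in> borel_measurable lebesgue"
        by (intro borel_measurable_divide borel_measurable_times Fm G' D)
      then show "(\<lambda>(x, y). F (x, y) * ?G (x, y) / of_real (norm (x - y) ^ CARD('n))) \<in> borel_measurable lebesgue"
        by (simp add: case_prod_beta')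
      show "AE z in lebesgue. (case z of (x, y) \<Rightarrow> F (x, y) * ?G (x, y) / of_real (norm (x - y) ^ CARD('n)))
         = (case z of (x, y) \<Rightarrow> K (x, y) * (\<phi> x * \<psi> y)) - (case z of (x, y) \<Rightarrow> K (x, y) * (\<psi> x * \<phi> y))"
        using ael
      proof eventually_elim
        case (elim z)
        then show ?case using pw by (cases z) simp
      qed
    qed
    also have "\<dots> = ?I - (LINT (x, y)|lborel. K (x, y) * (\<psi> x * \<phi> y))"
      unfolding integral_completion[OF meas] by (rule Bochner_Integration.integral_diff[OF i1 i2])
    finally have "distr_of_L1_od F ?G = 2 * ?I" by (simp add: swap)
    then have "2 * (integral\<^sup>L lborel \<psi> * w \<phi> - integral\<^sup>L lborel \<phi> * w \<psi>) = 2 * ?I"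
      using dec[OF G] U V by (simp add: w_def algebra_simps)
    then show ?thesis by (rule mult_left_cancel[THEN iffD1, rotated]) simp
  qed
  have wadd: "w (\<lambda>x. f x + g x) = w f + w g" if fg: "f \<in> schwartz" "g \<in> schwartz" for f g
    using uadd[OF fg] vint[OF fg(1)] vint[OF fg(2)] by (simp add: w_def ring_distribs)
  have "\<exists>g \<in> borel_measurable borel.
    (\<forall>\<phi>\<in>schwartz. integrable lborel (\<lambda>x. g x * \<phi> x) \<and> w \<phi> = (LINT x|lborel. g x * \<phi> x)) \<and>
    (AE z in lborel. fst z \<noteq> snd z \<longrightarrow> K z = g (fst z) - g (snd z))"
    by (rule separated_kernel_representation) (fact K Kloc wadd Kint Kid)+
  then obtain g where g[measurable]: "g \<in> borel_measurable borel"
    and g_S: "\<forall>\<phi>\<in>schwartz. integrable lborel (\<lambda>x. g x * \<phi> x) \<and> w \<phi> = (LINT x|lborel. g x * \<phi> x)"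
    and g_K: "AE z in lborel. fst z \<noteq> snd z \<longrightarrow> K z = g (fst z) - g (snd z)"
    by (elim bexE conjE)
  have g_int: "integrable lborel (\<lambda>x. g x * \<phi> x)" and g_rep: "w \<phi> = (LINT x|lborel. g x * \<phi> x)"
    if "\<phi> \<in> schwartz" for \<phi>
    using g_S that by auto
  have gag: "gagliardo s g = ennreal (L1_od_norm F)"
  proof -
    have [measurable]: "(\<lambda>z::(real^'n) \<times> (real^'n). g (fst z)) \<in> borel_measurable borel"
      "(\<lambda>z::(real^'n) \<times> (real^'n). g (snd z)) \<in> borel_measurable borel"
      by (intro measurable_compose[OF _ g] borel_measurable_continuous_onI continuous_intros)+
    have "gagliardo s g = (\<integral>\<^sup>+z. ennreal (norm (g (fst z) - g (snd z)) / norm (fst z - snd z) powr (?n + s)) \<partial>(lborel \<Otimes>\<^sub>M lborel))"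
      unfolding gagliardo_def DIM_cart DIM_real mult_1_right
      by (subst lborel.nn_integral_fst[symmetric]) (auto simp: lborel_prod)
    also have "\<dots> = (\<integral>\<^sup>+z. ennreal (N z) \<partial>lborel)"
      unfolding lborel_prod
    proof (rule nn_integral_cong_AE)
      show "AE z in lborel. ennreal (norm (g (fst z) - g (snd z)) / norm (fst z - snd z) powr (?n + s)) = ennreal (N z)"
        using g_K
      proof eventually_elim
        case (elim z)
        show ?case
        proof (cases "fst z = snd z")
          case False
          then have "norm (g (fst z) - g (snd z)) = norm (F' z) * norm (fst z - snd z) powr s"
            using elim by (simp add: K_def norm_mult flip: elim)
          then show ?thesis using False by (simp add: N_def powr_add powr_realpow)
        qed (simp add: N_def)
      qed
    qed
    also have "\<dots> = ennreal (L1_od_norm F)"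
      unfolding Nnorm by (rule nn_integral_eq_integral[OF Nint]) (simp add: N0)
    finally show ?thesis .
  qed
  have F0: "0 \<le> L1_od_norm F" unfolding Nnorm by (intro integral_nonneg_AE) (simp add: N0)
  have g_ball: "set_integrable lborel (ball x r) g" for x r
  proof -
    obtain a b where "ball x r \<subseteq> cbox a b" using bounded_subset_cbox_symmetric[OF bounded_ball] by metis
    then show ?thesis
      using set_integrable_cbox_if_integrable_mult_schwartz[OF g g_int, of a b]
      by (rule set_integrable_subset[rotated 2]) auto
  qed
  have sn: "s < real DIM(real^'n)" using ns by simp
  have pn: "p = real DIM(real^'n) / (real DIM(real^'n) - s)" by (simp add: p)
  obtain C where C: "(\<integral>\<^sup>+x. ennreal (norm (g x - C) powr p) \<partial>lborel)
      \<le> ennreal (p * (L1_od_norm F / iso_const s CARD('n)) powr p)"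
    using frac_sobolev[OF g g_ball s(1) sn pn eq_refl[OF gag] F0] by auto
  define f where "f = (\<lambda>x. g x - C)"
  have [measurable]: "f \<in> borel_measurable borel" unfolding f_def by measurable
  have f_int: "integrable lborel (\<lambda>x. norm (f x) powr p)"
    using C by (simp add: integrable_iff_bounded f_def le_less_trans)
  have fLp: "f \<in> Lp p"
    using f_int by (auto simp: Lp_def integrable_completion intro: measurable_completion)
  show ?thesis
  proof (intro exI[of _ C] bexI[of _ f] conjI ballI fLp)
    let ?D = "L1_od_norm F / iso_const s CARD('n)"
    have D0: "0 \<le> ?D" using F0 iso_const_pos[of s "CARD('n)"] by simp
    have root: "(p * d powr p) powr (1 / p) = p powr (1 / p) * d" if "0 \<le> d" for d
      using that p1 by (simp add: powr_mult powr_powr)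
    have "(LINT x|lebesgue. norm (f x) powr p) \<le> p * ?D powr p"
    proof -
      have "ennreal (LINT x|lborel. norm (f x) powr p) \<le> ennreal (p * ?D powr p)"
        using C f_int by (subst nn_integral_eq_integral[symmetric]) (auto simp: f_def)
      then show ?thesis using p1 by (simp add: integral_completion)
    qed
    then have "Lp_norm p f \<le> (p * ?D powr p) powr (1 / p)"
      unfolding Lp_norm_def using p1 by (intro powr_mono2) auto
    also have "\<dots> = p powr (1 / p) * ?D" by (rule root[OF D0])
    finally show "Lp_norm p f \<le> p powr (1 / p) / iso_const s CARD('n) * L1_od_norm F" by simp
    fix \<phi> :: "real^'n \<Rightarrow> complex" assume \<phi>: "\<phi> \<in> schwartz"
    have "(LINT x|lborel. g x * \<phi> x) = (LINT x|lebesgue. g x * \<phi> x)"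
      using borel_measurable_integrable[OF g_int[OF \<phi>]] by (simp add: integral_completion)
    also have "\<dots> = (LINT x|lebesgue. C * \<phi> x + f x * \<phi> x)"
      by (intro Bochner_Integration.integral_cong) (auto simp: f_def algebra_simps)
    also have "\<dots> = C * integral\<^sup>L lebesgue \<phi> + (LINT x|lebesgue. f x * \<phi> x)"
      using schwartz_integrable_lebesgue[OF \<phi>] Lp_mult_schwartz_integrable[OF fLp p1 \<phi>] by simp
    finally show "u \<phi> = C * integral\<^sup>L lebesgue \<phi>
       + (LINT x|lebesgue. f x * \<phi> x) + (LINT x|lebesgue. v x * \<phi> x)"
      using g_rep[OF \<phi>] by (simp add: w_def diff_eq_eq)
  qed
qed

lemma distr_of_fun_Lp_linear:
  assumes f: "f \<in> Lp p" and p: "1 \<le> p" and "\<phi> \<in> schwartz"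
  shows "\<psi> \<in> schwartz \<Longrightarrow> distr_of_fun f (\<lambda>x. \<phi> x + \<psi> x) = distr_of_fun f \<phi> + distr_of_fun f \<psi>"
    and "distr_of_fun f (\<lambda>x. c * \<phi> x) = c * distr_of_fun f \<phi>"
proof -
  note i = Lp_mult_schwartz_integrable[OF f p]
  show "distr_of_fun f (\<lambda>x. \<phi> x + \<psi> x) = distr_of_fun f \<phi> + distr_of_fun f \<psi>" if \<psi>: "\<psi> \<in> schwartz"
    using i[OF \<open>\<phi> \<in> schwartz\<close>] i[OF \<psi>]
    by (simp add: distr_of_fun_def schwartz_add assms \<psi> ring_distribs)
  have "(LINT x|lebesgue. f x * (c * \<phi> x)) = (LINT x|lebesgue. c * (f x * \<phi> x))"
    by (simp add: mult_ac)
  then show "distr_of_fun f (\<lambda>x. c * \<phi> x) = c * distr_of_fun f \<phi>"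
    by (simp add: distr_of_fun_def schwartz_cmult assms)
qed

lemma Lp_norm_le_0_imp_AE_0:
  assumes f: "f \<in> Lp p" and p: "1 \<le> p" and "Lp_norm p f \<le> 0"
  shows "AE x in lebesgue. f x = 0"
proof -
  have "Lp_norm p f = 0" using assms(3) Lp_norm_nonneg[of p f] by linarith
  then have "(LINT x|lebesgue. norm (f x) powr p) = 0"
    using Lp_norm_powr[of p f] p by simp
  then have "AE x in lebesgue. norm (f x) powr p = 0"
    using f by (subst (asm) integral_nonneg_eq_0_iff_AE) (auto simp: Lp_def)
  then show ?thesis by eventually_elim simp
qed

text \<open>If \<open>d\<^sub>s v = d\<^sub>s v'\<close>, \<open>frac_grad_in_L1_plus_W_representation\<close>
  with \<open>F = 0\<close> shows that \<open>v\<close> and \<open>v'\<close> differ by a constant,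
  which has to be zero.\<close>

lemma W_od_norm_frac_grad:
  fixes v :: "real^'n \<Rightarrow> complex"
  assumes s: "0 < s" "s < 1" and p: "p = real CARD('n) / (real CARD('n) - s)" and v: "v \<in> Lp p"
  shows "W_od_norm s p (frac_grad s (distr_of_fun v)) = Lp_norm p v"
proof -
  have "1 \<le> real CARD('n)" by (simp add: Suc_leI)
  then have "s < real CARD('n)" using s by linarith
  then have p1: "1 \<le> p" using s unfolding p by (subst pos_le_divide_eq) auto
  have eq: "Lp_norm p v' = Lp_norm p v"
    if v': "v' \<in> Lp p" and "frac_grad s (distr_of_fun v) = frac_grad s (distr_of_fun v')" for v'
  proof -
    have zero: "(\<lambda>_. 0) \<in> (L1_od :: ((real^'n) \<times> (real^'n) \<Rightarrow> complex) set)"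
      by (simp add: L1_od_def case_prod_beta')
    have "\<exists>C. \<exists>f\<in>Lp p. Lp_norm p f \<le> p powr (1 / p) / iso_const s CARD('n) * L1_od_norm (\<lambda>_::(real^'n) \<times> (real^'n). 0) \<and>
        (\<forall>\<phi>\<in>schwartz. distr_of_fun v' \<phi> = C * integral\<^sup>L lebesgue \<phi>
          + (LINT x|lebesgue. f x * \<phi> x) + (LINT x|lebesgue. v x * \<phi> x))"
    proof (rule frac_grad_in_L1_plus_W_representation[OF s p])
      show "frac_grad s (distr_of_fun v') G = distr_of_L1_od (\<lambda>_. 0) G + frac_grad s (distr_of_fun v) G"
        if "G \<in> schwartz_od" for G
        using that by (simp add: \<open>frac_grad s (distr_of_fun v) = _\<close> distr_of_L1_od_def case_prod_beta')
    qed (fact zero v distr_of_fun_Lp_linear[OF v' p1])+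
    then obtain C f where f: "f \<in> Lp p"
        "Lp_norm p f \<le> p powr (1 / p) / iso_const s CARD('n) * L1_od_norm (\<lambda>_::(real^'n) \<times> (real^'n). 0)"
      and rep: "\<And>\<phi>. \<phi> \<in> schwartz \<Longrightarrow> distr_of_fun v' \<phi> = C * integral\<^sup>L lebesgue \<phi>
       + (LINT x|lebesgue. f x * \<phi> x) + (LINT x|lebesgue. v x * \<phi> x)"
      by blast
    have "L1_od_norm (\<lambda>_::(real^'n) \<times> (real^'n). 0) = 0" by (simp add: L1_od_norm_def case_prod_beta')
    then have f0: "AE x in lebesgue. f x = 0" using Lp_norm_le_0_imp_AE_0[OF f(1) p1] f(2) by simp
    have "AE x in lebesgue. v' x = f x + v x"
    proof (rule Lp_plus_const_unique(2)[OF v' Lp_add(1)[OF f(1) v p1] p1])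
      fix \<phi> :: "real^'n \<Rightarrow> complex" assume \<phi>: "\<phi> \<in> schwartz"
      show "(LINT x|lebesgue. v' x * \<phi> x) + 0 * integral\<^sup>L lebesgue \<phi>
          = (LINT x|lebesgue. (f x + v x) * \<phi> x) + C * integral\<^sup>L lebesgue \<phi>"
        using rep[OF \<phi>] Lp_mult_schwartz_integrable[OF f(1) p1 \<phi>] Lp_mult_schwartz_integrable[OF v p1 \<phi>] \<phi>
        by (simp add: distr_of_fun_def ring_distribs)
    qed
    with f0 have ae: "AE x in lebesgue. v' x = v x" by eventually_elim simp
    have "v \<in> borel_measurable lebesgue" using v by (simp add: Lp_def)
    then show ?thesis by (rule Lp_cong_AE(2)[OF v' _ ae])
  qed
  show ?thesis
    unfolding W_od_norm_def
  proof (rule the_equality)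
    show "\<exists>v'\<in>Lp p. frac_grad s (distr_of_fun v) = frac_grad s (distr_of_fun v') \<and> Lp_norm p v = Lp_norm p v'"
      using v by (intro bexI[of _ v] conjI refl)
    show "r = Lp_norm p v"
      if "\<exists>v'\<in>Lp p. frac_grad s (distr_of_fun v) = frac_grad s (distr_of_fun v') \<and> r = Lp_norm p v'" for r
      using that
    proof (elim bexE conjE)
      fix v' assume v': "v' \<in> Lp p" "frac_grad s (distr_of_fun v) = frac_grad s (distr_of_fun v')" "r = Lp_norm p v'"
      show "r = Lp_norm p v" unfolding v'(3) by (rule eq[OF v'(1,2)])
    qed
  qed
qed

theorem theorem4p7:
  fixes s p :: real
  assumes "0 < s" and "s < 1"
    and p: "p = real CARD('n::finite) / (real CARD('n) - s)"
  shows "\<exists>K>0. \<forall>u \<in> (tempered :: ((real^'n \<Rightarrow> complex) \<Rightarrow> complex) set).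
    frac_grad s u \<in> L1_plus_W_od s p \<longrightarrow>
    (\<exists>C. \<exists>f \<in> Lp p.
       (\<lambda>\<phi> \<in> schwartz. u \<phi> - distr_of_fun (\<lambda>_. C) \<phi>) = distr_of_fun f \<and>
       Lp_norm p f \<le> K * L1_plus_W_od_norm s p (frac_grad s u))"
proof -
  note s = assms(1,2)
  have "1 \<le> real CARD('n)" by (simp add: Suc_leI)
  then have "s < real CARD('n)" using s by linarith
  then have p1: "1 \<le> p" using s unfolding p by (subst pos_le_divide_eq) auto
  define K0 where "K0 = p powr (1 / p) / iso_const s CARD('n)"
  have K0: "0 \<le> K0" using iso_const_pos[of s "CARD('n)"] by (simp add: K0_def)
  define K where "K = 4 * (K0 + 1)"
  have K: "0 < K" using K0 by (simp add: K_def)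
  have "\<exists>C. \<exists>f \<in> Lp p.
       (\<lambda>\<phi> \<in> schwartz. u \<phi> - distr_of_fun (\<lambda>_. C) \<phi>) = distr_of_fun f \<and>
       Lp_norm p f \<le> K * L1_plus_W_od_norm s p (frac_grad s u)"
    if u: "u \<in> tempered" and dsu: "frac_grad s u \<in> L1_plus_W_od s p" for u :: "(real^'n \<Rightarrow> complex) \<Rightarrow> complex"
  proof -
    have uadd: "u (\<lambda>x. f x + g x) = u f + u g" if "f \<in> schwartz" "g \<in> schwartz" for f g
      using u that by (simp add: tempered_def topological_dual_def)
    have umult: "u (\<lambda>x. c * f x) = c * u f" if "f \<in> schwartz" for f c
      using u that by (simp add: tempered_def topological_dual_def)
    have rep: "\<exists>C f. f \<in> Lp p \<and> (\<forall>\<phi>\<in>schwartz. u \<phi> = (LINT x|lebesgue. f x * \<phi> x) + C * integral\<^sup>L lebesgue \<phi>)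
        \<and> Lp_norm p f \<le> K * (L1_od_norm F + W_od_norm s p V)"
      if dec: "is_decomposition_od s p (frac_grad s u) F V" for F V
    proof -
      obtain v where v: "v \<in> Lp p" "V = frac_grad s (distr_of_fun v)"
        using dec by (auto simp: is_decomposition_od_def W_od_def)
      have F: "F \<in> L1_od" using dec by (simp add: is_decomposition_od_def)
      have dec': "frac_grad s u G = distr_of_L1_od F G + frac_grad s (distr_of_fun v) G"
        if "G \<in> schwartz_od" for G
        using dec that v(2) by (simp add: is_decomposition_od_def)
      have "\<exists>C. \<exists>f\<in>Lp p. Lp_norm p f \<le> K0 * L1_od_norm F \<and>
        (\<forall>\<phi>\<in>schwartz. u \<phi> = C * integral\<^sup>L lebesgue \<phi>
          + (LINT x|lebesgue. f x * \<phi> x) + (LINT x|lebesgue. v x * \<phi> x))"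
        unfolding K0_def
        by (rule frac_grad_in_L1_plus_W_representation[OF s p]) (fact uadd umult F v(1) dec')+
      then obtain C f where f: "f \<in> Lp p" "Lp_norm p f \<le> K0 * L1_od_norm F"
        and fv: "\<And>\<phi>. \<phi> \<in> schwartz \<Longrightarrow> u \<phi> = C * integral\<^sup>L lebesgue \<phi>
          + (LINT x|lebesgue. f x * \<phi> x) + (LINT x|lebesgue. v x * \<phi> x)"
        by blast
      have nn: "0 \<le> L1_od_norm F" "0 \<le> Lp_norm p v"
        unfolding L1_od_norm_def by (auto intro!: integral_nonneg_AE Lp_norm_nonneg)
      show ?thesis
      proof (intro exI conjI ballI)
        show "(\<lambda>x. f x + v x) \<in> Lp p" by (rule Lp_add(1)[OF f(1) v(1) p1])
        show "u \<phi> = (LINT x|lebesgue. (f x + v x) * \<phi> x) + C * integral\<^sup>L lebesgue \<phi>" if "\<phi> \<in> schwartz" for \<phi>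
          using fv[OF that] Lp_mult_schwartz_integrable[OF f(1) p1 that] Lp_mult_schwartz_integrable[OF v(1) p1 that]
          by (simp add: ring_distribs)
        have "Lp_norm p (\<lambda>x. f x + v x) \<le> 4 * (Lp_norm p f + Lp_norm p v)"
          by (rule Lp_add(2)[OF f(1) v(1) p1])
        also have "\<dots> \<le> 4 * (K0 * L1_od_norm F + Lp_norm p v)" using f(2) by simp
        also have "\<dots> \<le> K * (L1_od_norm F + Lp_norm p v)"
          using nn K0 by (simp add: K_def algebra_simps)
        also have "Lp_norm p v = W_od_norm s p V" unfolding v(2) by (rule W_od_norm_frac_grad[OF s p v(1), symmetric])
        finally show "Lp_norm p (\<lambda>x. f x + v x) \<le> K * (L1_od_norm F + W_od_norm s p V)" .
      qed
    qed
    obtain F0 V0 where dec0: "is_decomposition_od s p (frac_grad s u) F0 V0"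
      using dsu by (auto simp: L1_plus_W_od_def)
    obtain C f where f: "f \<in> Lp p"
      and fu: "\<And>\<phi>. \<phi> \<in> schwartz \<Longrightarrow> u \<phi> = (LINT x|lebesgue. f x * \<phi> x) + C * integral\<^sup>L lebesgue \<phi>"
      using rep[OF dec0] by blast
    \<comment> \<open>Every decomposition produces the same \<open>f\<close> up to null sets, so its bound holds for \<open>f\<close>.\<close>
    have "Lp_norm p f / K \<le> L1_plus_W_od_norm s p (frac_grad s u)"
      unfolding L1_plus_W_od_norm_def
    proof (rule cInf_greatest)
      show "{L1_od_norm F + W_od_norm s p V |F V. is_decomposition_od s p (frac_grad s u) F V} \<noteq> {}"
        using dec0 by blast
      fix r assume "r \<in> {L1_od_norm F + W_od_norm s p V |F V. is_decomposition_od s p (frac_grad s u) F V}"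
      then obtain F V where r: "r = L1_od_norm F + W_od_norm s p V" and dec: "is_decomposition_od s p (frac_grad s u) F V"
        by blast
      obtain C' f' where f': "f' \<in> Lp p" "Lp_norm p f' \<le> K * r"
        and fu': "\<And>\<phi>. \<phi> \<in> schwartz \<Longrightarrow> u \<phi> = (LINT x|lebesgue. f' x * \<phi> x) + C' * integral\<^sup>L lebesgue \<phi>"
        using rep[OF dec] unfolding r by blast
      have ae: "AE x in lebesgue. f x = f' x"
      proof (rule Lp_plus_const_unique(2)[OF f f'(1) p1])
        fix \<phi> :: "real^'n \<Rightarrow> complex" assume \<phi>: "\<phi> \<in> schwartz"
        show "(LINT x|lebesgue. f x * \<phi> x) + C * integral\<^sup>L lebesgue \<phi>
            = (LINT x|lebesgue. f' x * \<phi> x) + C' * integral\<^sup>L lebesgue \<phi>"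
          by (rule trans[OF fu[OF \<phi>, symmetric] fu'[OF \<phi>]])
      qed
      have "f' \<in> borel_measurable lebesgue" using f'(1) by (simp add: Lp_def)
      then have "Lp_norm p f = Lp_norm p f'" by (rule Lp_cong_AE(2)[OF f _ ae])
      then show "Lp_norm p f / K \<le> r" using f'(2) K by (simp add: pos_divide_le_eq mult.commute)
    qed
    then have "Lp_norm p f \<le> K * L1_plus_W_od_norm s p (frac_grad s u)"
      using K by (simp add: pos_divide_le_eq mult.commute)
    moreover have "(\<lambda>\<phi> \<in> schwartz. u \<phi> - distr_of_fun (\<lambda>_. C) \<phi>) = distr_of_fun f"
      by (auto simp: distr_of_fun_def fun_eq_iff restrict_def fu)
    ultimately show ?thesis using f by blast
  qed
  then show ?thesis using K by blast
qed

end
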